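(* Let $\gamma>0$, $\kappa>0$ and $g_{11},g_{22},g_{12}\in\mathbb{R}$ with $g_{11}=g_{22}=g_{12}$, and consider the system $$ \begin{aligned} i u_t &= -u_{xx} + \kappa v + i\gamma u - (g_{11}|u|^2 + g_{12}|v|^2)u,\\ i v_t &= -v_{xx} + \kappa u - i\gamma v - (g_{12}|u|^2 + g_{22}|v|^2)v. \end{aligned} $$ (i) If $\gamma<\kappa$, then for any global solution $(u(t),v(t))\in C(\mathbb{R},H^1(\mathbb{R})\times H^1(\mathbb{R}))$ of the system there exists a constant $Q_{max}>0$ such that $$ \sup_{t\in\mathbb{R}}\left(\|u(t)\|_{L^2}^2+\|v(t)\|_{L^2}^2\right)\le Q_{max}. $$ (ii) If $\gamma\ge\kappa$, then there exists a global solution $(u(t),v(t))\in C(\mathbb{R},H^1(\mathbb{R})\times H^1(\mathbb{R}))$ of the system such that $$ \lim_{t\to\infty}\left(\|u(t)\|_{L^2}^2+\|v(t)\|_{L^2}^2\right)=\infty. $$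
   Context: Here $u=u(x,t)$ and $v=v(x,t)$ are complex-valued functions of $x\in\mathbb{R}$ and $t\in\mathbb{R}$, $H^1(\mathbb{R})$ is the $L^2$-based Sobolev space of complex-valued functions, and $\|\cdot\|_{L^2}$ is the norm of $L^2(\mathbb{R})$ in the variable $x$. A solution in $C(\mathbb{R},H^1(\mathbb{R})\times H^1(\mathbb{R}))$ is understood in the usual sense for semilinear Schrödinger equations: it satisfies the Duhamel integral form of the system (equivalently, the equations hold in $H^{-1}(\mathbb{R})$ for every $t$). For every initial datum $(u(0),v(0))=(u_0,v_0)\in H^1(\mathbb{R})\times H^1(\mathbb{R})$ the system has a unique such global solution. *)

theory Defs
  imports "HOL-Analysis.Analysis"
begin

text \<open>
  Elements of \<open>L\<^sup>2\<close> and \<open>H\<^sup>1\<close> are represented by functions, not by classes modulo null sets;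
  every notion below is invariant under changes on a null set.
\<close>

definition L2 :: "(real \<Rightarrow> complex) \<Rightarrow> bool" where
  "L2 f \<longleftrightarrow> f \<in> borel_measurable lebesgue \<and> integrable lebesgue (\<lambda>x. (cmod (f x))\<^sup>2)"

definition L2_norm :: "(real \<Rightarrow> complex) \<Rightarrow> real" where
  "L2_norm f = sqrt (\<integral>x. (cmod (f x))\<^sup>2 \<partial>lebesgue)"

definition test_function :: "(real \<Rightarrow> real) \<Rightarrow> bool" where
  "test_function \<phi> \<longleftrightarrow>
     (\<forall>n x. (deriv ^^ n) \<phi> field_differentiable (at x)) \<and> compact (closure {x. \<phi> x \<noteq> 0})"

definition has_weak_deriv :: "(real \<Rightarrow> complex) \<Rightarrow> (real \<Rightarrow> complex) \<Rightarrow> bool" where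
  "has_weak_deriv f g \<longleftrightarrow>
     (\<forall>\<phi>. test_function \<phi> \<longrightarrow>
        (\<integral>x. f x * of_real (deriv \<phi> x) \<partial>lebesgue) = - (\<integral>x. g x * of_real (\<phi> x) \<partial>lebesgue))"

definition H1 :: "(real \<Rightarrow> complex) \<Rightarrow> bool" where
  "H1 f \<longleftrightarrow> L2 f \<and> (\<exists>g. L2 g \<and> has_weak_deriv f g)"

text \<open>The weak derivative is unique up to null sets; one representative is chosen.\<close>

definition weak_deriv :: "(real \<Rightarrow> complex) \<Rightarrow> (real \<Rightarrow> complex)" where
  "weak_deriv f = (SOME g. L2 g \<and> has_weak_deriv f g)"

definition H1_norm :: "(real \<Rightarrow> complex) \<Rightarrow> real" where
  "H1_norm f = sqrt ((L2_norm f)\<^sup>2 + (L2_norm (weak_deriv f))\<^sup>2)"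

text \<open>
  \<open>H\<^sup>-\<^sup>1\<close> is the space of bounded complex-linear functionals on \<open>H\<^sup>1\<close>. The duality is bilinear,
  i.e. no complex conjugate is taken, and extends the pairing of distributions with test
  functions.
\<close>

definition Hm1 :: "((real \<Rightarrow> complex) \<Rightarrow> complex) \<Rightarrow> bool" where
  "Hm1 L \<longleftrightarrow>
     (\<forall>\<phi> \<psi>. H1 \<phi> \<longrightarrow> H1 \<psi> \<longrightarrow> L (\<lambda>x. \<phi> x + \<psi> x) = L \<phi> + L \<psi>) \<and>
     (\<forall>c \<phi>. H1 \<phi> \<longrightarrow> L (\<lambda>x. c * \<phi> x) = c * L \<phi>) \<and>
     (\<exists>C. \<forall>\<phi>. H1 \<phi> \<longrightarrow> cmod (L \<phi>) \<le> C * H1_norm \<phi>)"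

definition pairing :: "(real \<Rightarrow> complex) \<Rightarrow> (real \<Rightarrow> complex) \<Rightarrow> complex" where
  "pairing f \<phi> = (\<integral>x. f x * \<phi> x \<partial>lebesgue)"

text \<open>The functional \<open>-f\<^sub>x\<^sub>x \<in> H\<^sup>-\<^sup>1\<close> of a function \<open>f \<in> H\<^sup>1\<close>.\<close>

definition minus_dxx :: "(real \<Rightarrow> complex) \<Rightarrow> (real \<Rightarrow> complex) \<Rightarrow> complex" where
  "minus_dxx f \<phi> = pairing (weak_deriv f) (weak_deriv \<phi>)"

text \<open>
  The curve \<open>w\<close>, with time as its first argument, is differentiable at \<open>t\<close> in the norm of \<open>H\<^sup>-\<^sup>1\<close>,
  with derivative \<open>L\<close>: the bound on all \<open>\<phi>\<close> below says that the dual norm of the difference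
  between the quotient and \<open>L\<close> is at most \<open>\<epsilon>\<close>.
\<close>

definition has_Hm1_derivative ::
  "(real \<Rightarrow> real \<Rightarrow> complex) \<Rightarrow> ((real \<Rightarrow> complex) \<Rightarrow> complex) \<Rightarrow> real \<Rightarrow> bool" where
  "has_Hm1_derivative w L t \<longleftrightarrow>
     Hm1 L \<and>
     (\<forall>\<epsilon>>0. \<forall>\<^sub>F s in at t. \<forall>\<phi>. H1 \<phi> \<longrightarrow>
        cmod ((pairing (w s) \<phi> - pairing (w t) \<phi>) / of_real (s - t) - L \<phi>) \<le> \<epsilon> * H1_norm \<phi>)"

definition continuous_H1 :: "(real \<Rightarrow> real \<Rightarrow> complex) \<Rightarrow> bool" where
  "continuous_H1 w \<longleftrightarrow>
     (\<forall>t. H1 (w t)) \<and> (\<forall>t. ((\<lambda>s. H1_norm (\<lambda>x. w s x - w t x)) \<longlongrightarrow> 0) (at t))"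

text \<open>
  \<open>(u, v)\<close> belongs to \<open>C(\<real>, H\<^sup>1 \<times> H\<^sup>1)\<close> and solves the system in \<open>H\<^sup>-\<^sup>1\<close> for every time; \<open>u t x\<close>
  stands for \<open>u(x,t)\<close>.
\<close>

definition global_solution ::
  "real \<Rightarrow> real \<Rightarrow> real \<Rightarrow> real \<Rightarrow> real \<Rightarrow>
   (real \<Rightarrow> real \<Rightarrow> complex) \<Rightarrow> (real \<Rightarrow> real \<Rightarrow> complex) \<Rightarrow> bool" where
  "global_solution \<gamma> \<kappa> g11 g22 g12 u v \<longleftrightarrow>
     continuous_H1 u \<and> continuous_H1 v \<and>
     (\<forall>t. \<exists>u' v'. has_Hm1_derivative u u' t \<and> has_Hm1_derivative v v' t \<and>
       (\<forall>\<phi>. H1 \<phi> \<longrightarrow>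
          \<i> * u' \<phi> = minus_dxx (u t) \<phi> + of_real \<kappa> * pairing (v t) \<phi>
             + \<i> * of_real \<gamma> * pairing (u t) \<phi>
             - pairing (\<lambda>x. of_real (g11 * (cmod (u t x))\<^sup>2 + g12 * (cmod (v t x))\<^sup>2) * u t x) \<phi> \<and>
          \<i> * v' \<phi> = minus_dxx (v t) \<phi> + of_real \<kappa> * pairing (u t) \<phi>
             - \<i> * of_real \<gamma> * pairing (v t) \<phi>
             - pairing (\<lambda>x. of_real (g12 * (cmod (u t x))\<^sup>2 + g22 * (cmod (v t x))\<^sup>2) * v t x) \<phi>))"

end

theory Submission
  imports Defs
begin

text \<open>
  Both parts rest on the fact that equal coefficients make the nonlinear terms act on \<open>u\<close> and \<open>v\<close> by
  one and the same real factor \<open>g (|u|\<^sup>2 + |v|\<^sup>2)\<close>.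

  Part (i). Because of the common factor, the nonlinear terms drop out of the derivatives of
  \<open>Q = \<parallel>u\<parallel>\<^sup>2 + \<parallel>v\<parallel>\<^sup>2\<close> and of \<open>P = Im \<integral> v cnj u\<close>, and \<open>\<kappa> Q + 2 \<gamma> P\<close> is conserved. As
  \<open>|2 P| \<le> Q\<close>, the conserved quantity bounds \<open>(\<kappa> - \<gamma>) Q\<close>. The derivatives have to be taken for
  curves that are only differentiable in the dual of \<open>H\<^sup>1\<close>; this is \<open>hermitian_pairing_quotient\<close>, and
  the conclusion is \<open>mass_bounded\<close>.

  Part (ii). The linear coupling matrix has a solution \<open>(a, b)\<close> without spatial dependence for which
  \<open>\<rho> = |a|\<^sup>2 + |b|\<^sup>2\<close> tends to infinity if \<open>\<gamma> \<ge> \<kappa>\<close>: exponentially for \<open>\<gamma> > \<kappa>\<close>, and quadratically in the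
  resonant case \<open>\<gamma> = \<kappa>\<close>, where the matrix is nilpotent. The ansatz \<open>u = a \<psi>\<close>, \<open>v = b \<psi>\<close> turns the
  system into the single equation
  \<open>i \<psi>\<^sub>t = - \<psi>\<^sub>x\<^sub>x - g \<rho>(t) |\<psi>|\<^sup>2 \<psi>\<close>, which preserves \<open>\<parallel>\<psi>\<parallel>\<close>, so that \<open>Q = \<rho> \<parallel>\<psi>\<parallel>\<^sup>2\<close> grows. What remains is
  a global \<open>H\<^sup>1\<close> solution of this equation for one nonzero datum, and most of the text is about it.

  The solution is a limit of solutions \<open>\<phi> n\<close> of ordinary differential equations in the Hilbert space
  \<open>L\<^sup>2\<close>, in which \<open>- \<partial>\<^sub>x\<^sub>x\<close> is replaced by the second difference operator \<open>A n\<close> with step \<open>2\<^sup>-\<^sup>n\<close> and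
  the cubic term by a globally Lipschitz truncation at the height \<open>r(t)\<close>. Three observations carry the
  argument.

  \<^item> Differentiating in time (as a Gronwall estimate on time increments) bounds \<open>A n (\<phi> n)\<close> uniformly in
    \<open>n\<close>. Translation invariance bounds \<open>\<phi> n\<close> in \<open>H\<^sup>1\<close> in the same way. By the factorization
    \<open>A\<^sub>n\<^sub>+\<^sub>1 - A\<^sub>n = (k\<^sup>2/4) A\<^sub>n\<^sub>+\<^sub>1\<^sup>2\<close>, \<open>k = 2\<^sup>-\<^sup>n\<^sup>-\<^sup>1\<close>, these bounds give
    \<open>\<parallel>\<phi> (n+1) - \<phi> n\<parallel>\<^sup>2 = O(2\<^sup>-\<^sup>n)\<close>, so the approximations converge, locally uniformly in time.

  \<^item> The limit stays in the set where second differences are bounded. Interpolation between this bound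
    and the Lipschitz continuity in \<open>L\<^sup>2\<close> yields continuity in \<open>H\<^sup>1\<close> and the equation in the dual of \<open>H\<^sup>1\<close>.

  \<^item> The truncated potential energy is at most \<open>|g| \<rho> r\<^sup>2 \<parallel>\<phi>\<parallel>\<^sup>2 / 2\<close>. Energy bounds \<open>\<parallel>\<psi>\<^sub>x\<parallel>\<^sup>2\<close> by a multiple of
    \<open>1 + \<rho> r\<^sup>2\<close>, hence \<open>sup |\<psi>|\<^sup>2 \<le> 4 \<parallel>\<psi>\<parallel> \<parallel>\<psi>\<^sub>x\<parallel>\<close> grows no faster than \<open>(\<rho> r\<^sup>2)\<^sup>1\<^sup>/\<^sup>2\<close>, which is below \<open>r\<^sup>2\<close> for
    \<open>r = R \<rho>\<close> and large \<open>R\<close>: the truncation never acts.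

  The Sobolev space is accessible through difference quotients: \<open>f\<close> has a weak derivative in \<open>L\<^sup>2\<close> if
  and only if the quotients \<open>D n f\<close> converge in \<open>L\<^sup>2\<close>, and the limit is the derivative
  (\<open>weak_deriv_imp_h1\<close>, \<open>h1_imp_weak_deriv\<close>). All algebra of \<open>H\<^sup>1\<close> then follows from that of limits.
\<close>

section \<open>The Hilbert space of square integrable functions\<close>

lemma L2_measurable [measurable_dest]: "L2 f \<Longrightarrow> f \<in> borel_measurable lebesgue"
  by (simp add: L2_def)

lemma L2_integrable: "L2 f \<Longrightarrow> integrable lebesgue (\<lambda>x. (cmod (f x))\<^sup>2)"
  by (simp add: L2_def)

lemma L2I_bound:
  assumes [measurable]: "f \<in> borel_measurable lebesgue"
    and "integrable lebesgue w" and "AE x in lebesgue. (cmod (f x))\<^sup>2 \<le> w x"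
  shows "L2 f"
  unfolding L2_def
proof (intro conjI)
  show "integrable lebesgue (\<lambda>x. (cmod (f x))\<^sup>2)"
    by (rule Bochner_Integration.integrable_bound[OF assms(2)]) (use assms(3) in auto)
qed fact

lemma norm_add_sq_le: "(norm (a + b))\<^sup>2 \<le> 2 * (norm a)\<^sup>2 + 2 * (norm b)\<^sup>2" for a b :: "'a::real_normed_vector"
proof -
  have "(norm (a + b))\<^sup>2 \<le> (norm a + norm b)\<^sup>2"
    by (intro power_mono norm_triangle_ineq) auto
  also have "\<dots> \<le> 2 * (norm a)\<^sup>2 + 2 * (norm b)\<^sup>2"
    using sum_squares_bound[of "norm a" "norm b"] by (simp add: power2_sum)
  finally show ?thesis .
qed

lemma L2_add: assumes [measurable_dest]: "L2 f" "L2 g" shows "L2 (\<lambda>x. f x + g x)"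
proof (rule L2I_bound)
  show "integrable lebesgue (\<lambda>x. 2 * (cmod (f x))\<^sup>2 + 2 * (cmod (g x))\<^sup>2)"
    by (intro Bochner_Integration.integrable_add integrable_mult_right L2_integrable assms)
qed (use assms L2_measurable in \<open>auto simp: norm_add_sq_le\<close>)

lemma L2_lipschitz:
  assumes "L2 f" and "\<And>z. cmod (F z) \<le> c * cmod z" and [measurable]: "F \<in> borel_measurable borel"
  shows "L2 (\<lambda>x. F (f x))"
proof (rule L2I_bound)
  show "integrable lebesgue (\<lambda>x. c\<^sup>2 * (cmod (f x))\<^sup>2)"
    by (intro integrable_mult_right L2_integrable assms)
  show "AE x in lebesgue. (cmod (F (f x)))\<^sup>2 \<le> c\<^sup>2 * (cmod (f x))\<^sup>2"
    using power_mono[OF assms(2), of _ 2] by (simp add: power_mult_distrib)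
qed (use assms L2_measurable in \<open>auto intro!: measurable_compose[OF _ assms(3)]\<close>)

lemma L2_cmult: "L2 f \<Longrightarrow> L2 (\<lambda>x. c * f x)"
  by (rule L2_lipschitz[where F="(*) c" and c="cmod c"]) (auto simp: norm_mult)

lemma L2_cnj: "L2 f \<Longrightarrow> L2 (\<lambda>x. cnj (f x))"
  by (rule L2_lipschitz[where c=1]) (auto intro!: borel_measurable_continuous_onI continuous_intros)

lemma L2_shift: assumes "L2 f" shows "L2 (\<lambda>x. f (a + x))"
proof -
  have m: "(\<lambda>x. a + 1 * x) \<in> lebesgue \<rightarrow>\<^sub>M lebesgue"
    using lebesgue_affine_measurable[where c= "\<lambda>x::real. 1" and t=a] by simp
  have "integrable lebesgue (\<lambda>x. (cmod (f (a + 1 * x)))\<^sup>2)"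
    using lebesgue_integrable_real_affine_iff[of 1 "\<lambda>x. (cmod (f x))\<^sup>2" a] L2_integrable[OF assms] by simp
  then show ?thesis
    using measurable_compose[OF m L2_measurable[OF assms]] by (simp add: L2_def)
qed

lemma L2_mult_integrable:
  assumes "L2 f" "L2 g" shows "integrable lebesgue (\<lambda>x. f x * g x)"
proof (rule Bochner_Integration.integrable_bound)
  show "integrable lebesgue (\<lambda>x. (cmod (f x))\<^sup>2 + (cmod (g x))\<^sup>2)"
    by (intro Bochner_Integration.integrable_add L2_integrable assms)
  show "(\<lambda>x. f x * g x) \<in> borel_measurable lebesgue"
    using assms L2_measurable by auto
  have "cmod (z * w) \<le> norm ((cmod z)\<^sup>2 + (cmod w)\<^sup>2)" for z w
  proof -
    have "0 \<le> cmod z * cmod w" "cmod z * cmod w * 2 \<le> (cmod z)\<^sup>2 + (cmod w)\<^sup>2"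
      using sum_squares_bound[of "cmod z" "cmod w"] by (auto simp: algebra_simps)
    then show ?thesis unfolding norm_mult real_norm_def by linarith
  qed
  then show "AE x in lebesgue. cmod (f x * g x) \<le> norm ((cmod (f x))\<^sup>2 + (cmod (g x))\<^sup>2)"
    by auto
qed

lemma L2_cong_AE: "L2 f \<Longrightarrow> g \<in> borel_measurable lebesgue \<Longrightarrow> AE x in lebesgue. f x = g x \<Longrightarrow> L2 g"
  by (rule L2I_bound[OF _ L2_integrable[of f]]) auto

lemma AE_shift:
  assumes "AE x in lebesgue. P x" shows "AE x in lebesgue. P (a + x :: real)"
proof -
  obtain N where N: "N \<in> null_sets lebesgue" "{x. \<not> P x} \<subseteq> N"
    using assms by (auto simp: eventually_ae_filter)
  have "(\<lambda>x. - a + x) ` N \<in> null_sets lebesgue"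
    using negligible_translation[of N "-a"] N(1) by (simp add: negligible_iff_null_sets)
  moreover have "{x. \<not> P (a + x)} \<subseteq> (\<lambda>x. - a + x) ` N"
  proof
    fix x assume "x \<in> {x. \<not> P (a + x)}"
    then have "a + x \<in> N" using N by auto
    then show "x \<in> (\<lambda>x. - a + x) ` N" by (rule rev_image_eqI) simp
  qed
  ultimately show ?thesis
    by (auto simp: eventually_ae_filter)
qed

text \<open>
  Evolution equations and limits take place in a complete inner product space, hence classes
  modulo null sets. The inner product is the real one, \<open>Re \<integral> f cnj g\<close>: energy identities are
  statements about real parts, and skew-adjointness of \<open>- i A\<close> becomes orthogonality.
\<close>

quotient_type l2 = "real \<Rightarrow> complex" / partial: "\<lambda>f g. L2 f \<and> L2 g \<and> (AE x in lebesgue. f x = g x)"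
proof (rule part_equivpI)
  have "L2 (\<lambda>_. 0)" by (simp add: L2_def)
  then show "\<exists>f. L2 f \<and> L2 f \<and> (AE x in lebesgue. f x = f x)" by auto
qed (auto intro!: sympI transpI elim: eventually_elim2)

abbreviation mk :: "(real \<Rightarrow> complex) \<Rightarrow> l2" where "mk \<equiv> abs_l2"
abbreviation fn :: "l2 \<Rightarrow> real \<Rightarrow> complex" where "fn \<equiv> rep_l2"

lemma L2_fn [simp, intro]: "L2 (fn f)"
  using Quotient3_rep_reflp[OF Quotient3_l2, of f] by auto

lemma fn_measurable [measurable]: "fn f \<in> borel_measurable lebesgue"
  using L2_measurable[OF L2_fn] .

lemma mk_fn [simp]: "mk (fn f) = f"
  by (rule Quotient3_abs_rep[OF Quotient3_l2])

lemma mk_eq_iff: "L2 f \<Longrightarrow> L2 g \<Longrightarrow> mk f = mk g \<longleftrightarrow> (AE x in lebesgue. f x = g x)"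
  using Quotient3_rel[OF Quotient3_l2, of f g] by auto

lemma fn_mk: "L2 f \<Longrightarrow> AE x in lebesgue. fn (mk f) x = f x"
  using mk_eq_iff[of "fn (mk f)" f] by auto

lemma l2_eqI: "AE x in lebesgue. fn f x = fn g x \<Longrightarrow> f = g"
  using mk_eq_iff[of "fn f" "fn g"] by auto

lemma l2_eq_iff: "f = g \<longleftrightarrow> (AE x in lebesgue. fn f x = fn g x)"
  using l2_eqI by auto

definition cscale :: "complex \<Rightarrow> l2 \<Rightarrow> l2" where "cscale c f = mk (\<lambda>x. c * fn f x)"
definition conjug :: "l2 \<Rightarrow> l2" where "conjug f = mk (\<lambda>x. cnj (fn f x))"
definition shift :: "real \<Rightarrow> l2 \<Rightarrow> l2" where "shift a f = mk (\<lambda>x. fn f (a + x))"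
definition pair :: "l2 \<Rightarrow> l2 \<Rightarrow> complex" where "pair f g = pairing (fn f) (fn g)"

lemma fn_cscale: "AE x in lebesgue. fn (cscale c f) x = c * fn f x"
  unfolding cscale_def by (intro fn_mk L2_cmult L2_fn)
lemma fn_conjug: "AE x in lebesgue. fn (conjug f) x = cnj (fn f x)"
  unfolding conjug_def by (intro fn_mk L2_cnj L2_fn)
lemma fn_shift: "AE x in lebesgue. fn (shift a f) x = fn f (a + x)"
  unfolding shift_def by (intro fn_mk L2_shift L2_fn)

instantiation l2 :: real_inner
begin

definition "0 = mk (\<lambda>_. 0)"
definition "f + g = mk (\<lambda>x. fn f x + fn g x)"
definition "- f = cscale (-1) f" for f :: l2
definition "f - g = f + - g" for f g :: l2
definition "scaleR r f = cscale (of_real r) f"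
definition "inner f g = (\<integral>x. Re (fn f x * cnj (fn g x)) \<partial>lebesgue)"
definition "norm f = sqrt (inner f f)" for f :: l2
definition "dist f g = norm (f - g)" for f g :: l2
definition "sgn f = scaleR (inverse (norm f)) f" for f :: l2
definition "(uniformity :: (l2 \<times> l2) filter) = (INF e\<in>{0<..}. principal {(x, y). dist x y < e})"
definition "open (U::l2 set) = (\<forall>x\<in>U. \<forall>\<^sub>F (x', y) in uniformity. x' = x \<longrightarrow> y \<in> U)"

lemma fn_0: "AE x in lebesgue. fn 0 x = 0"
  unfolding zero_l2_def by (intro fn_mk) (simp add: L2_def)
lemma fn_plus: "AE x in lebesgue. fn (f + g) x = fn f x + fn g x"
  unfolding plus_l2_def by (intro fn_mk L2_add L2_fn)
lemma fn_uminus: "AE x in lebesgue. fn (- f) x = - fn f x"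
  unfolding uminus_l2_def using fn_cscale[of "-1" f] by simp
lemma fn_minus: "AE x in lebesgue. fn (f - g) x = fn f x - fn g x"
  unfolding minus_l2_def using fn_plus[of f "-g"] fn_uminus[of g] by eventually_elim simp
lemma fn_scaleR: "AE x in lebesgue. fn (scaleR r f) x = r *\<^sub>R fn f x"
  unfolding scaleR_l2_def using fn_cscale[of "of_real r" f] by (simp add: scaleR_conv_of_real)

lemma integrable_inner: "integrable lebesgue (\<lambda>x. Re (fn f x * cnj (fn g x)))"
  by (intro integrable_Re L2_mult_integrable L2_fn L2_cnj)

instance
proof
  fix f g h :: l2 and r s :: real
  show "f + g + h = f + (g + h)"
    apply (rule l2_eqI)
    using fn_plus[of "f+g" h] fn_plus[of f g] fn_plus[of g h] fn_plus[of f "g+h"]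
    by eventually_elim simp
  show "f + g = g + f"
    apply (rule l2_eqI) using fn_plus[of f g] fn_plus[of g f] by eventually_elim simp
  show "0 + f = f"
    apply (rule l2_eqI) using fn_plus[of 0 f] fn_0 by eventually_elim simp
  show "- f + f = 0"
    apply (rule l2_eqI) using fn_plus[of "-f" f] fn_0 fn_uminus[of f] by eventually_elim simp
  show "f - g = f + - g" by (simp add: minus_l2_def)
  show "r *\<^sub>R (f + g) = r *\<^sub>R f + r *\<^sub>R g"
    apply (rule l2_eqI)
    using fn_plus[of "r *\<^sub>R f" "r *\<^sub>R g"] fn_plus[of f g] fn_scaleR[of r f] fn_scaleR[of r g] fn_scaleR[of r "f+g"]
    by eventually_elim (simp add: algebra_simps)
  show "(r + s) *\<^sub>R f = r *\<^sub>R f + s *\<^sub>R f"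
    apply (rule l2_eqI)
    using fn_plus[of "r *\<^sub>R f" "s *\<^sub>R f"] fn_scaleR[of r f] fn_scaleR[of s f] fn_scaleR[of "r+s" f]
    by eventually_elim (simp add: algebra_simps)
  show "r *\<^sub>R s *\<^sub>R f = (r * s) *\<^sub>R f"
    apply (rule l2_eqI)
    using fn_scaleR[of s f] fn_scaleR[of r "s *\<^sub>R f"] fn_scaleR[of "r * s" f]
    by eventually_elim simp
  show "1 *\<^sub>R f = f"
    apply (rule l2_eqI) using fn_scaleR[of 1 f] by eventually_elim simp
  show "dist f g = norm (f - g)" by (simp add: dist_l2_def)
  show "sgn f = inverse (norm f) *\<^sub>R f" by (simp add: sgn_l2_def)
  show "(uniformity :: (l2 \<times> l2) filter) = (INF e\<in>{0<..}. principal {(x, y). dist x y < e})"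
    by (simp add: uniformity_l2_def)
  show "open U = (\<forall>x\<in>U. \<forall>\<^sub>F (x', y) in uniformity. x' = x \<longrightarrow> y \<in> U)" for U :: "l2 set"
    by (simp add: open_l2_def)
  show "f \<bullet> g = g \<bullet> f"
    unfolding inner_l2_def by (intro Bochner_Integration.integral_cong) (auto simp: algebra_simps)
  have "(f + g) \<bullet> h = (\<integral>x. Re (fn f x * cnj (fn h x)) + Re (fn g x * cnj (fn h x)) \<partial>lebesgue)"
    unfolding inner_l2_def
  proof (rule integral_cong_AE)
    show "AE x in lebesgue. Re (fn (f + g) x * cnj (fn h x)) = Re (fn f x * cnj (fn h x)) + Re (fn g x * cnj (fn h x))"
      using fn_plus[of f g] by eventually_elim (simp add: algebra_simps)
  qed (intro borel_measurable_integrable Bochner_Integration.integrable_add integrable_inner)+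
  then show "(f + g) \<bullet> h = f \<bullet> h + g \<bullet> h"
    unfolding inner_l2_def by (simp only: Bochner_Integration.integral_add[OF integrable_inner integrable_inner])
  have "(r *\<^sub>R f) \<bullet> g = (\<integral>x. r * Re (fn f x * cnj (fn g x)) \<partial>lebesgue)"
    unfolding inner_l2_def
  proof (rule integral_cong_AE)
    show "AE x in lebesgue. Re (fn (r *\<^sub>R f) x * cnj (fn g x)) = r * Re (fn f x * cnj (fn g x))"
      using fn_scaleR[of r f] by eventually_elim (simp add: algebra_simps)
  qed (intro borel_measurable_integrable integrable_mult_right integrable_inner)+
  then show "(r *\<^sub>R f) \<bullet> g = r * (f \<bullet> g)"
    unfolding inner_l2_def by (simp only: integral_mult_right_zero)
  have sq: "Re (z * cnj z) = (cmod z)\<^sup>2" for z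
    by (simp add: complex_mult_cnj cmod_power2)
  show "0 \<le> f \<bullet> f"
    unfolding inner_l2_def sq by simp
  have "f \<bullet> f = 0 \<longleftrightarrow> (AE x in lebesgue. (cmod (fn f x))\<^sup>2 = 0)"
    unfolding inner_l2_def sq
    by (rule integral_nonneg_eq_0_iff_AE[OF L2_integrable[OF L2_fn]]) auto
  also have "\<dots> \<longleftrightarrow> (AE x in lebesgue. fn f x = fn 0 x)"
    using fn_0 by (auto elim: eventually_elim2)
  finally show "(f \<bullet> f = 0) = (f = 0)"
    by (simp add: l2_eq_iff)
  show "norm f = sqrt (f \<bullet> f)" by (simp add: norm_l2_def)
qed

end

lemma norm_l2_sq: "(norm f)\<^sup>2 = (\<integral>x. (cmod (fn f x))\<^sup>2 \<partial>lebesgue)" for f :: l2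
proof -
  have sq: "Re (z * cnj z) = (cmod z)\<^sup>2" for z
    by (simp add: complex_mult_cnj cmod_power2)
  show ?thesis
    unfolding power2_norm_eq_inner inner_l2_def sq ..
qed

lemma norm_mk_sq: "L2 f \<Longrightarrow> (norm (mk f))\<^sup>2 = (\<integral>x. (cmod (f x))\<^sup>2 \<partial>lebesgue)"
  unfolding norm_l2_sq
  by (rule integral_cong_AE)
     (use fn_mk[of f] in \<open>auto elim: eventually_mono dest: L2_measurable\<close>)

lemma L2_norm_mk: "L2 f \<Longrightarrow> L2_norm f = norm (mk f)"
  unfolding L2_norm_def using norm_mk_sq[of f] by (metis norm_ge_zero real_sqrt_unique)

lemma inner_mk:
  assumes "L2 f" "L2 g" shows "inner (mk f) (mk g) = (\<integral>x. Re (f x * cnj (g x)) \<partial>lebesgue)"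
  unfolding inner_l2_def
proof (rule integral_cong_AE)
  show "AE x in lebesgue. Re (fn (mk f) x * cnj (fn (mk g) x)) = Re (f x * cnj (g x))"
    using fn_mk[OF assms(1)] fn_mk[OF assms(2)] by eventually_elim simp
  show "(\<lambda>x. Re (f x * cnj (g x))) \<in> borel_measurable lebesgue"
    by (intro borel_measurable_integrable integrable_Re L2_mult_integrable assms L2_cnj)
qed (intro borel_measurable_integrable integrable_inner)

lemma L2_norm_fun: "L2 f \<Longrightarrow> L2 (\<lambda>x. of_real (cmod (f x)))"
  by (rule L2_lipschitz[where c=1 and F="\<lambda>z. of_real (cmod z)"]) auto

lemma norm_mk_norm:
  assumes "L2 f" shows "norm (mk (\<lambda>x. of_real (cmod (f x)))) = norm (mk f)"
proof (rule power2_eq_imp_eq)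
  show "(norm (mk (\<lambda>x. of_real (cmod (f x)))))\<^sup>2 = (norm (mk f))\<^sup>2"
    unfolding norm_mk_sq[OF assms] norm_mk_sq[OF L2_norm_fun[OF assms]] by simp
qed auto

lemma integral_norm_mult_le:
  assumes "L2 f" "L2 g" shows "(\<integral>x. cmod (f x * g x) \<partial>lebesgue) \<le> norm (mk f) * norm (mk g)"
proof -
  have "(\<integral>x. cmod (f x * g x) \<partial>lebesgue) = inner (mk (\<lambda>x. of_real (cmod (f x)))) (mk (\<lambda>x. of_real (cmod (g x))))"
    unfolding inner_mk[OF L2_norm_fun[OF assms(1)] L2_norm_fun[OF assms(2)]] by (simp add: norm_mult)
  also have "\<dots> \<le> norm (mk f) * norm (mk g)"
    using norm_cauchy_schwarz[of "mk (\<lambda>x. of_real (cmod (f x)))" "mk (\<lambda>x. of_real (cmod (g x)))"]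
    by (simp add: norm_mk_norm assms)
  finally show ?thesis .
qed

text \<open>
  Fatou's lemma: a bound on norms survives almost everywhere convergence. It identifies limits
  both in the completeness proof and for averages of functions.
\<close>

lemma l2_fatou:
  fixes Y :: "nat \<Rightarrow> l2"
  assumes lim: "AE x in lebesgue. (\<lambda>k. fn (Y k) x) \<longlonglongrightarrow> g x" and [measurable]: "g \<in> borel_measurable lebesgue"
    and B: "\<forall>\<^sub>F k in sequentially. norm (Y k) \<le> B"
  shows "L2 g" "norm (mk g) \<le> B"
proof -
  obtain k where "norm (Y k) \<le> B"
    using eventually_happens'[OF sequentially_bot B] by blast
  then have B0: "B \<ge> 0" using norm_ge_zero order_trans by blast
  have eq: "(\<integral>\<^sup>+x. ennreal ((cmod (fn (Y k) x))\<^sup>2) \<partial>lebesgue) = ennreal ((norm (Y k))\<^sup>2)" for k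
    unfolding norm_l2_sq by (rule nn_integral_eq_integral) (auto intro: L2_integrable)
  have "(\<integral>\<^sup>+x. ennreal ((cmod (g x))\<^sup>2) \<partial>lebesgue) = (\<integral>\<^sup>+x. liminf (\<lambda>k. ennreal ((cmod (fn (Y k) x))\<^sup>2)) \<partial>lebesgue)"
  proof (rule nn_integral_cong_AE, use lim in eventually_elim)
    case (elim x)
    have "(\<lambda>k. ennreal ((cmod (fn (Y k) x))\<^sup>2)) \<longlonglongrightarrow> ennreal ((cmod (g x))\<^sup>2)"
      by (intro tendsto_ennrealI tendsto_intros elim)
    then show ?case by (rule lim_imp_Liminf[OF sequentially_bot, symmetric])
  qed
  also have "\<dots> \<le> liminf (\<lambda>k. \<integral>\<^sup>+x. ennreal ((cmod (fn (Y k) x))\<^sup>2) \<partial>lebesgue)"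
    by (rule nn_integral_liminf) auto
  also have "\<dots> \<le> ennreal (B\<^sup>2)"
    unfolding eq
  proof (rule Liminf_le[OF sequentially_bot])
    show "\<forall>\<^sub>F k in sequentially. ennreal ((norm (Y k))\<^sup>2) \<le> ennreal (B\<^sup>2)"
      using B by (auto elim!: eventually_mono intro!: ennreal_leI power_mono)
  qed
  finally have le: "(\<integral>\<^sup>+x. ennreal ((cmod (g x))\<^sup>2) \<partial>lebesgue) \<le> ennreal (B\<^sup>2)" .
  have "integrable lebesgue (\<lambda>x. (cmod (g x))\<^sup>2)"
    by (rule integrableI_nonneg) (use le in \<open>auto simp: less_top[symmetric] top_unique\<close>)
  then show L: "L2 g" by (simp add: L2_def)
  have "ennreal ((norm (mk g))\<^sup>2) \<le> ennreal (B\<^sup>2)"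
    using le unfolding norm_mk_sq[OF L] by (subst (asm) nn_integral_eq_integral[OF L2_integrable[OF L]]) auto
  then have "(norm (mk g))\<^sup>2 \<le> B\<^sup>2" by (simp add: ennreal_le_iff)
  then show "norm (mk g) \<le> B" using B0 by (rule power2_le_imp_le)
qed

lemma mk_diff: "L2 f \<Longrightarrow> L2 g \<Longrightarrow> mk (\<lambda>x. f x - g x) = mk f - mk g"
proof (rule l2_eqI)
  assume L: "L2 f" "L2 g"
  have "L2 (\<lambda>x. f x - g x)" using L2_add[OF L(1) L2_cmult[OF L(2), of "-1"]] by simp
  from fn_mk[OF this] fn_mk[OF L(1)] fn_mk[OF L(2)] fn_minus[of "mk f" "mk g"]
  show "AE x in lebesgue. fn (mk (\<lambda>x. f x - g x)) x = fn (mk f - mk g) x"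
    by eventually_elim simp
qed

text \<open>
  Riesz--Fischer. Multiplication by a positive weight \<open>W\<close> in \<open>L\<^sup>2\<close> turns a Cauchy sequence of
  \<open>L\<^sup>2\<close> into one of \<open>L\<^sup>1\<close>, which has an almost everywhere convergent subsequence; Fatou's
  lemma shows that the pointwise limit is the limit in norm.
\<close>

instance l2 :: complete_space
proof
  fix X :: "nat \<Rightarrow> l2" assume X: "Cauchy X"
  obtain w :: "real \<Rightarrow> real" where w: "w \<in> borel_measurable lborel" "\<And>x. w x > 0" "\<And>x. w x \<le> 1" "integrable lborel w"
    using sigma_finite_measure.obtain_positive_integrable_function[OF sigma_finite_lborel] by metis
  have wl: "integrable lebesgue w" using w(1,4) by (simp add: integrable_completion)
  \<comment> \<open>Since \<open>0 < w \<le> 1\<close>, integrability of \<open>w\<close> entails square integrability.\<close>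
  define W where "W = (\<lambda>x. complex_of_real (w x))"
  have L2W: "L2 W"
  proof (rule L2I_bound[OF _ wl])
    show "W \<in> borel_measurable lebesgue" unfolding W_def using wl by auto
    have "(w x)\<^sup>2 \<le> w x" for x
      using w(2,3)[of x] by (simp add: power2_eq_square mult_left_le less_imp_le)
    then show "AE x in lebesgue. (cmod (W x))\<^sup>2 \<le> w x"
      by (auto simp: W_def)
  qed
  define s where "s = (\<lambda>n x. fn (X n) x * W x)"
  have s_int: "integrable lebesgue (s n)" for n
    unfolding s_def by (intro L2_mult_integrable L2_fn L2W)
  have s_le: "(\<integral>x. norm (s i x - s j x) \<partial>lebesgue) \<le> norm (X i - X j) * norm (mk W)" for i j
  proof -
    have "(\<integral>x. norm (s i x - s j x) \<partial>lebesgue) = (\<integral>x. cmod (fn (X i - X j) x * W x) \<partial>lebesgue)"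
    proof (rule integral_cong_AE)
      show "(\<lambda>x. norm (s i x - s j x)) \<in> borel_measurable lebesgue" using s_int by auto
      show "(\<lambda>x. cmod (fn (X i - X j) x * W x)) \<in> borel_measurable lebesgue"
        using L2_mult_integrable[OF L2_fn L2W] by auto
      show "AE x in lebesgue. norm (s i x - s j x) = cmod (fn (X i - X j) x * W x)"
        using fn_minus[of "X i" "X j"] by eventually_elim (simp add: s_def left_diff_distrib)
    qed
    also have "\<dots> \<le> norm (mk (fn (X i - X j))) * norm (mk W)"
      by (intro integral_norm_mult_le L2_fn L2W)
    finally show ?thesis by simp
  qed
  have "\<exists>N. \<forall>i\<ge>N. \<forall>j\<ge>N. (\<integral>x. norm (s i x - s j x) \<partial>lebesgue) < e" if "e > 0" for e
  proof -
    have "e / (norm (mk W) + 1) > 0" using that by (simp add: add_nonneg_pos)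
    then obtain N where N: "\<And>i j. i \<ge> N \<Longrightarrow> j \<ge> N \<Longrightarrow> norm (X i - X j) < e / (norm (mk W) + 1)"
      using CauchyD[OF X] by meson
    have "(\<integral>x. norm (s i x - s j x) \<partial>lebesgue) < e" if "i \<ge> N" "j \<ge> N" for i j
    proof -
      have "norm (X i - X j) * norm (mk W) \<le> norm (X i - X j) * (norm (mk W) + 1)"
        by (intro mult_left_mono) auto
      also have "\<dots> < e"
        using N[OF that] by (simp add: pos_less_divide_eq add_nonneg_pos)
      finally show ?thesis using s_le[of i j] by simp
    qed
    then show ?thesis by blast
  qed
  from cauchy_L1_AE_cauchy_subseq[OF s_int this] obtain r where
    r: "strict_mono r" and rC: "AE x in lebesgue. Cauchy (\<lambda>i. s (r i) x)" by auto
  define f where "f = (\<lambda>x. lim (\<lambda>i. fn (X (r i)) x))"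
  have f_meas: "f \<in> borel_measurable lebesgue"
    unfolding f_def by (intro borel_measurable_lim_metric fn_measurable)
  have f_lim: "AE x in lebesgue. (\<lambda>i. fn (X (r i)) x) \<longlonglongrightarrow> f x"
    using rC
  proof eventually_elim
    case (elim x)
    then have "convergent (\<lambda>i. s (r i) x)" by (simp add: Cauchy_convergent_iff)
    then have "convergent (\<lambda>i. s (r i) x * inverse (W x))"
      by (intro convergent_mult convergent_const)
    moreover have "W x \<noteq> 0" using w(2)[of x] by (simp add: W_def)
    then have "(\<lambda>i. s (r i) x * inverse (W x)) = (\<lambda>i. fn (X (r i)) x)"
      by (simp add: s_def mult.assoc)
    ultimately show ?case
      unfolding f_def by (simp only: convergent_LIMSEQ_iff)
  qed
  have key: "L2 (\<lambda>x. f x - fn (X n) x) \<and> norm (mk (\<lambda>x. f x - fn (X n) x)) \<le> e"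
    if "\<forall>i\<ge>n. norm (X i - X n) \<le> e" for n e
  proof -
    have "AE x in lebesgue. \<forall>k. fn (X (r k) - X n) x = fn (X (r k)) x - fn (X n) x"
      unfolding AE_all_countable using fn_minus by blast
    with f_lim have "AE x in lebesgue. (\<lambda>k. fn (X (r k) - X n) x) \<longlonglongrightarrow> f x - fn (X n) x"
      by eventually_elim (auto intro!: tendsto_intros)
    moreover have "\<forall>\<^sub>F k in sequentially. norm (X (r k) - X n) \<le> e"
      using eventually_ge_at_top[of n] 
      by eventually_elim (use that seq_suble[OF r] in \<open>meson order_trans\<close>)
    ultimately show ?thesis
      using l2_fatou[of "\<lambda>k. X (r k) - X n" "\<lambda>x. f x - fn (X n) x" e] f_meas by auto
  qed
  have ex: "\<exists>N. \<forall>n\<ge>N. \<forall>i\<ge>n. norm (X i - X n) \<le> e" if "e > 0" for e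
    using CauchyD[OF X that] by (meson less_imp_le order_trans)
  obtain N where "\<forall>i\<ge>N. norm (X i - X N) \<le> 1" using ex[of 1] by auto
  then have "L2 (\<lambda>x. f x - fn (X N) x)" using key by blast
  from L2_add[OF this L2_fn[of "X N"]] have Lf: "L2 f" by simp
  have "X \<longlonglongrightarrow> mk f"
  proof (rule LIMSEQ_I)
    fix e :: real assume e: "e > 0"
    obtain N where N: "\<forall>n\<ge>N. \<forall>i\<ge>n. norm (X i - X n) \<le> e/2" using ex[of "e/2"] e by auto
    have "norm (X n - mk f) < e" if "n \<ge> N" for n
    proof -
      have "norm (mk f - X n) \<le> e/2"
        using key[of n "e/2"] N that mk_diff[OF Lf L2_fn[of "X n"]] by simp
      then show ?thesis using e by (simp add: norm_minus_commute)
    qed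
    then show "\<exists>N. \<forall>n\<ge>N. norm (X n - mk f) < e" by blast
  qed
  then show "convergent X" by (auto simp: convergent_def)
qed

instance l2 :: banach ..

section \<open>Multiplication, conjugation, translation and the bilinear pairing\<close>

lemma cscale_add: "cscale c (f + g) = cscale c f + cscale c g"
  by (rule l2_eqI) (use fn_cscale[of c "f+g"] fn_plus[of f g] fn_cscale[of c f] fn_cscale[of c g] fn_plus[of "cscale c f" "cscale c g"]
    in eventually_elim, simp add: algebra_simps)
lemma cscale_add_left: "cscale (c + d) f = cscale c f + cscale d f"
  by (rule l2_eqI) (use fn_cscale[of "c + d" f] fn_cscale[of c f] fn_cscale[of d f] fn_plus[of "cscale c f" "cscale d f"]
    in eventually_elim, simp add: algebra_simps)
lemma cscale_cscale [simp]: "cscale c (cscale d f) = cscale (c * d) f"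
  by (rule l2_eqI) (use fn_cscale[of c "cscale d f"] fn_cscale[of d f] fn_cscale[of "c * d" f] in eventually_elim, simp)
lemma cscale_of_real: "cscale (of_real r) f = r *\<^sub>R f"
  by (simp add: scaleR_l2_def)
lemma cscale_neg1: "cscale (-1) f = - f" using cscale_of_real[of "-1" f] by simp
lemma cscale_scaleR: "cscale c (r *\<^sub>R f) = r *\<^sub>R cscale c f"
  by (simp add: scaleR_l2_def mult.commute)
lemma cscale_minus_left: "cscale (- c) f = - cscale c f"
  using cscale_cscale[of "-1" c f] by (simp only: cscale_neg1 mult_minus1)
lemma cscale_zero [simp]: "cscale c 0 = 0"
  using cscale_scaleR[of c 0 0] by simp
lemma cscale_diff: "cscale c (f - g) = cscale c f - cscale c g"
  using cscale_add[of c f "-g"] cscale_scaleR[of c "-1" g] by simp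

lemma inner_cscale: "inner (cscale c f) g = inner f (cscale (cnj c) g)"
  unfolding inner_l2_def
  by (rule integral_cong_AE)
     (use fn_cscale[of c f] fn_cscale[of "cnj c" g] in \<open>auto intro!: borel_measurable_integrable integrable_inner elim!: eventually_elim2 simp: algebra_simps\<close>)

lemma norm_cscale [simp]: "norm (cscale c f) = cmod c * norm f"
proof -
  have "inner (cscale c f) (cscale c f) = (cmod c)\<^sup>2 * inner f f"
    by (simp add: inner_cscale complex_norm_square[symmetric] mult.commute[of "cnj c" c] cscale_of_real flip: of_real_power)
  then have "(norm (cscale c f))\<^sup>2 = (cmod c * norm f)\<^sup>2"
    by (simp add: power2_norm_eq_inner power_mult_distrib)
  then show ?thesis by (metis norm_ge_zero power2_eq_imp_eq zero_le_mult_iff)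
qed

lemma inner_cscale_ii_self [simp]: "inner f (cscale \<i> f) = 0" "inner (cscale \<i> f) f = 0"
  using inner_cscale[of \<i> f f] by (simp_all add: cscale_minus_left inner_commute)

lemma shift_add: "shift a (f + g) = shift a f + shift a g"
  by (rule l2_eqI) (use AE_shift[OF fn_plus[of f g], of a] fn_shift[of a f] fn_shift[of a g]
     fn_shift[of a "f + g"] fn_plus[of "shift a f" "shift a g"] in eventually_elim, simp)
lemma shift_cscale: "shift a (cscale c f) = cscale c (shift a f)"
  by (rule l2_eqI) (use AE_shift[OF fn_cscale[of c f], of a] fn_shift[of a f] 
     fn_shift[of a "cscale c f"] fn_cscale[of c "shift a f"] in eventually_elim, simp)
lemma shift_scaleR: "shift a (r *\<^sub>R f) = r *\<^sub>R shift a f"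
  by (simp add: scaleR_l2_def shift_cscale)
lemma shift_uminus: "shift a (- f) = - shift a f"
  using shift_scaleR[of a "-1" f] by simp
lemma shift_diff: "shift a (f - g) = shift a f - shift a g"
  using shift_add[of a f "-g"] by (simp add: shift_uminus)
lemma shift_shift [simp]: "shift a (shift b f) = shift (a + b) f"
  by (rule l2_eqI) (use AE_shift[OF fn_shift[of b f], of a] fn_shift[of a "shift b f"]
     fn_shift[of "a + b" f] in eventually_elim, simp add: add_ac)
lemma shift_0 [simp]: "shift 0 f = f"
  by (rule l2_eqI) (use fn_shift[of 0 f] in simp)
lemma inner_shift: "inner (shift a f) (shift a g) = inner f g"
proof -
  have "inner (shift a f) (shift a g) = (\<integral>x. Re (fn f (a + x) * cnj (fn g (a + x))) \<partial>lebesgue)"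
    unfolding shift_def by (simp add: inner_mk L2_shift)
  also have "\<dots> = inner f g"
    unfolding inner_l2_def
    using lebesgue_integral_real_affine[of 1 "\<lambda>x. Re (fn f x * cnj (fn g x))" a] by simp
  finally show ?thesis .
qed
lemma norm_shift [simp]: "norm (shift a f) = norm f"
  by (simp add: norm_eq_sqrt_inner inner_shift)
lemma inner_shift_left: "inner (shift a f) g = inner f (shift (- a) g)"
  using inner_shift[of a f "shift (-a) g"] by simp

lemma conjug_add: "conjug (f + g) = conjug f + conjug g"
  by (rule l2_eqI) (use fn_plus[of f g] fn_conjug[of f] fn_conjug[of g] fn_conjug[of "f + g"] fn_plus[of "conjug f" "conjug g"] in eventually_elim, simp)
lemma conjug_cscale: "conjug (cscale c f) = cscale (cnj c) (conjug f)"
  by (rule l2_eqI) (use fn_cscale[of c f] fn_conjug[of f] fn_conjug[of "cscale c f"] fn_cscale[of "cnj c" "conjug f"] in eventually_elim, simp)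
lemma conjug_scaleR: "conjug (r *\<^sub>R f) = r *\<^sub>R conjug f"
  by (simp add: scaleR_l2_def conjug_cscale)
lemma conjug_diff: "conjug (f - g) = conjug f - conjug g"
  using conjug_add[of f "-g"] conjug_scaleR[of "-1" g] by simp
lemma conjug_conjug [simp]: "conjug (conjug f) = f"
  by (rule l2_eqI) (use fn_conjug[of f] fn_conjug[of "conjug f"] in eventually_elim, simp)
lemma conjug_shift: "conjug (shift a f) = shift a (conjug f)"
  by (rule l2_eqI) (use AE_shift[OF fn_conjug[of f], of a] fn_shift[of a "conjug f"] fn_shift[of a f] fn_conjug[of "shift a f"] in eventually_elim, simp)
lemma inner_conjug: "inner (conjug f) (conjug g) = inner f g"
  unfolding inner_l2_def
  by (rule integral_cong_AE)
     (use fn_conjug[of f] fn_conjug[of g] in \<open>auto intro!: borel_measurable_integrable integrable_inner elim!: eventually_elim2 simp: algebra_simps\<close>)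
lemma norm_conjug [simp]: "norm (conjug f) = norm f"
  by (simp add: norm_eq_sqrt_inner inner_conjug)

lemma pairing_cong_AE:
  assumes "L2 f" "L2 g" "L2 f'" "L2 g'" "AE x in lebesgue. f x = f' x" "AE x in lebesgue. g x = g' x"
  shows "pairing f g = pairing f' g'"
  unfolding pairing_def
  by (rule integral_cong_AE) (use assms in \<open>auto intro!: borel_measurable_integrable L2_mult_integrable elim: eventually_elim2\<close>)

lemma pairing_mk: "L2 f \<Longrightarrow> L2 g \<Longrightarrow> pairing f g = pair (mk f) (mk g)"
  unfolding pair_def by (rule pairing_cong_AE) (auto intro: AE_symmetric[OF fn_mk])

lemma pair_commute: "pair f g = pair g f"
  by (simp add: pair_def pairing_def mult.commute)

lemma pair_add_left: "pair (f + g) h = pair f h + pair g h"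
proof -
  have "pair (f + g) h = pairing (\<lambda>x. fn f x + fn g x) (fn h)"
    unfolding pair_def by (rule pairing_cong_AE) (auto intro: L2_add fn_plus)
  also have "\<dots> = pair f h + pair g h"
    unfolding pair_def pairing_def
    by (simp add: distrib_right L2_mult_integrable)
  finally show ?thesis .
qed
lemma pair_cscale_left: "pair (cscale c f) g = c * pair f g"
proof -
  have "pair (cscale c f) g = pairing (\<lambda>x. c * fn f x) (fn g)"
    unfolding pair_def by (rule pairing_cong_AE) (auto intro: L2_cmult fn_cscale)
  also have "\<dots> = c * pair f g"
    unfolding pair_def pairing_def by (simp add: mult.assoc)
  finally show ?thesis .
qed
lemma pair_diff_left: "pair (f - g) h = pair f h - pair g h"
  using pair_add_left[of f "-g" h] pair_cscale_left[of "-1" g h] by (simp add: cscale_neg1)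
lemma pair_add_right: "pair h (f + g) = pair h f + pair h g"
  using pair_add_left pair_commute by metis
lemma pair_cscale_right: "pair f (cscale c g) = c * pair f g"
  using pair_cscale_left pair_commute by metis
lemma pair_scaleR_left: "pair (r *\<^sub>R f) g = r *\<^sub>R pair f g"
  using pair_cscale_left[of "of_real r" f g] by (simp add: cscale_of_real scaleR_conv_of_real)

lemma Re_pair: "Re (pair f g) = inner f (conjug g)"
proof -
  have "inner f (conjug g) = (\<integral>x. Re (fn f x * fn g x) \<partial>lebesgue)"
    unfolding inner_l2_def
    by (rule integral_cong_AE)
     (use fn_conjug[of g] in \<open>auto intro!: borel_measurable_integrable integrable_inner integrable_Re L2_mult_integrable elim!: eventually_mono\<close>)
  also have "\<dots> = Re (pair f g)"
    unfolding pair_def pairing_def by (rule integral_Re) (intro L2_mult_integrable L2_fn)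
  finally show ?thesis by simp
qed

lemma cmod_pair_le: "cmod (pair f g) \<le> norm f * norm g"
proof -
  have "cmod (pair f g) \<le> (\<integral>x. cmod (fn f x * fn g x) \<partial>lebesgue)"
    unfolding pair_def pairing_def by (rule integral_norm_bound)
  also have "\<dots> \<le> norm f * norm g"
    using integral_norm_mult_le[of "fn f" "fn g"] by simp
  finally show ?thesis .
qed

lemma pair_conjug_conjug: "pair (conjug f) (conjug g) = cnj (pair f g)"
proof -
  have "pair (conjug f) (conjug g) = pairing (\<lambda>x. cnj (fn f x)) (\<lambda>x. cnj (fn g x))"
    unfolding pair_def by (rule pairing_cong_AE) (auto intro: L2_cnj fn_conjug)
  also have "\<dots> = cnj (pair f g)"
    unfolding pair_def pairing_def by (simp flip: complex_cnj_mult)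
  finally show ?thesis .
qed

lemma conjug_mk: "L2 f \<Longrightarrow> conjug (mk f) = mk (\<lambda>x. cnj (f x))"
  unfolding conjug_def by (subst mk_eq_iff) (auto intro: L2_cnj elim: eventually_mono[OF fn_mk])
lemma cscale_mk: "L2 f \<Longrightarrow> cscale c (mk f) = mk (\<lambda>x. c * f x)"
  unfolding cscale_def by (subst mk_eq_iff) (use fn_mk[of f] in \<open>auto intro: L2_cmult elim: eventually_mono\<close>)
lemma mk_add: "L2 f \<Longrightarrow> L2 g \<Longrightarrow> mk (\<lambda>x. f x + g x) = mk f + mk g"
  unfolding plus_l2_def
  by (subst mk_eq_iff) (auto intro: L2_add elim: eventually_elim2[OF fn_mk fn_mk])
section \<open>Difference quotients on dyadic meshes\<close>

lemma geometric_limit: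
  fixes x :: "nat \<Rightarrow> 'a::banach"
  assumes step: "\<And>n. norm (x (Suc n) - x n) \<le> C * q ^ n" and q: "0 \<le> q" "q < 1"
  shows "convergent x" "norm (x n - lim x) \<le> C * q ^ n / (1 - q)"
proof -
  have sm: "summable (\<lambda>i. C * q ^ i)" using q by (intro summable_mult summable_geometric) auto
  have s: "summable (\<lambda>i. x (Suc i) - x i)"
    by (rule summable_comparison_test'[OF sm]) (use step in auto)
  have t: "(\<Sum>i<n. x (Suc i) - x i) = x n - x 0" for n by (rule sum_lessThan_telescope)
  have "(\<lambda>n. x n - x 0) \<longlonglongrightarrow> (\<Sum>i. x (Suc i) - x i)"
    using summable_LIMSEQ[OF s] by (simp add: t)
  then have "(\<lambda>n. (x n - x 0) + x 0) \<longlonglongrightarrow> (\<Sum>i. x (Suc i) - x i) + x 0"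
    by (intro tendsto_intros)
  then show c: "convergent x" by (auto simp: convergent_def)
  have "norm (x m - x n) \<le> C * q ^ n / (1 - q)" if "m \<ge> n" for m
  proof -
    have C: "C * q ^ i \<ge> 0" for i using step[of i] norm_ge_zero order_trans by blast
    have "x m - x n = (\<Sum>i=n..<m. x (Suc i) - x i)" using that by (simp add: sum_Suc_diff')
    also have "norm \<dots> \<le> (\<Sum>i=n..<m. C * q ^ i)"
      by (rule order_trans[OF norm_sum sum_mono]) (rule step)
    also have "\<dots> = (\<Sum>i<m-n. C * q ^ n * q ^ i)"
      by (rule sum.reindex_bij_witness[of _ "\<lambda>i. i + n" "\<lambda>i. i - n"]) (use that in \<open>auto simp: power_add[symmetric]\<close>)
    also have "\<dots> \<le> (\<Sum>i. C * q ^ n * q ^ i)"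
      using q C[of n] by (intro sum_le_suminf summable_mult summable_geometric) auto
    also have "\<dots> = C * q ^ n / (1 - q)"
      using q by (subst suminf_mult) (auto simp: suminf_geometric summable_geometric)
    finally show ?thesis .
  qed
  then have "\<forall>\<^sub>F m in sequentially. norm (x m - x n) \<le> C * q ^ n / (1 - q)"
    by (auto simp: eventually_sequentially)
  moreover have "(\<lambda>m. norm (x m - x n)) \<longlonglongrightarrow> norm (lim x - x n)"
    using c by (intro tendsto_intros) (simp add: convergent_LIMSEQ_iff)
  ultimately have "norm (lim x - x n) \<le> C * q ^ n / (1 - q)"
    by (intro tendsto_upperbound[OF _ _ sequentially_bot])
  then show "norm (x n - lim x) \<le> C * q ^ n / (1 - q)" by (simp add: norm_minus_commute)
qed

text \<open>
  Halving the step keeps all operators in one commutative family: with \<open>T\<close> the translation by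
  the finer step, the coarser quotients are averages of translates of the finer ones. This
  gives monotonicity in \<open>n\<close> and exact formulas for the change from one level to the next.
\<close>

definition mesh :: "nat \<Rightarrow> real" where "mesh n = (1/2) ^ n"

lemma mesh_pos [simp]: "mesh n > 0" "mesh n \<noteq> 0" by (simp_all add: mesh_def)
lemma mesh_ge [simp]: "mesh n \<ge> 0" using mesh_pos(1)[of n] by (rule less_imp_le)
lemma mesh_Suc: "mesh n = 2 * mesh (Suc n)" by (simp add: mesh_def)
lemma mesh_tendsto: "mesh \<longlonglongrightarrow> 0" unfolding mesh_def by (intro LIMSEQ_realpow_zero) auto
lemma mesh_le_1 [simp]: "mesh n \<le> 1" by (simp add: mesh_def power_le_one)

text \<open>
  \<open>D n\<close> approximates the derivative and \<open>A n\<close> the operator \<open>- \<partial>\<^sub>x\<^sub>x\<close>; \<open>A n\<close> is the product of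
  \<open>D n\<close> with its adjoint (\<open>inner_A\<close>).
\<close>

definition D :: "nat \<Rightarrow> l2 \<Rightarrow> l2" where
  "D n f = inverse (mesh n) *\<^sub>R (shift (mesh n) f - f)"
definition A :: "nat \<Rightarrow> l2 \<Rightarrow> l2" where
  "A n f = inverse ((mesh n)\<^sup>2) *\<^sub>R ((f - shift (mesh n) f) + (f - shift (- mesh n) f))"

lemma D_add: "D n (f + g) = D n f + D n g"
  by (simp add: D_def shift_add scaleR_right_distrib[symmetric])
lemma D_cscale: "D n (cscale c f) = cscale c (D n f)"
  by (simp add: D_def shift_cscale cscale_diff cscale_scaleR)
lemma D_scaleR: "D n (r *\<^sub>R f) = r *\<^sub>R D n f"
  using D_cscale[of n "of_real r" f] by (simp add: cscale_of_real)
lemma D_diff: "D n (f - g) = D n f - D n g"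
  using D_add[of n f "-g"] D_scaleR[of n "-1" g] by simp
lemma D_conjug: "D n (conjug f) = conjug (D n f)"
  by (simp add: D_def conjug_shift conjug_diff conjug_scaleR)
lemma A_add: "A n (f + g) = A n f + A n g"
  by (simp add: A_def shift_add scaleR_right_distrib[symmetric])
lemma A_cscale: "A n (cscale c f) = cscale c (A n f)"
  by (simp add: A_def shift_cscale cscale_diff cscale_add cscale_scaleR)
lemma A_scaleR: "A n (r *\<^sub>R f) = r *\<^sub>R A n f"
  using A_cscale[of n "of_real r" f] by (simp add: cscale_of_real)
lemma A_diff: "A n (f - g) = A n f - A n g"
  using A_add[of n f "-g"] A_scaleR[of n "-1" g] by simp
lemma A_shift: "A n (shift a f) = shift a (A n f)"
  by (simp add: A_def shift_diff shift_add shift_scaleR add.commute)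

lemma norm_A_le: "norm (A n f) \<le> 4 / (mesh n)\<^sup>2 * norm f"
proof -
  have "norm ((f - shift (mesh n) f) + (f - shift (- mesh n) f)) \<le> 4 * norm f"
    using norm_triangle_ineq[of "f - shift (mesh n) f" "f - shift (- mesh n) f"]
      norm_triangle_ineq4[of f "shift (mesh n) f"] norm_triangle_ineq4[of f "shift (-mesh n) f"] by simp
  then show ?thesis by (simp add: A_def divide_simps)
qed

lemma bounded_linear_A: "bounded_linear (A n)"
  by (rule bounded_linear_intro[where K="4 / (mesh n)\<^sup>2"])
     (use norm_A_le in \<open>auto simp: A_add A_scaleR mult.commute\<close>)

lemma inner_A: "inner (A n f) g = inner (D n f) (D n g)"
proof -
  have "inner (D n f) (D n g) = inverse ((mesh n)\<^sup>2) * inner (shift (mesh n) f - f) (shift (mesh n) g - g)"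
    by (simp add: D_def power2_eq_square)
  also have "inner (shift (mesh n) f - f) (shift (mesh n) g - g) = inner ((f - shift (mesh n) f) + (f - shift (- mesh n) f)) g"
    by (simp add: inner_diff_left inner_diff_right inner_add_left inner_shift inner_shift_left[of "-mesh n" f g])
  finally show ?thesis by (simp add: A_def)
qed

lemma inner_A_sym: "inner (A n f) g = inner f (A n g)"
  using inner_A[of n f g] inner_A[of n g f] by (simp add: inner_commute)

lemma norm_D_sq: "(norm (D n f))\<^sup>2 = inner (A n f) f"
  by (simp add: inner_A power2_norm_eq_inner)

lemma norm_D_sq_le: "(norm (D n f))\<^sup>2 \<le> norm (A n f) * norm f"
  unfolding norm_D_sq by (rule norm_cauchy_schwarz)

lemma D_half: "D n f = (1/2) *\<^sub>R (shift (mesh (Suc n)) (D (Suc n) f) + D (Suc n) f)"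
proof -
  define k where "k = mesh (Suc n)"
  have k: "mesh n = 2 * k" "mesh (Suc n) = k" by (simp_all add: k_def mesh_Suc[of n])
  have "shift k (D (Suc n) f) + D (Suc n) f = inverse k *\<^sub>R ((shift (k + k) f - shift k f) + (shift k f - f))"
    unfolding D_def k by (simp only: shift_scaleR shift_diff scaleR_add_right shift_shift)
  then show ?thesis by (simp add: D_def k)
qed

lemma norm_D_Suc: "norm (D n f) \<le> norm (D (Suc n) f)"
  unfolding D_half[of n f] using norm_triangle_ineq[of "shift (mesh (Suc n)) (D (Suc n) f)" "D (Suc n) f"] by simp

text \<open>
  On symbols in \<open>T\<close>: \<open>2 - T\<^sup>2 - T\<^sup>-\<^sup>2 = (2 - T - T\<^sup>-\<^sup>1) (2 + T + T\<^sup>-\<^sup>1)\<close>. The second factor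
  divided by 4 is an average of translations, hence a contraction.
\<close>

lemma A_half: "A n f = (1/4) *\<^sub>R (shift (mesh (Suc n)) (A (Suc n) f) + shift (- mesh (Suc n)) (A (Suc n) f) + (A (Suc n) f + A (Suc n) f))"
proof -
  define k where "k = mesh (Suc n)"
  have k: "mesh n = 2 * k" "mesh (Suc n) = k" by (simp_all add: k_def mesh_Suc[of n])
  have "k \<noteq> 0" by (simp add: k_def)
  then show ?thesis
    unfolding A_def k
    by (simp add: shift_scaleR shift_diff shift_add power2_eq_square flip: scaleR_add_right)
qed

lemma norm_A_Suc: "norm (A n f) \<le> norm (A (Suc n) f)"
proof -
  let ?a = "A (Suc n) f" and ?k = "mesh (Suc n)"
  have "norm (shift ?k ?a + shift (- ?k) ?a + (?a + ?a)) \<le> 4 * norm ?a"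
    using norm_triangle_ineq[of "shift ?k ?a + shift (- ?k) ?a" "?a + ?a"]
      norm_triangle_ineq[of "shift ?k ?a" "shift (- ?k) ?a"] norm_triangle_ineq[of ?a ?a] by simp
  then show ?thesis unfolding A_half[of n f] by simp
qed

lemma norm_D_mono: "n \<le> m \<Longrightarrow> norm (D n f) \<le> norm (D m f)"
  by (rule lift_Suc_mono_le[of "\<lambda>n. norm (D n f)"]) (auto intro: norm_D_Suc)
lemma norm_A_mono: "n \<le> m \<Longrightarrow> norm (A n f) \<le> norm (A m f)"
  by (rule lift_Suc_mono_le[of "\<lambda>n. norm (A n f)"]) (auto intro: norm_A_Suc)

text \<open>
  The complementary factor in the preceding formula is \<open>1 - (2 + T + T\<^sup>-\<^sup>1)/4 = (2 - T -
  T\<^sup>-\<^sup>1)/4\<close>, a multiple of the finer operator itself. So the discretization error is a square,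
  and in the energy estimate one of its factors falls on each of the two functions that are
  compared.
\<close>

lemma A_Suc_diff: "A (Suc n) f - A n f = ((mesh (Suc n))\<^sup>2 / 4) *\<^sub>R A (Suc n) (A (Suc n) f)"
proof -
  define a where "a = A (Suc n) f"
  define k where "k = mesh (Suc n)"
  have "(k\<^sup>2 / 4) *\<^sub>R A (Suc n) a = (1/4) *\<^sub>R ((a - shift k a) + (a - shift (- k) a))"
    by (simp add: A_def k_def)
  also have "(a - shift k a) + (a - shift (- k) a) = 4 *\<^sub>R a - (shift k a + shift (- k) a + (a + a))"
    (is "?l = ?r")
  proof -
    have "4 *\<^sub>R a = (a + a) + (a + a)"
      using scaleR_add_left[of 2 2 a] by (simp add: scaleR_2)
    then show ?thesis by simp
  qed
  also have "(1/4) *\<^sub>R \<dots> = a - A n f"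
    unfolding A_half[of n f] a_def[symmetric] k_def[symmetric] by (simp add: scaleR_right_diff_distrib)
  finally show ?thesis by (simp add: a_def k_def)
qed

lemma norm_D_Suc_diff: "norm (D (Suc n) f - D n f) = mesh (Suc n) / 2 * norm (A (Suc n) f)"
proof -
  define k where "k = mesh (Suc n)"
  have k: "mesh n = 2 * k" "mesh (Suc n) = k" by (simp_all add: k_def mesh_Suc[of n])
  have k0: "k > 0" by (simp add: k_def)
  have "D (Suc n) f - D n f = (1/2) *\<^sub>R (D (Suc n) f - shift k (D (Suc n) f))"
  proof -
    have "y - (1/2) *\<^sub>R (z + y) = (1/2) *\<^sub>R (y - z)" for y z :: l2
    proof -
      have "(1/2) *\<^sub>R (y - z) + (1/2) *\<^sub>R (z + y) = (1/2) *\<^sub>R (y + y)"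
        by (simp only: scaleR_add_right[symmetric]) simp
      then show ?thesis by (simp only: scaleR_half_double) (metis add_diff_cancel_right')
    qed
    then show ?thesis unfolding D_half[of n f] k(2) by blast
  qed
  also have "D (Suc n) f - shift k (D (Suc n) f) = k *\<^sub>R shift k (A (Suc n) f)"
  proof -
    have "D (Suc n) f - shift k (D (Suc n) f) = inverse k *\<^sub>R ((shift k f - f) - (shift (k + k) f - shift k f))"
      by (simp add: D_def k shift_scaleR shift_diff scaleR_diff_right)
    also have "(shift k f - f) - (shift (k + k) f - shift k f) = (shift k f - shift (k + k) f) + (shift k f - f)"
      by simp
    also have "inverse k *\<^sub>R \<dots> = k *\<^sub>R shift k (A (Suc n) f)"
      using k0 by (simp add: A_def k shift_scaleR shift_diff shift_add power2_eq_square)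
    finally show ?thesis .
  qed
  finally show ?thesis using k0 by (simp add: k)
qed

lemma sq_norm_A_le: "(mesh n)\<^sup>2 * norm (A n f) \<le> 2 * norm (shift (mesh n) f - f)"
proof -
  have "norm (f - shift (- mesh n) f) = norm (shift (mesh n) (f - shift (- mesh n) f))" by (simp only: norm_shift)
  also have "\<dots> = norm (shift (mesh n) f - f)" by (simp add: shift_diff)
  finally have "norm (f - shift (- mesh n) f) = norm (shift (mesh n) f - f)" .
  moreover have "(mesh n)\<^sup>2 * norm (A n f) = norm ((f - shift (mesh n) f) + (f - shift (- mesh n) f))"
    by (simp add: A_def)
  ultimately show ?thesis
    using norm_triangle_ineq[of "f - shift (mesh n) f" "f - shift (- mesh n) f"]
    by (simp add: norm_minus_commute)
qed

text \<open>
  The strong form of differentiability in \<open>L\<^sup>2\<close>. It describes the same space and the same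
  derivative as the weak form (\<open>H1_iff\<close>, \<open>weak_deriv_dx\<close>), and sums, multiples and conjugates
  are immediate from limits.
\<close>

definition h1 :: "l2 \<Rightarrow> bool" where "h1 f \<longleftrightarrow> convergent (\<lambda>n. D n f)"
definition dx :: "l2 \<Rightarrow> l2" where "dx f = lim (\<lambda>n. D n f)"

lemma h1_iff: "h1 f \<longleftrightarrow> (\<lambda>n. D n f) \<longlonglongrightarrow> dx f"
  by (simp add: h1_def dx_def convergent_LIMSEQ_iff)
lemma h1I: "(\<lambda>n. D n f) \<longlonglongrightarrow> g \<Longrightarrow> h1 f" "(\<lambda>n. D n f) \<longlonglongrightarrow> g \<Longrightarrow> dx f = g"
  by (auto simp: h1_def dx_def convergent_def limI)

lemma bounded_linear_cscale: "bounded_linear (cscale c)"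
  by (rule bounded_linear_intro[where K="cmod c"]) (auto simp: cscale_add cscale_scaleR mult.commute)
lemma bounded_linear_conjug: "bounded_linear conjug"
  by (rule bounded_linear_intro[where K=1]) (auto simp: conjug_add conjug_scaleR)
lemma bounded_linear_shift: "bounded_linear (shift a)"
  by (rule bounded_linear_intro[where K=1]) (auto simp: shift_add shift_scaleR)

lemma h1_add: assumes "h1 f" "h1 g" shows "h1 (f + g)" "dx (f + g) = dx f + dx g"
  using tendsto_add[OF assms[unfolded h1_iff]] by (auto simp: D_add[symmetric] intro: h1I)
lemma h1_diff: assumes "h1 f" "h1 g" shows "h1 (f - g)" "dx (f - g) = dx f - dx g"
  using tendsto_diff[OF assms[unfolded h1_iff]] by (auto simp: D_diff[symmetric] intro: h1I)
lemma h1_cscale: assumes "h1 f" shows "h1 (cscale c f)" "dx (cscale c f) = cscale c (dx f)"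
  using bounded_linear.tendsto[OF bounded_linear_cscale assms[unfolded h1_iff]] by (auto simp: D_cscale[symmetric] intro: h1I)
lemma h1_conjug: assumes "h1 f" shows "h1 (conjug f)" "dx (conjug f) = conjug (dx f)"
  using bounded_linear.tendsto[OF bounded_linear_conjug assms[unfolded h1_iff]] by (auto simp: D_conjug[symmetric] intro: h1I)

lemma norm_D_le_dx: assumes "h1 f" shows "norm (D n f) \<le> norm (dx f)"
proof (rule tendsto_lowerbound)
  show "(\<lambda>m. norm (D m f)) \<longlonglongrightarrow> norm (dx f)" using assms by (intro tendsto_norm) (simp add: h1_iff)
  show "\<forall>\<^sub>F m in sequentially. norm (D n f) \<le> norm (D m f)"
    using eventually_ge_at_top[of n] by eventually_elim (rule norm_D_mono)
qed simp

text \<open>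
  Consecutive quotients differ by \<open>k/2\<close> times a second difference, \<open>k\<close> the step, so bounded
  second differences make the quotients a Cauchy sequence with a geometric rate.
\<close>

lemma h1_of_bounded_A:
  assumes "\<And>n. norm (A n f) \<le> C"
  shows "h1 f" "norm (D n f - dx f) \<le> C * mesh n"
proof -
  have "norm (D (Suc n) f - D n f) \<le> (C/4) * (1/2) ^ n" for n
    unfolding norm_D_Suc_diff using mult_left_mono[OF assms[of "Suc n"], of "mesh (Suc n) / 2"]
    by (simp add: mesh_def)
  from geometric_limit[of "\<lambda>n. D n f", OF this]
  have "convergent (\<lambda>n. D n f)" "norm (D n f - dx f) \<le> C / 4 * mesh n / (1/2)"
    by (auto simp: dx_def mesh_def)
  moreover have "C \<ge> 0" using assms[of 0] norm_ge_zero order_trans by blast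
  ultimately show "h1 f" "norm (D n f - dx f) \<le> C * mesh n"
    using mesh_ge[of n] by (auto simp: h1_def) (smt (verit) norm_ge_zero)
qed

section \<open>Smooth functions with compact support\<close>

text \<open>
  With polynomials \<open>p\<close> as parameters these functions are closed under differentiation, and all
  of them are flat at the origin.
\<close>

definition flat_exp :: "real poly \<Rightarrow> real \<Rightarrow> real" where
  "flat_exp p x = (if x > 0 then poly p (1/x) * exp (- (1/x)) else 0)"

lemma poly_exp_tendsto: "((\<lambda>y. poly p y * exp (- y)) \<longlongrightarrow> 0) at_top" for p :: "real poly"
proof -
  have "((\<lambda>y. \<Sum>i\<le>degree p. coeff p i * (y ^ i / exp y)) \<longlongrightarrow> (\<Sum>i\<le>degree p. coeff p i * 0)) at_top"
    by (intro tendsto_sum tendsto_mult tendsto_const tendsto_power_div_exp_0)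
  then show ?thesis
    by (simp add: poly_altdef exp_minus sum_distrib_right divide_inverse mult.assoc)
qed

lemma flat_exp_right_tendsto: "((\<lambda>x. flat_exp p x) \<longlongrightarrow> 0) (at_right 0)"
proof -
  have "((\<lambda>x. poly p (inverse x) * exp (- inverse x)) \<longlongrightarrow> 0) (at_right 0)"
    by (rule filterlim_compose[OF poly_exp_tendsto filterlim_inverse_at_top_right])
  then show ?thesis
    by (rule Lim_transform_eventually)
       (auto simp: eventually_at_right_field flat_exp_def inverse_eq_divide intro!: exI[of _ 1])
qed

lemma flat_exp_deriv: "(flat_exp p has_real_derivative flat_exp ([:0,0,1:] * (p - pderiv p)) x) (at x)"
proof (cases x "0::real" rule: linorder_cases)
  case less
  have "((\<lambda>_. 0) has_real_derivative 0) (at x)" by simp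
  then have "(flat_exp p has_real_derivative 0) (at x)"
    by (rule DERIV_cong_ev[THEN iffD1, rotated 3, OF _ refl _ refl])
       (use less in \<open>auto simp: flat_exp_def eventually_nhds intro!: exI[of _ "{..<0}"]\<close>)
  then show ?thesis using less by (simp add: flat_exp_def)
next
  case equal
  have "((\<lambda>h. (flat_exp p h - flat_exp p 0) / h) \<longlongrightarrow> 0) (at_right 0)"
  proof (rule Lim_transform_eventually[OF flat_exp_right_tendsto[of "pCons 0 p"]])
    show "\<forall>\<^sub>F x in at_right 0. flat_exp (pCons 0 p) x = (flat_exp p x - flat_exp p 0) / x"
      by (auto simp: eventually_at_right_field flat_exp_def intro!: exI[of _ 1])
  qed
  moreover have "((\<lambda>h. (flat_exp p h - flat_exp p 0) / h) \<longlongrightarrow> 0) (at_left 0)"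
  proof (rule Lim_transform_eventually[OF tendsto_const])
    show "\<forall>\<^sub>F x in at_left 0. 0 = (flat_exp p x - flat_exp p 0) / x"
      by (auto simp: eventually_at_left_field flat_exp_def intro!: exI[of _ "-1"])
  qed
  ultimately have "((\<lambda>h. (flat_exp p h - flat_exp p 0) / h) \<longlongrightarrow> 0) (at 0)"
    by (simp add: filterlim_at_split)
  then show ?thesis using equal
    by (simp add: flat_exp_def has_field_derivative_iff)
next
  case greater
  have "((\<lambda>x. poly p (1/x) * exp (- (1/x))) has_real_derivative flat_exp ([:0,0,1:] * (p - pderiv p)) x) (at x)"
    using greater
    by (auto intro!: derivative_eq_intros DERIV_chain2[OF poly_DERIV] simp: flat_exp_def algebra_simps divide_simps power2_eq_square)
  then show ?thesis
    by (rule DERIV_cong_ev[THEN iffD1, rotated 3, OF _ refl _ refl])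
       (use greater in \<open>auto simp: flat_exp_def eventually_nhds intro!: exI[of _ "{0<..}"]\<close>)
qed

text \<open>
  Membership is preserved by differentiation, so all iterated derivatives exist without any
  Leibniz or chain rule of higher order.
\<close>

inductive smooth_expr :: "(real \<Rightarrow> real) \<Rightarrow> bool" where
  base: "smooth_expr (\<lambda>x. flat_exp p (a + b * x))"
| cmult: "smooth_expr f \<Longrightarrow> smooth_expr (\<lambda>x. c * f x)"
| add: "smooth_expr f \<Longrightarrow> smooth_expr g \<Longrightarrow> smooth_expr (\<lambda>x. f x + g x)"
| mult: "smooth_expr f \<Longrightarrow> smooth_expr g \<Longrightarrow> smooth_expr (\<lambda>x. f x * g x)"

lemma smooth_expr_deriv: "smooth_expr f \<Longrightarrow> \<exists>f'. smooth_expr f' \<and> (\<forall>x. (f has_real_derivative f' x) (at x))"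
proof (induction rule: smooth_expr.induct)
  case (base p a b)
  define q where "q = [:0,0,1:] * (p - pderiv p)"
  have "((\<lambda>x. flat_exp p (a + b * x)) has_real_derivative b * flat_exp q (a + b * x)) (at x)" for x
    by (rule DERIV_cong[OF DERIV_chain2[OF flat_exp_deriv[of p, folded q_def], of _ b]]) (auto intro!: derivative_eq_intros)
  then show ?case
    by (intro exI[of _ "\<lambda>x. b * flat_exp q (a + b * x)"] conjI allI smooth_expr.intros)
next
  case (cmult f c)
  then obtain f' where "smooth_expr f'" "\<forall>x. (f has_real_derivative f' x) (at x)" by blast
  then show ?case by (intro exI[of _ "\<lambda>x. c * f' x"]) (auto intro!: smooth_expr.intros derivative_eq_intros)
next
  case (add f g)
  then obtain f' g' where "smooth_expr f'" "smooth_expr g'" "\<forall>x. (f has_real_derivative f' x) (at x)" "\<forall>x. (g has_real_derivative g' x) (at x)" by blast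
  then show ?case by (intro exI[of _ "\<lambda>x. f' x + g' x"]) (auto intro!: smooth_expr.intros derivative_eq_intros)
next
  case (mult f g)
  then obtain f' g' where "smooth_expr f'" "smooth_expr g'" "\<forall>x. (f has_real_derivative f' x) (at x)" "\<forall>x. (g has_real_derivative g' x) (at x)" by blast
  then show ?case using mult by (intro exI[of _ "\<lambda>x. f' x * g x + f x * g' x"]) (auto intro!: smooth_expr.intros derivative_eq_intros)
qed

lemma smooth_expr_funpow_deriv: "smooth_expr f \<Longrightarrow> smooth_expr ((deriv ^^ n) f)"
proof (induction n arbitrary: f)
  case (Suc n)
  obtain f' where f': "smooth_expr f'" "\<forall>x. (f has_real_derivative f' x) (at x)" using smooth_expr_deriv[OF Suc.prems] by blast
  then have "deriv f = f'" by (auto simp: DERIV_imp_deriv)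
  then show ?case using Suc.IH[OF f'(1)] by (simp add: funpow_swap1)
qed simp

lemma smooth_expr_differentiable: "smooth_expr f \<Longrightarrow> f field_differentiable (at x)"
  using smooth_expr_deriv by (auto simp: field_differentiable_def)

text \<open>
  The primitive of such a function is smooth as well, although it need not be of that form.
\<close>

lemma primitive_smooth:
  assumes "smooth_expr s" "\<And>x. (\<Phi> has_real_derivative s x) (at x)"
  shows "(deriv ^^ n) \<Phi> field_differentiable (at x)"
proof (cases n)
  case 0 then show ?thesis using assms(2) by (auto simp: field_differentiable_def)
next
  case (Suc k)
  have "deriv \<Phi> = s" using assms(2) by (auto simp: DERIV_imp_deriv)
  then show ?thesis using smooth_expr_differentiable[OF smooth_expr_funpow_deriv[OF assms(1)]] Suc by (simp add: funpow_swap1)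
qed

text \<open>
  Supported in \<open>[0, e]\<close> and, as \<open>m\<close> grows, increasing to the indicator function of the
  interval.
\<close>

definition bump :: "real \<Rightarrow> nat \<Rightarrow> real \<Rightarrow> real" where
  "bump e m x = flat_exp 1 (real (Suc m) * x) * flat_exp 1 (real (Suc m) * (e - x))"

lemma smooth_expr_bump: "smooth_expr (\<lambda>x. bump e m (x - a))"
proof -
  have "smooth_expr (\<lambda>x. flat_exp 1 (- real (Suc m) * a + real (Suc m) * x) * flat_exp 1 (real (Suc m) * (e + a) + (- real (Suc m)) * x))"
    by (intro smooth_expr.intros)
  then show ?thesis by (simp add: bump_def algebra_simps)
qed

lemma bump_bounds: "0 \<le> bump e m x" "bump e m x \<le> 1"
  by (auto simp: bump_def flat_exp_def mult_le_one)
lemma bump_0: "x \<le> 0 \<or> e \<le> x \<Longrightarrow> bump e m x = 0"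
  by (auto simp: bump_def flat_exp_def zero_less_mult_iff)
lemma bump_tendsto: "(\<lambda>m. bump e m x) \<longlonglongrightarrow> indicator {0<..<e} x"
proof (cases "0 < x \<and> x < e")
  case True
  have L: "(\<lambda>m. exp (- (1 / (real (Suc m) * y)))) \<longlonglongrightarrow> exp (- 0)" if "y > 0" for y
  proof (intro tendsto_intros)
    have "(\<lambda>m. inverse (real (Suc m)) * inverse y) \<longlonglongrightarrow> 0 * inverse y"
      by (intro tendsto_mult LIMSEQ_inverse_real_of_nat tendsto_const)
    then show "(\<lambda>m. 1 / (real (Suc m) * y)) \<longlonglongrightarrow> 0" by (simp add: inverse_eq_divide)
  qed
  have "(\<lambda>m. exp (- (1 / (real (Suc m) * x))) * exp (- (1 / (real (Suc m) * (e - x))))) \<longlonglongrightarrow> exp (-0) * exp (-0)"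
    by (intro tendsto_mult L) (use True in auto)
  then show ?thesis using True by (simp add: bump_def flat_exp_def zero_less_mult_iff)
qed (auto simp: bump_0)

lemma continuous_bump: "continuous_on S (bump e m)"
  using smooth_expr_differentiable[OF smooth_expr_bump[of e m 0]]
  by (intro continuous_at_imp_continuous_on) (auto intro: field_differentiable_imp_continuous_at)

lemma integral_vanish: "(\<And>x. x \<in> S \<Longrightarrow> f x = 0) \<Longrightarrow> integral S f = 0"
  by (rule integral_unique[OF has_integral_is_0])

text \<open>
  A smooth version of the function that vanishes before \<open>0\<close>, has slope one on \<open>[0, e]\<close> and is
  constant afterwards. The difference of two translates is a smooth trapezoid, the test
  function below. The integral starts at \<open>-1\<close> so that the derivative at \<open>0\<close> is an interior
  one.
\<close>

definition ramp :: "real \<Rightarrow> nat \<Rightarrow> real \<Rightarrow> real" where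
  "ramp e m x = integral {-1..x} (bump e m)"

lemma bump_integrable [simp]: "bump e m integrable_on {a..b}"
  by (intro integrable_continuous_real continuous_bump)

lemma ramp_neg: "x \<le> 0 \<Longrightarrow> ramp e m x = 0"
  unfolding ramp_def by (intro integral_vanish) (auto simp: bump_0)

lemma ramp_const: "e > 0 \<Longrightarrow> x \<ge> e \<Longrightarrow> ramp e m x = ramp e m e"
  unfolding ramp_def using Henstock_Kurzweil_Integration.integral_combine[of "-1" e x "bump e m"]
  integral_vanish[of "{e..x}" "bump e m"] by (simp add: bump_0)

lemma ramp_deriv: "(ramp e m has_real_derivative bump e m x) (at x)"
proof (cases "x < 0")
  case True
  have "((\<lambda>_. 0) has_real_derivative 0) (at x)" by simp
  then have "(ramp e m has_real_derivative 0) (at x)"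
    by (rule DERIV_cong_ev[THEN iffD1, rotated 3, OF _ refl _ refl])
       (use True in \<open>auto simp: ramp_neg eventually_nhds intro!: exI[of _ "{..<0}"]\<close>)
  then show ?thesis using True by (simp add: bump_0)
next
  case False
  have "(ramp e m has_real_derivative bump e m x) (at x within {-1..x+1})"
    unfolding ramp_def using False by (intro integral_has_real_derivative continuous_bump) auto
  moreover have "at x within {-1..x+1} = at x" using False by (intro at_within_interior) auto
  ultimately show ?thesis by simp
qed

lemma ramp_bounds: assumes "e > 0" shows "0 \<le> ramp e m x" "ramp e m x \<le> e"
proof -
  show "0 \<le> ramp e m x" unfolding ramp_def by (intro Henstock_Kurzweil_Integration.integral_nonneg) (auto simp: bump_bounds)
  show "ramp e m x \<le> e"
  proof (cases "x \<le> 0")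
    case False
    define y where "y = min x e"
    have y: "0 < y" "y \<le> e" using assms False by (auto simp: y_def)
    have "ramp e m x = ramp e m y" using ramp_const[OF assms, of x m] by (auto simp: y_def min_def)
    also have "\<dots> = integral {-1..0} (bump e m) + integral {0..y} (bump e m)"
      unfolding ramp_def using y by (intro Henstock_Kurzweil_Integration.integral_combine[symmetric]) auto
    also have "integral {-1..0} (bump e m) = 0" by (intro integral_vanish) (auto simp: bump_0)
    also have "integral {0..y} (bump e m) \<le> integral {0..y} (\<lambda>_. 1)"
      by (intro integral_le) (auto simp: bump_bounds)
    finally show ?thesis using y by simp
  qed (use assms in \<open>simp add: ramp_neg\<close>)
qed

definition ramp' :: "real \<Rightarrow> real \<Rightarrow> real" where
  "ramp' e x = integral {-1..x} (indicat_real {0<..<e})"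

lemma ramp_tendsto: "(\<lambda>m. ramp e m x) \<longlonglongrightarrow> ramp' e x"
  unfolding ramp_def ramp'_def
  by (rule dominated_convergence[of _ _ "\<lambda>_. 1"]) (auto simp: bump_bounds bump_tendsto)

lemma ramp'_neg: "x \<le> 0 \<Longrightarrow> ramp' e x = 0"
  unfolding ramp'_def by (intro integral_vanish) auto

lemma ramp'_ge: assumes "0 < e" "e \<le> x" shows "ramp' e x = e"
proof -
  have "{0<..<e} \<inter> {-1..x} = {0<..<e}" using assms by auto
  then show ?thesis using assms unfolding ramp'_def by (subst integral_indicator) auto
qed

lemma test_trapezoid:
  assumes "a < b" "e > 0"
  shows "test_function (\<lambda>x. ramp e m (x - a) - ramp e m (x - b))"
    and "deriv (\<lambda>x. ramp e m (x - a) - ramp e m (x - b)) = (\<lambda>x. bump e m (x - a) - bump e m (x - b))"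
proof -
  let ?P = "\<lambda>x. ramp e m (x - a) - ramp e m (x - b)"
  have d: "(?P has_real_derivative bump e m (x - a) - bump e m (x - b)) (at x)" for x
    by (auto intro!: derivative_eq_intros DERIV_chain2[OF ramp_deriv])
  then show "deriv ?P = (\<lambda>x. bump e m (x - a) - bump e m (x - b))" by (auto simp: DERIV_imp_deriv)
  have s: "smooth_expr (\<lambda>x. bump e m (x - a) - bump e m (x - b))"
    using smooth_expr.add[OF smooth_expr_bump smooth_expr.cmult[OF smooth_expr_bump, of "-1"], of e m a e m b] by simp
  have "{x. ?P x \<noteq> 0} \<subseteq> {a..b+e}"
  proof
    fix x assume "x \<in> {x. ?P x \<noteq> 0}"
    then show "x \<in> {a..b+e}"
      using ramp_neg[of "x - a" e m] ramp_neg[of "x - b" e m] ramp_const[of e "x - a" m] ramp_const[of e "x - b" m] assms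
      by (cases "x < a"; cases "x > b + e") auto
  qed
  then have "bounded {x. ?P x \<noteq> 0}" using bounded_subset bounded_closed_interval by blast
  then have "compact (closure {x. ?P x \<noteq> 0})" by (rule compact_closure[THEN iffD2])
  then show "test_function ?P"
    unfolding test_function_def using primitive_smooth[OF s d] by blast
qed

section \<open>Weak derivatives and the fundamental theorem of calculus\<close>

lemma L2_bounded_support:
  assumes [measurable]: "f \<in> borel_measurable lebesgue"
    and "\<And>x. cmod (f x) \<le> B" "\<And>x. x \<notin> {a..b} \<Longrightarrow> f x = 0"
  shows "L2 f"
proof (rule L2I_bound)
  show "integrable lebesgue (\<lambda>x. B\<^sup>2 * indicator {a..b} x)"
    by (intro integrable_mult_right integrable_real_indicator) (auto simp: emeasure_lborel_Icc_eq)
  have "(cmod (f x))\<^sup>2 \<le> B\<^sup>2 * indicator {a..b} x" for x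
    using assms(2)[of x] assms(3)[of x] by (auto simp: indicator_def intro: power_mono)
  then show "AE x in lebesgue. (cmod (f x))\<^sup>2 \<le> B\<^sup>2 * indicator {a..b} x" by simp
qed fact

lemma borel_measurable_lebesgue: "f \<in> borel_measurable borel \<Longrightarrow> f \<in> borel_measurable lebesgue"
  by (simp add: measurable_completion)

lemma L2_weight:
  fixes w :: "real \<Rightarrow> real"
  assumes "w \<in> borel_measurable borel" "\<And>x. \<bar>w x\<bar> \<le> B" "\<And>x. x \<notin> {a..b} \<Longrightarrow> w x = 0"
  shows "L2 (\<lambda>x. of_real (w x))"
  by (rule L2_bounded_support[of _ B a b]) (use assms in \<open>auto intro: borel_measurable_lebesgue\<close>)

lemma L2_set_integrable: "L2 f \<Longrightarrow> set_integrable lebesgue {a..b::real} f"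
  using L2_mult_integrable[OF L2_weight[of "indicator {a..b}" 1 a b], of f]
  by (simp add: set_integrable_def scaleR_conv_of_real)

lemma L2_integrable_on: "L2 f \<Longrightarrow> f integrable_on {a..b}"
  using set_lebesgue_integral_eq_integral(1)[OF L2_set_integrable] .

lemma L2_integral_eq: "L2 f \<Longrightarrow> (\<integral>x. f x * of_real (indicator {a..b} x) \<partial>lebesgue) = integral {a..b} f"
  using set_lebesgue_integral_eq_integral(2)[OF L2_set_integrable, of f a b]
  by (simp add: set_lebesgue_integral_def scaleR_conv_of_real mult.commute)

lemma L2_weight_dominated:
  fixes w :: "nat \<Rightarrow> real \<Rightarrow> real"
  assumes f: "L2 f" and [measurable]: "\<And>m. w m \<in> borel_measurable borel"
    and B: "\<And>m x. \<bar>w m x\<bar> \<le> B * indicator {a..b} x"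
    and lim: "\<And>x. (\<lambda>m. w m x) \<longlonglongrightarrow> v x"
  shows "(\<lambda>m. \<integral>x. f x * of_real (w m x) \<partial>lebesgue) \<longlonglongrightarrow> (\<integral>x. f x * of_real (v x) \<partial>lebesgue)"
proof (rule integral_dominated_convergence)
  have [measurable]: "v \<in> borel_measurable borel"
    by (rule borel_measurable_LIMSEQ_real[OF lim]) simp
  have B0: "B \<ge> 0" if "a \<le> b" using B[of 0 a] that by (simp add: order_trans[OF abs_ge_zero])
  have L: "L2 (\<lambda>x. of_real (B * indicator {a..b} x))"
    by (rule L2_weight[of _ "\<bar>B\<bar>" a b]) (auto simp: indicator_def)
  show "integrable lebesgue (\<lambda>x. cmod (f x * of_real (B * indicator {a..b} x)))"
    by (intro integrable_norm L2_mult_integrable f L)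
  show "AE x in lebesgue. (\<lambda>m. f x * of_real (w m x)) \<longlonglongrightarrow> f x * of_real (v x)"
    by (intro AE_I2 tendsto_intros lim)
  show "AE x in lebesgue. cmod (f x * of_real (w m x)) \<le> cmod (f x * of_real (B * indicator {a..b} x))" for m
  proof (rule AE_I2)
    fix x show "cmod (f x * of_real (w m x)) \<le> cmod (f x * of_real (B * indicator {a..b} x))"
      using B[of m x] unfolding norm_mult norm_of_real by (intro mult_left_mono) (linarith, simp)
  qed
  have "f \<in> borel_measurable lebesgue" using f by (rule L2_measurable)
  then show "(\<lambda>x. f x * of_real (v x)) \<in> borel_measurable lebesgue"
    by (intro borel_measurable_times) (auto intro: borel_measurable_lebesgue)
  show "(\<lambda>x. f x * of_real (w m x)) \<in> borel_measurable lebesgue" for m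
    using \<open>f \<in> borel_measurable lebesgue\<close>
    by (intro borel_measurable_times) (auto intro: borel_measurable_lebesgue)
qed

text \<open>
  One-sided form of the Lebesgue differentiation theorem, along sequences.
\<close>

lemma lebesgue_point:
  assumes "L2 f"
  obtains N where "negligible N"
    "\<And>x u. x \<notin> N \<Longrightarrow> u \<longlonglongrightarrow> 0 \<Longrightarrow> (\<And>n. u n > 0) \<Longrightarrow> (\<lambda>n. integral {x..x + u n} f /\<^sub>R u n) \<longlonglongrightarrow> f x"
proof -
  have "f integrable_on cbox a b" for a b using L2_integrable_on[OF assms] by simp
  then obtain N where N: "negligible N"
    "\<And>x e. \<lbrakk>x \<notin> N; 0 < e\<rbrakk> \<Longrightarrow> \<exists>d>0. \<forall>h. 0 < h \<and> h < d \<longrightarrow>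
         norm(integral (cbox x (x + h *\<^sub>R One)) f /\<^sub>R h ^ DIM(real) - f x) < e"
    using integrable_ccontinuous_explicit[of f] by blast
  show thesis
  proof (rule that[OF N(1)])
    fix x and u :: "nat \<Rightarrow> real" assume x: "x \<notin> N" and u: "u \<longlonglongrightarrow> 0" "\<And>n. u n > 0"
    show "(\<lambda>n. integral {x..x + u n} f /\<^sub>R u n) \<longlonglongrightarrow> f x"
    proof (rule tendstoI)
      fix e :: real assume "e > 0"
      then obtain d where d: "d > 0" "\<forall>h. 0 < h \<and> h < d \<longrightarrow> norm(integral (cbox x (x + h *\<^sub>R One)) f /\<^sub>R h ^ DIM(real) - f x) < e"
        using N(2)[OF x] by blast
      have "\<forall>\<^sub>F n in sequentially. u n < d" using u(1) d(1) by (rule order_tendstoD)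
      then show "\<forall>\<^sub>F n in sequentially. dist (integral {x..x + u n} f /\<^sub>R u n) (f x) < e"
        by eventually_elim (use d(2) u(2) in \<open>auto simp: dist_norm\<close>)
    qed
  qed
qed

lemma continuous_ramp: "continuous_on S (ramp e m)"
  by (intro continuous_at_imp_continuous_on ballI DERIV_isCont[OF ramp_deriv])

text \<open>
  Testing with smooth trapezoids and letting their slopes become sharp: the derivative of the
  trapezoid is \<open>1\<close> on \<open>[a, a + e]\<close> and \<open>-1\<close> on \<open>[b, b + e]\<close>.
\<close>

lemma weak_deriv_trapezoid:
  assumes fg: "L2 f" "L2 g" "has_weak_deriv f g" and ab: "a < b" and e: "e > 0"
  shows "integral {a..a+e} f - integral {b..b+e} f =
    - (\<integral>x. g x * of_real (ramp' e (x - a) - ramp' e (x - b)) \<partial>lebesgue)"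
proof -
  have 1: "(\<integral>x. f x * of_real (bump e m (x - a) - bump e m (x - b)) \<partial>lebesgue) =
     - (\<integral>x. g x * of_real (ramp e m (x - a) - ramp e m (x - b)) \<partial>lebesgue)" for m
    using fg(3) test_trapezoid[OF ab e, of m] unfolding has_weak_deriv_def by auto
  have m: "bump e m \<in> borel_measurable borel" "ramp e m \<in> borel_measurable borel" for m
    by (auto intro!: borel_measurable_continuous_onI continuous_bump continuous_ramp)
  have 2: "(\<lambda>m. \<integral>x. f x * of_real (bump e m (x - a) - bump e m (x - b)) \<partial>lebesgue) \<longlonglongrightarrow>
     (\<integral>x. f x * of_real (indicator {0<..<e} (x - a) - indicator {0<..<e} (x - b)) \<partial>lebesgue)"
  proof (rule L2_weight_dominated[OF fg(1), of _ 1 a "b+e"])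
    show "\<bar>bump e m (x - a) - bump e m (x - b)\<bar> \<le> 1 * indicator {a..b+e} x" for m x
      using bump_bounds[of e m "x-a"] bump_bounds[of e m "x-b"] bump_0[of "x-a" e m] bump_0[of "x-b" e m] ab
      by (auto simp: indicator_def)
  qed (auto intro!: tendsto_intros bump_tendsto borel_measurable_diff measurable_compose[OF _ m(1)])
  have 3: "(\<lambda>m. \<integral>x. g x * of_real (ramp e m (x - a) - ramp e m (x - b)) \<partial>lebesgue) \<longlonglongrightarrow>
     (\<integral>x. g x * of_real (ramp' e (x - a) - ramp' e (x - b)) \<partial>lebesgue)"
  proof (rule L2_weight_dominated[OF fg(2), of _ e a "b+e"])
    show "\<bar>ramp e m (x - a) - ramp e m (x - b)\<bar> \<le> e * indicator {a..b+e} x" for m x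
      using ramp_bounds[OF e, of m "x-a"] ramp_bounds[OF e, of m "x-b"] ramp_neg[of "x - a" e m] ramp_neg[of "x - b" e m]
        ramp_const[of e "x - a" m] ramp_const[of e "x - b" m] ab e
      by (auto simp: indicator_def)
  qed (auto intro!: tendsto_intros ramp_tendsto borel_measurable_diff measurable_compose[OF _ m(2)])
  have 4: "(\<integral>x. f x * of_real (indicator {0<..<e} (x - a) - indicator {0<..<e} (x - b)) \<partial>lebesgue) =
    - (\<integral>x. g x * of_real (ramp' e (x - a) - ramp' e (x - b)) \<partial>lebesgue)"
    by (rule LIMSEQ_unique[OF 2]) (unfold 1, intro tendsto_minus 3)
  have 5: "(\<integral>x. f x * of_real (indicator {0<..<e} (x - c)) \<partial>lebesgue) = integral {c..c+e} f" for c
  proof -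
    have "AE x in lebesgue. x \<notin> {c, c+e}"
      using negligible_finite[of "{c, c+e}"] by (intro AE_not_in) (simp add: negligible_iff_null_sets)
    then have "AE x in lebesgue. f x * of_real (indicator {0<..<e} (x - c)) = f x * of_real (indicator {c..c+e} x)"
      by eventually_elim (auto simp: indicator_def)
    moreover have "integrable lebesgue (\<lambda>x. f x * of_real (indicator {0<..<e} (x - c)))"
      by (rule L2_mult_integrable[OF fg(1) L2_weight[of _ 1 c "c+e"]]) (auto simp: indicator_def)
    moreover have "integrable lebesgue (\<lambda>x. f x * of_real (indicator {c..c+e} x))"
      by (rule L2_mult_integrable[OF fg(1) L2_weight[of _ 1 c "c+e"]]) (auto simp: indicator_def)
    ultimately have "(\<integral>x. f x * of_real (indicator {0<..<e} (x - c)) \<partial>lebesgue) = (\<integral>x. f x * of_real (indicator {c..c+e} x) \<partial>lebesgue)"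
      by (intro integral_cong_AE) auto
    then show ?thesis using L2_integral_eq[OF fg(1)] by simp
  qed
  have "(\<integral>x. f x * of_real (indicator {0<..<e} (x - a) - indicator {0<..<e} (x - b)) \<partial>lebesgue)
     = (\<integral>x. f x * of_real (indicator {0<..<e} (x - a)) \<partial>lebesgue) - (\<integral>x. f x * of_real (indicator {0<..<e} (x - b)) \<partial>lebesgue)"
    unfolding of_real_diff right_diff_distrib
    by (intro Bochner_Integration.integral_diff L2_mult_integrable fg(1) L2_weight[of _ 1 a "a+e"] L2_weight[of _ 1 b "b+e"]) (auto simp: indicator_def)
  then show ?thesis using 4 5 by simp
qed

lemma measurable_ramp': "ramp' e \<in> borel_measurable borel"
  by (rule borel_measurable_LIMSEQ_real[OF ramp_tendsto])
     (intro borel_measurable_continuous_onI continuous_ramp)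

lemma ramp'_bounds: "e > 0 \<Longrightarrow> 0 \<le> ramp' e x" "e > 0 \<Longrightarrow> ramp' e x \<le> e"
  using LIMSEQ_le_const[OF ramp_tendsto] LIMSEQ_le_const2[OF ramp_tendsto] ramp_bounds by blast+

text \<open>
  Divide the identity for trapezoids by \<open>e\<close> and let \<open>e\<close> tend to zero. At Lebesgue points \<open>a\<close>,
  \<open>b\<close> of \<open>f\<close> the left side converges to \<open>f a - f b\<close>, while the normalized trapezoid converges
  to the indicator function of \<open>(a, b]\<close>.
\<close>

lemma weak_FTC:
  assumes fg: "L2 f" "L2 g" "has_weak_deriv f g"
  obtains N where "negligible N" "\<And>a b. a \<notin> N \<Longrightarrow> b \<notin> N \<Longrightarrow> a < b \<Longrightarrow> f b - f a = integral {a..b} g"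
proof -
  obtain N where N: "negligible N"
    "\<And>x u. x \<notin> N \<Longrightarrow> u \<longlonglongrightarrow> 0 \<Longrightarrow> (\<And>n. u n > 0) \<Longrightarrow> (\<lambda>n. integral {x..x + u n} f /\<^sub>R u n) \<longlonglongrightarrow> f x"
    using lebesgue_point[OF fg(1)] by blast
  show thesis
  proof (rule that[OF N(1)])
    fix a b :: real assume ab: "a \<notin> N" "b \<notin> N" "a < b"
    define u where "u n = inverse (real (Suc n))" for n
    have u: "u \<longlonglongrightarrow> 0" "\<And>n. u n > 0" "\<And>n. u n \<le> 1"
      unfolding u_def by (rule LIMSEQ_inverse_real_of_nat) (auto simp: divide_simps)
    have L: "(\<lambda>n. integral {a..a + u n} f /\<^sub>R u n - integral {b..b + u n} f /\<^sub>R u n) \<longlonglongrightarrow> f a - f b"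
      by (intro tendsto_diff N(2) ab u)
    have R: "(\<lambda>n. \<integral>x. g x * of_real ((ramp' (u n) (x - a) - ramp' (u n) (x - b)) / u n) \<partial>lebesgue)
       \<longlonglongrightarrow> (\<integral>x. g x * of_real (indicator {a<..b} x) \<partial>lebesgue)"
    proof (rule L2_weight_dominated[OF fg(2), of _ 1 a "b+1"])
      show "\<bar>(ramp' (u m) (x - a) - ramp' (u m) (x - b)) / u m\<bar> \<le> 1 * indicator {a..b + 1} x" for m x
      proof -
        have "\<bar>ramp' (u m) (x - a) - ramp' (u m) (x - b)\<bar> \<le> u m * indicator {a..b + 1} x"
          using ramp'_bounds[OF u(2)[of m], of "x-a"] ramp'_bounds[OF u(2)[of m], of "x-b"] ramp'_neg[of "x-a" "u m"] ramp'_neg[of "x-b" "u m"]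
            ramp'_ge[of "u m" "x-a"] ramp'_ge[of "u m" "x-b"] u(2,3)[of m] ab
          by (auto simp: indicator_def)
        then show ?thesis using u(2)[of m] by (simp add: divide_simps abs_mult mult.commute)
      qed
      have lim: "(\<lambda>n. ramp' (u n) y / u n) \<longlonglongrightarrow> indicator {0<..} y" for y
      proof (cases "y \<le> 0")
        case False
        then have "\<forall>\<^sub>F n in sequentially. u n < y" using u(1) by (intro order_tendstoD) auto
        then have "\<forall>\<^sub>F n in sequentially. 1 = ramp' (u n) y / u n"
          by eventually_elim (use u(2) in \<open>auto simp: ramp'_ge less_imp_neq[symmetric]\<close>)
        with tendsto_const have "(\<lambda>n. ramp' (u n) y / u n) \<longlonglongrightarrow> 1" by (rule Lim_transform_eventually)
        then show ?thesis using False by simp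
      qed (simp add: ramp'_neg)
      have "(\<lambda>m. ramp' (u m) (x - a) / u m - ramp' (u m) (x - b) / u m) \<longlonglongrightarrow> indicator {0<..} (x - a) - indicator {0<..} (x - b)" for x
        by (intro tendsto_intros lim)
      moreover have "indicator {0<..} (x - a) - indicator {0<..} (x - b) = (indicator {a<..b} x :: real)" for x
        using ab by (auto simp: indicator_def)
      ultimately show "(\<lambda>m. (ramp' (u m) (x - a) - ramp' (u m) (x - b)) / u m) \<longlonglongrightarrow> indicator {a<..b} x" for x
        by (simp add: diff_divide_distrib)
      show "(\<lambda>x. (ramp' (u m) (x - a) - ramp' (u m) (x - b)) / u m) \<in> borel_measurable borel" for m
        by (intro borel_measurable_divide borel_measurable_diff measurable_compose[OF _ measurable_ramp'] borel_measurable_const) auto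
    qed
    have "(\<integral>x. g x * of_real ((ramp' (u n) (x - a) - ramp' (u n) (x - b)) / u n) \<partial>lebesgue)
      = - (integral {a..a + u n} f /\<^sub>R u n - integral {b..b + u n} f /\<^sub>R u n)" for n
    proof -
      define I where "I = (\<integral>x. g x * of_real (ramp' (u n) (x - a) - ramp' (u n) (x - b)) \<partial>lebesgue)"
      have I: "I = - (integral {a..a + u n} f - integral {b..b + u n} f)"
        using weak_deriv_trapezoid[OF fg ab(3) u(2)[of n]] by (simp add: I_def)
      have "(\<integral>x. g x * of_real ((ramp' (u n) (x - a) - ramp' (u n) (x - b)) / u n) \<partial>lebesgue) = I * of_real (inverse (u n))"
        unfolding I_def integral_mult_left_zero[symmetric] by (simp add: divide_inverse mult.assoc)
      then show ?thesis unfolding I by (simp add: scaleR_conv_of_real algebra_simps)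
    qed
    then have "(\<integral>x. g x * of_real (indicator {a<..b} x) \<partial>lebesgue) = - (f a - f b)"
      using R tendsto_minus[OF L] LIMSEQ_unique by auto
    moreover have "(\<integral>x. g x * of_real (indicator {a<..b} x) \<partial>lebesgue) = (\<integral>x. g x * of_real (indicator {a..b} x) \<partial>lebesgue)"
    proof (rule integral_cong_AE)
      have "AE x in lebesgue. x \<notin> {a}"
        using negligible_finite[of "{a}"] by (intro AE_not_in) (simp add: negligible_iff_null_sets)
      then show "AE x in lebesgue. g x * of_real (indicator {a<..b} x) = g x * of_real (indicator {a..b} x)"
        by eventually_elim (auto simp: indicator_def)
    qed (rule borel_measurable_integrable, rule L2_mult_integrable[OF fg(2)], rule L2_weight[of _ 1 a b], auto simp: indicator_def)+
    ultimately show "f b - f a = integral {a..b} g"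
      using L2_integral_eq[OF fg(2)] by simp
  qed
qed

section \<open>Weak derivatives as limits of difference quotients\<close>

lemma integral_sq_le:
  assumes "L2 g" "h > 0"
  shows "(cmod (integral {a..a+h} g))\<^sup>2 \<le> h * (\<integral>x. (cmod (g x))\<^sup>2 * indicator {a..a+h} x \<partial>lebesgue)"
proof -
  define w where "w = (\<lambda>x. complex_of_real (indicator {a..a+h} x))"
  have w: "L2 w" unfolding w_def by (rule L2_weight[of _ 1 a "a+h"]) auto
  have gw: "L2 (\<lambda>x. g x * w x)"
    by (rule L2I_bound[OF _ L2_integrable[OF assms(1)]])
       (use borel_measurable_times[OF L2_measurable[OF assms(1)] L2_measurable[OF w]] in \<open>auto simp: w_def indicator_def\<close>)
  have "integral {a..a+h} g = (\<integral>x. g x * w x * w x \<partial>lebesgue)"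
    unfolding L2_integral_eq[OF assms(1), symmetric] w_def by (rule Bochner_Integration.integral_cong) (auto simp: indicator_def)
  then have "cmod (integral {a..a+h} g) \<le> (\<integral>x. cmod (g x * w x * w x) \<partial>lebesgue)"
    by (simp add: integral_norm_bound)
  also have "\<dots> \<le> norm (mk (\<lambda>x. g x * w x)) * norm (mk w)"
    by (rule integral_norm_mult_le[OF gw w])
  finally have "(cmod (integral {a..a+h} g))\<^sup>2 \<le> (norm (mk (\<lambda>x. g x * w x)))\<^sup>2 * (norm (mk w))\<^sup>2"
    unfolding power_mult_distrib[symmetric] by (rule power_mono) simp
  also have "(norm (mk w))\<^sup>2 = h"
  proof -
    have "(\<lambda>x. (cmod (w x))\<^sup>2) = indicator {a..a+h}" by (auto simp: w_def indicator_def)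
    then show ?thesis unfolding norm_mk_sq[OF w] using assms(2) by (simp add: measure_completion)
  qed
  also have "(norm (mk (\<lambda>x. g x * w x)))\<^sup>2 = (\<integral>x. (cmod (g x))\<^sup>2 * indicator {a..a+h} x \<partial>lebesgue)"
    unfolding norm_mk_sq[OF gw]
    by (rule Bochner_Integration.integral_cong) (auto simp: w_def indicator_def)
  finally show ?thesis by (simp add: mult.commute)
qed

text \<open>
  Averages over intervals of length \<open>h\<close> do not increase the norm: by Cauchy--Schwarz \<open>h |G
  x|\<^sup>2 \<le> \<integral> |g|\<^sup>2\<close> over \<open>[x, x + h]\<close>, and by Tonelli every point \<open>z\<close> is counted for a set of
  \<open>x\<close> of measure \<open>h\<close>. Tonelli is applied to a Borel function \<open>q\<close> that agrees with \<open>|g|\<^sup>2\<close>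
  almost everywhere.
\<close>

lemma average_contraction:
  assumes "L2 g" "h > 0" "L2 G" and G: "AE x in lebesgue. G x = integral {x..x+h} g /\<^sub>R h"
  shows "norm (mk G) \<le> norm (mk g)"
proof -
  have gm: "g \<in> borel_measurable lebesgue" using assms(1) by (rule L2_measurable)
  have "(\<lambda>x. ennreal ((cmod (g x))\<^sup>2)) \<in> borel_measurable lebesgue"
    using gm by measurable
  then obtain q where q[measurable]: "q \<in> borel_measurable lborel" and qg: "AE x in lborel. ennreal ((cmod (g x))\<^sup>2) = q x"
    using completion_ex_borel_measurable by blast
  have qg': "AE x in lebesgue. ennreal ((cmod (g x))\<^sup>2) = q x" using qg by (rule AE_completion)
  define k where "k = (\<lambda>x z. q z * indicator {x..x+h} z)"
  have km: "(\<lambda>(x, z). k x z) \<in> borel_measurable (lborel \<Otimes>\<^sub>M lborel)"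
  proof -
    have "(\<lambda>p. q (snd p) * (indicator {p. fst p \<le> snd p \<and> snd p \<le> fst p + h} p)) \<in> borel_measurable (lborel \<Otimes>\<^sub>M lborel)"
      by measurable
    moreover have "(\<lambda>(x, z). k x z) = (\<lambda>p. q (snd p) * (indicator {p. fst p \<le> snd p \<and> snd p \<le> fst p + h} p))"
      by (auto simp: k_def indicator_def)
    ultimately show ?thesis by simp
  qed
  have 1: "ennreal (h * (cmod (G x))\<^sup>2) \<le> (\<integral>\<^sup>+z. k x z \<partial>lborel)" if x: "G x = integral {x..x+h} g /\<^sub>R h" for x
  proof -
    have I: "integrable lebesgue (\<lambda>z. (cmod (g z))\<^sup>2 * indicator {x..x+h} z)"
      using integrable_mult_indicator[OF _ L2_integrable[OF assms(1)], of "{x..x+h}"] by (simp add: mult.commute)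
    have "h * (cmod (G x))\<^sup>2 = (cmod (integral {x..x+h} g))\<^sup>2 / h"
      using assms(2) unfolding x by (simp add: power_mult_distrib power2_eq_square divide_simps)
    also have "\<dots> \<le> (\<integral>z. (cmod (g z))\<^sup>2 * indicator {x..x+h} z \<partial>lebesgue)"
      using integral_sq_le[OF assms(1,2), of x] assms(2) by (simp add: divide_simps mult.commute)
    finally have "ennreal (h * (cmod (G x))\<^sup>2) \<le> ennreal (\<integral>z. (cmod (g z))\<^sup>2 * indicator {x..x+h} z \<partial>lebesgue)"
      by (rule ennreal_leI)
    also have "\<dots> = (\<integral>\<^sup>+z. ennreal ((cmod (g z))\<^sup>2 * indicator {x..x+h} z) \<partial>lebesgue)"
      by (rule nn_integral_eq_integral[OF I, symmetric]) auto
    also have "\<dots> = (\<integral>\<^sup>+z. k x z \<partial>lebesgue)"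
      by (rule nn_integral_cong_AE) (use qg' in eventually_elim, auto simp: k_def indicator_def)
    finally show ?thesis by (simp add: nn_integral_completion)
  qed
  have "ennreal (h * (norm (mk G))\<^sup>2) = ennreal h * (\<integral>\<^sup>+x. ennreal ((cmod (G x))\<^sup>2) \<partial>lebesgue)"
    unfolding norm_mk_sq[OF assms(3)] using assms(2)
    by (subst nn_integral_eq_integral[OF L2_integrable[OF assms(3)]]) (auto simp: ennreal_mult)
  also have "\<dots> = (\<integral>\<^sup>+x. ennreal (h * (cmod (G x))\<^sup>2) \<partial>lebesgue)"
    using L2_measurable[OF assms(3)] assms(2)
    by (subst nn_integral_cmult[symmetric]) (auto simp: ennreal_mult)
  also have "\<dots> \<le> (\<integral>\<^sup>+x. (\<integral>\<^sup>+z. k x z \<partial>lborel) \<partial>lebesgue)"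
    by (rule nn_integral_mono_AE) (use G in eventually_elim, rule 1)
  also have "\<dots> = (\<integral>\<^sup>+x. (\<integral>\<^sup>+z. k x z \<partial>lborel) \<partial>lborel)"
    by (rule nn_integral_completion)
  also have "\<dots> = (\<integral>\<^sup>+z. (\<integral>\<^sup>+x. k x z \<partial>lborel) \<partial>lborel)"
    by (rule lborel_pair.Fubini'[symmetric]) (use km in auto)
  also have "\<dots> = (\<integral>\<^sup>+z. q z * ennreal h \<partial>lborel)"
  proof (rule nn_integral_cong)
    fix z :: real
    have "(\<integral>\<^sup>+x. k x z \<partial>lborel) = (\<integral>\<^sup>+x. q z * indicator {z-h..z} x \<partial>lborel)"
      unfolding k_def by (rule nn_integral_cong) (auto simp: indicator_def)
    also have "\<dots> = q z * emeasure lborel {z-h..z}" by (rule nn_integral_cmult_indicator) simp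
    finally show "(\<integral>\<^sup>+x. k x z \<partial>lborel) = q z * ennreal h" using assms(2) by simp
  qed
  also have "\<dots> = (\<integral>\<^sup>+z. q z \<partial>lborel) * ennreal h" by (rule nn_integral_multc) simp
  also have "(\<integral>\<^sup>+z. q z \<partial>lborel) = (\<integral>\<^sup>+z. q z \<partial>lebesgue)" by (simp add: nn_integral_completion)
  also have "\<dots> = (\<integral>\<^sup>+z. ennreal ((cmod (g z))\<^sup>2) \<partial>lebesgue)"
    by (rule nn_integral_cong_AE) (use qg' in eventually_elim, simp)
  also have "\<dots> = ennreal ((norm (mk g))\<^sup>2)"
    unfolding norm_mk_sq[OF assms(1)] by (rule nn_integral_eq_integral[OF L2_integrable[OF assms(1)]]) simp
  also have "\<dots> * ennreal h = ennreal (h * (norm (mk g))\<^sup>2)"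
    using assms(2) by (simp add: ennreal_mult mult.commute)
  finally have "h * (norm (mk G))\<^sup>2 \<le> h * (norm (mk g))\<^sup>2"
    using assms(2) by (subst (asm) ennreal_le_iff) auto
  then have "(norm (mk G))\<^sup>2 \<le> (norm (mk g))\<^sup>2" using assms(2) by simp
  then show ?thesis by (rule power2_le_imp_le) simp
qed

text \<open>
  By the parallelogram law the distance to the limit is small as soon as \<open>\<parallel>Y k + g\<parallel>\<close> is close
  to \<open>2 \<parallel>g\<parallel>\<close>, and Fatou's lemma forbids that this norm stays below \<open>2 \<parallel>g\<parallel>\<close> along a
  subsequence.
\<close>

lemma AE_bounded_tendsto:
  fixes Y :: "nat \<Rightarrow> l2"
  assumes lim: "AE x in lebesgue. (\<lambda>k. fn (Y k) x) \<longlonglongrightarrow> fn g x" and le: "\<And>k. norm (Y k) \<le> norm g"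
  shows "Y \<longlonglongrightarrow> g"
proof (rule tendstoI)
  fix e :: real assume e: "e > 0"
  have par: "(dist (Y k) g)\<^sup>2 \<le> 4 * (norm g)\<^sup>2 - (norm (Y k + g))\<^sup>2" for k
  proof -
    have "(norm (Y k))\<^sup>2 \<le> (norm g)\<^sup>2" using le[of k] by (intro power_mono) auto
    then show ?thesis
      by (simp add: dist_norm power2_norm_eq_inner inner_diff_left inner_diff_right inner_add_left inner_add_right inner_commute)
  qed
  show "\<forall>\<^sub>F k in sequentially. dist (Y k) g < e"
  proof (rule ccontr)
    assume "\<not> ?thesis"
    then have inf: "infinite {k. dist (Y k) g \<ge> e}"
      by (simp add: not_eventually not_less frequently_cofinite cofinite_eq_sequentially[symmetric])
    then obtain r :: "nat \<Rightarrow> nat" where r: "strict_mono r" "\<And>k. dist (Y (r k)) g \<ge> e"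
      using infinite_enumerate by blast
    \<comment> \<open>If the distance stays above \<open>e\<close>, the parallelogram law keeps \<open>Y (r k) + g\<close> below \<open>c < 2 \<parallel>g\<parallel>\<close>.\<close>
    define c where "c = sqrt (4 * (norm g)\<^sup>2 - e\<^sup>2)"
    have sq: "(norm (Y (r k) + g))\<^sup>2 \<le> 4 * (norm g)\<^sup>2 - e\<^sup>2" for k
      using par[of "r k"] power_mono[OF r(2)[of k] less_imp_le[OF e], of 2] by linarith
    then have "norm (Y (r k) + g) \<le> c" for k
      unfolding c_def by (rule real_le_rsqrt)
    moreover have "AE x in lebesgue. (\<lambda>k. fn (Y (r k) + g) x) \<longlonglongrightarrow> fn (2 *\<^sub>R g) x"
    proof -
      have "AE x in lebesgue. \<forall>k. fn (Y (r k) + g) x = fn (Y (r k)) x + fn g x"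
        unfolding AE_all_countable using fn_plus by blast
      with lim fn_scaleR[of 2 g] show ?thesis
      proof eventually_elim
        case (elim x)
        have "(\<lambda>k. fn (Y (r k)) x + fn g x) \<longlonglongrightarrow> fn g x + fn g x"
          using LIMSEQ_subseq_LIMSEQ[OF elim(1) r(1)] by (intro tendsto_intros) (simp add: o_def)
        then show ?case using elim by (simp add: scaleR_2)
      qed
    qed
    ultimately have "norm (mk (fn (2 *\<^sub>R g))) \<le> c"
      by (intro l2_fatou(2)[of "\<lambda>k. Y (r k) + g"]) auto
    then have "2 * norm g \<le> c" by simp
    then have "(2 * norm g)\<^sup>2 \<le> c\<^sup>2" by (intro power_mono) auto
    moreover have "c\<^sup>2 = 4 * (norm g)\<^sup>2 - e\<^sup>2"
      unfolding c_def using sq[of 0] by (intro real_sqrt_pow2) (smt (verit) zero_le_power2)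
    ultimately show False using e by (simp add: power_mult_distrib)
  qed
qed

lemma fn_D: "AE x in lebesgue. fn (D n f) x = (fn f (mesh n + x) - fn f x) /\<^sub>R mesh n"
  unfolding D_def
  using fn_scaleR[of "inverse (mesh n)" "shift (mesh n) f - f"] fn_minus[of "shift (mesh n) f" f] fn_shift[of "mesh n" f]
  by eventually_elim simp

text \<open>
  By the fundamental theorem the quotients of \<open>f\<close> are averages of the weak derivative. They
  converge almost everywhere by Lebesgue differentiation and are bounded by its norm, hence
  converge in norm. In particular the weak derivative is unique up to null sets.
\<close>

theorem weak_deriv_imp_h1:
  assumes fg: "L2 f" "L2 g" "has_weak_deriv f g"
  shows "(\<lambda>n. D n (mk f)) \<longlonglongrightarrow> mk g"
proof -
  obtain N where N: "negligible N" "\<And>a b. a \<notin> N \<Longrightarrow> b \<notin> N \<Longrightarrow> a < b \<Longrightarrow> f b - f a = integral {a..b} g"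
    using weak_FTC[OF fg] by blast
  have AN: "AE x in lebesgue. x \<notin> N" using N(1) by (intro AE_not_in) (simp add: negligible_iff_null_sets)
  have ae: "AE x in lebesgue. fn (D n (mk f)) x = integral {x..x + mesh n} g /\<^sub>R mesh n" for n
    using fn_D[of n "mk f"] fn_mk[OF fg(1)] AE_shift[OF fn_mk[OF fg(1)], of "mesh n"] AN AE_shift[OF AN, of "mesh n"]
  proof eventually_elim
    case (elim x)
    then show ?case using N(2)[of x "mesh n + x"] by (simp add: add.commute)
  qed
  have le: "norm (D n (mk f)) \<le> norm (mk g)" for n
    using average_contraction[OF fg(2) mesh_pos(1) L2_fn ae[of n]] by simp
  obtain M where M: "negligible M"
    "\<And>x u. x \<notin> M \<Longrightarrow> u \<longlonglongrightarrow> 0 \<Longrightarrow> (\<And>n. u n > 0) \<Longrightarrow> (\<lambda>n. integral {x..x + u n} g /\<^sub>R u n) \<longlonglongrightarrow> g x"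
    using lebesgue_point[OF fg(2)] by blast
  have AM: "AE x in lebesgue. x \<notin> M" using M(1) by (intro AE_not_in) (simp add: negligible_iff_null_sets)
  have "AE x in lebesgue. \<forall>n. fn (D n (mk f)) x = integral {x..x + mesh n} g /\<^sub>R mesh n"
    unfolding AE_all_countable using ae by blast
  with AM fn_mk[OF fg(2)] have "AE x in lebesgue. (\<lambda>n. fn (D n (mk f)) x) \<longlonglongrightarrow> fn (mk g) x"
  proof eventually_elim
    case (elim x)
    then show ?case using M(2)[OF elim(1) mesh_tendsto] by simp
  qed
  then show ?thesis using le by (rule AE_bounded_tendsto)
qed

lemma test_functionD:
  assumes "test_function \<phi>"
  obtains R B where "R > 0" "\<And>x. x \<notin> {-R..R} \<Longrightarrow> \<phi> x = 0" "\<And>x. (\<phi> has_real_derivative deriv \<phi> x) (at x)"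
    "\<And>x. x \<notin> {-R..R} \<Longrightarrow> deriv \<phi> x = 0" "\<And>x. \<bar>deriv \<phi> x\<bar> \<le> B" "continuous_on UNIV (deriv \<phi>)"
    "\<And>x. (deriv \<phi> has_real_derivative deriv (deriv \<phi>) x) (at x)"
    "continuous_on UNIV (deriv (deriv \<phi>))"
proof -
  have d: "(deriv ^^ n) \<phi> field_differentiable (at x)" for n x using assms by (simp add: test_function_def)
  have der: "(\<phi> has_real_derivative deriv \<phi> x) (at x)" for x
    using d[of 0 x] by (simp add: field_differentiable_derivI)
  have der2: "(deriv \<phi> has_real_derivative deriv (deriv \<phi>) x) (at x)" for x
    using d[of 1 x] by (simp add: field_differentiable_derivI)
  have cont: "continuous_on UNIV (deriv \<phi>)"
    using d[of 1] by (intro continuous_at_imp_continuous_on) (auto intro: field_differentiable_imp_continuous_at)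
  have cont2: "continuous_on UNIV (deriv (deriv \<phi>))"
    using d[of 2] by (intro continuous_at_imp_continuous_on) (auto simp: numeral_2_eq_2 intro: field_differentiable_imp_continuous_at)
  have "bounded {x. \<phi> x \<noteq> 0}"
    using assms compact_imp_bounded bounded_subset closure_subset by (metis test_function_def)
  then obtain R where R: "R > 0" "\<And>x. \<phi> x \<noteq> 0 \<Longrightarrow> \<bar>x\<bar> < R"
    by (auto simp: bounded_pos_less)
  have z: "\<phi> x = 0" if "x \<notin> {-R..R}" for x using R(2)[of x] that by (cases "\<phi> x = 0") (auto simp: abs_less_iff)
  have z': "deriv \<phi> x = 0" if "x \<notin> {-R..R}" for x
  proof -
    have "open (- {-R..R})" by auto
    then have "\<forall>\<^sub>F y in nhds x. \<phi> y = 0" using that z by (auto simp: eventually_nhds intro!: exI[of _ "- {-R..R}"])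
    then have "((\<lambda>_. 0) has_real_derivative deriv \<phi> x) (at x)"
      using der[of x] by (subst DERIV_cong_ev[OF refl _ refl, of _ \<phi>]) (auto elim: eventually_mono)
    then show ?thesis using DERIV_const DERIV_unique by blast
  qed
  have "compact (deriv \<phi> ` {-R..R})" using cont by (intro compact_continuous_image) (auto intro: continuous_on_subset)
  then obtain B where B: "\<forall>x\<in>{-R..R}. \<bar>deriv \<phi> x\<bar> \<le> B" "B > 0"
    using compact_imp_bounded[of "deriv \<phi> ` {-R..R}"] unfolding bounded_pos by auto
  have "\<bar>deriv \<phi> x\<bar> \<le> B" for x using B z'[of x] by (cases "x \<in> {-R..R}") auto
  from that[OF R(1) z der z' this cont der2 cont2] show thesis .
qed

lemma test_function_mean:
  fixes x y :: real
  assumes der: "\<And>x. (\<phi> has_real_derivative \<phi>' x) (at x)" and B: "\<And>x. \<bar>\<phi>' x\<bar> \<le> B"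
  shows "\<bar>\<phi> x - \<phi> y\<bar> \<le> B * \<bar>x - y\<bar>"
  using field_differentiable_bound[of UNIV \<phi> \<phi>' B x y] der B by simp

text \<open>
  Discrete integration by parts moves the quotient to the test function, where it converges
  pointwise and boundedly, on a common compact support, to minus the derivative.
\<close>

theorem h1_imp_weak_deriv:
  assumes "h1 F" shows "has_weak_deriv (fn F) (fn (dx F))"
  unfolding has_weak_deriv_def
proof (intro allI impI)
  fix \<phi> assume t: "test_function \<phi>"
  obtain R B where R: "R > 0" "\<And>x. x \<notin> {-R..R} \<Longrightarrow> \<phi> x = 0" and der: "\<And>x. (\<phi> has_real_derivative deriv \<phi> x) (at x)"
    and z': "\<And>x. x \<notin> {-R..R} \<Longrightarrow> deriv \<phi> x = 0" and B: "\<And>x. \<bar>deriv \<phi> x\<bar> \<le> B" and "continuous_on UNIV (deriv \<phi>)"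
    using test_functionD[OF t] by metis
  have cont: "continuous_on UNIV \<phi>" by (intro continuous_at_imp_continuous_on ballI DERIV_isCont[OF der])
  have m: "\<phi> \<in> borel_measurable borel" using cont by (rule borel_measurable_continuous_onI)
  have lip: "\<bar>\<phi> x - \<phi> y\<bar> \<le> B * \<bar>x - y\<bar>" for x y by (rule test_function_mean[OF der B])
  have B0: "B \<ge> 0" using B[of 0] by simp
  have L: "L2 (\<lambda>x. of_real (\<phi> x))"
  proof (rule L2_weight[OF m, of "B * (2*R+1)" "-R" R])
    show "\<bar>\<phi> x\<bar> \<le> B * (2*R+1)" for x
    proof (cases "x \<in> {-R..R}")
      case True
      have "\<phi> (R + 1) = 0" using R by auto
      then have "\<bar>\<phi> x\<bar> \<le> B * \<bar>x - (R + 1)\<bar>" using lip[of x "R + 1"] by simp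
      also have "\<dots> \<le> B * (2*R+1)" using True B0 by (intro mult_left_mono) auto
      finally show ?thesis .
    qed (use R B0 in auto)
  qed (use R in auto)
  define X where "X = mk (\<lambda>x. of_real (\<phi> x))"
  define w where "w n x = (\<phi> (- mesh n + x) - \<phi> x) / mesh n" for n x
  have wL: "L2 (\<lambda>x. of_real (w n x))" for n
  proof -
    have "L2 (\<lambda>x. of_real (inverse (mesh n)) * (of_real (\<phi> (- mesh n + x)) + (-1) * of_real (\<phi> x)))"
      by (intro L2_cmult L2_add L2_shift[OF L] L)
    then show ?thesis by (simp add: w_def divide_inverse mult.commute)
  qed
  have "pair (D n F) X = (\<integral>x. fn F x * of_real (w n x) \<partial>lebesgue)" for n
  proof -
    have sh: "pair (shift a f) g = pair f (shift (- a) g)" for a f g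
    proof -
      have r: "Re (pair (shift a f) g) = Re (pair f (shift (- a) g))" for f
        by (simp add: Re_pair conjug_shift inner_shift_left)
      have "Im z = - Re (\<i> * z)" for z by simp
      then show ?thesis using r[of f] r[of "cscale \<i> f"]
        by (simp add: complex_eq_iff shift_cscale pair_cscale_left)
    qed
    have "pair (D n F) X = pair F (inverse (mesh n) *\<^sub>R (shift (- mesh n) X - X))"
      by (simp add: D_def pair_scaleR_left pair_diff_left sh)
         (simp add: pair_commute[of F] pair_scaleR_left pair_diff_left)
    also have "inverse (mesh n) *\<^sub>R (shift (- mesh n) X - X) = mk (\<lambda>x. of_real (w n x))"
    proof (rule l2_eqI)
      show "AE x in lebesgue. fn (inverse (mesh n) *\<^sub>R (shift (- mesh n) X - X)) x = fn (mk (\<lambda>x. of_real (w n x))) x"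
        using fn_scaleR[of "inverse (mesh n)" "shift (- mesh n) X - X"] fn_minus[of "shift (- mesh n) X" X]
          fn_shift[of "- mesh n" X] AE_shift[OF fn_mk[OF L], of "- mesh n"] fn_mk[OF L] fn_mk[OF wL[of n]]
        by eventually_elim (simp add: X_def w_def scaleR_conv_of_real divide_inverse mult.commute)
    qed
    also have "pair F \<dots> = (\<integral>x. fn F x * of_real (w n x) \<partial>lebesgue)"
      using pairing_mk[OF L2_fn[of F] wL[of n]] by (simp add: pairing_def)
    finally show ?thesis .
  qed
  moreover have "(\<lambda>n. \<integral>x. fn F x * of_real (w n x) \<partial>lebesgue) \<longlonglongrightarrow> (\<integral>x. fn F x * of_real (- deriv \<phi> x) \<partial>lebesgue)"
  proof (rule L2_weight_dominated[OF L2_fn, of _ B "-R" "R+1"])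
    show "w n \<in> borel_measurable borel" for n
      unfolding w_def using m by measurable
    show "\<bar>w n x\<bar> \<le> B * indicator {- R..R + 1} x" for n x
    proof (cases "x \<in> {-R..R+1}")
      case True
      have "\<bar>\<phi> (- mesh n + x) - \<phi> x\<bar> \<le> B * mesh n" using lip[of "-mesh n + x" x] by simp
      then show ?thesis using True by (simp add: w_def divide_simps)
    next
      case False
      have "x \<notin> {-R..R}" "- mesh n + x \<notin> {-R..R}"
        using False mesh_pos(1)[of n] mesh_le_1[of n] unfolding atLeastAtMost_iff by linarith+
      then have "\<phi> x = 0" "\<phi> (- mesh n + x) = 0" using R(2) by blast+
      then show ?thesis using False by (simp add: w_def)
    qed
    show "(\<lambda>n. w n x) \<longlonglongrightarrow> - deriv \<phi> x" for x
    proof -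
      have "(\<lambda>h. (\<phi> (x + h) - \<phi> x) / h) \<midarrow>0\<rightarrow> deriv \<phi> x" using der[of x] by (simp add: DERIV_def)
      moreover have "(\<lambda>n. - mesh n) \<longlonglongrightarrow> 0" using tendsto_minus[OF mesh_tendsto] by simp
      then have "filterlim (\<lambda>n. - mesh n) (at 0) sequentially" by (simp add: filterlim_at)
      ultimately have "(\<lambda>n. (\<phi> (x + - mesh n) - \<phi> x) / (- mesh n)) \<longlonglongrightarrow> deriv \<phi> x"
        by (rule filterlim_compose)
      from tendsto_minus[OF this] show ?thesis by (simp add: w_def add.commute)
    qed
  qed
  ultimately have "(\<lambda>n. pair (D n F) X) \<longlonglongrightarrow> (\<integral>x. fn F x * of_real (- deriv \<phi> x) \<partial>lebesgue)" by simp
  moreover have "(\<lambda>n. pair (D n F) X) \<longlonglongrightarrow> pair (dx F) X"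
  proof (rule Lim_null_comparison[THEN LIM_zero_cancel])
    show "\<forall>\<^sub>F n in sequentially. norm (pair (D n F) X - pair (dx F) X) \<le> norm (D n F - dx F) * norm X"
      by (simp add: pair_diff_left[symmetric] cmod_pair_le)
    have "(\<lambda>n. D n F) \<longlonglongrightarrow> dx F" using assms by (simp add: h1_iff)
    then show "(\<lambda>n. norm (D n F - dx F) * norm X) \<longlonglongrightarrow> 0"
      by (intro tendsto_mult_left_zero tendsto_norm_zero LIM_zero)
  qed
  ultimately have "pair (dx F) X = (\<integral>x. fn F x * of_real (- deriv \<phi> x) \<partial>lebesgue)" by (rule LIMSEQ_unique[symmetric])
  moreover have "pair (dx F) X = (\<integral>x. fn (dx F) x * of_real (\<phi> x) \<partial>lebesgue)"
    using pairing_mk[OF L2_fn[of "dx F"] L] by (simp add: pairing_def X_def)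
  ultimately show "(\<integral>x. fn F x * of_real (deriv \<phi> x) \<partial>lebesgue) = - (\<integral>x. fn (dx F) x * of_real (\<phi> x) \<partial>lebesgue)"
    by simp
qed

section \<open>The Sobolev space\<close>

lemma has_weak_deriv_cong_AE:
  assumes L: "L2 f" "L2 f'" "L2 g" "L2 g'" and ae: "AE x in lebesgue. f x = f' x" "AE x in lebesgue. g x = g' x"
    and w: "has_weak_deriv f g"
  shows "has_weak_deriv f' g'"
  unfolding has_weak_deriv_def
proof (intro allI impI)
  fix \<phi> assume t: "test_function \<phi>"
  obtain R B where der: "\<And>x. (\<phi> has_real_derivative deriv \<phi> x) (at x)" and cont: "continuous_on UNIV (deriv \<phi>)"
    using test_functionD[OF t] by metis
  have "continuous_on UNIV \<phi>" by (intro continuous_at_imp_continuous_on ballI DERIV_isCont[OF der])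
  then have m: "\<phi> \<in> borel_measurable lebesgue" "deriv \<phi> \<in> borel_measurable lebesgue"
    using cont by (auto intro!: borel_measurable_lebesgue borel_measurable_continuous_onI)
  have lm: "h \<in> borel_measurable lebesgue" if "L2 h" for h using that by (rule L2_measurable)
  have "(\<integral>x. f x * of_real (deriv \<phi> x) \<partial>lebesgue) = (\<integral>x. f' x * of_real (deriv \<phi> x) \<partial>lebesgue)"
    by (rule integral_cong_AE) (use ae(1) lm[OF L(1)] lm[OF L(2)] m in \<open>auto elim: eventually_mono\<close>)
  moreover have "(\<integral>x. g x * of_real (\<phi> x) \<partial>lebesgue) = (\<integral>x. g' x * of_real (\<phi> x) \<partial>lebesgue)"
    by (rule integral_cong_AE) (use ae(2) lm[OF L(3)] lm[OF L(4)] m in \<open>auto elim: eventually_mono\<close>)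
  ultimately show "(\<integral>x. f' x * of_real (deriv \<phi> x) \<partial>lebesgue) = - (\<integral>x. g' x * of_real (\<phi> x) \<partial>lebesgue)"
    using w t by (simp add: has_weak_deriv_def)
qed

lemma H1_iff: "H1 f \<longleftrightarrow> L2 f \<and> h1 (mk f)"
proof
  assume "H1 f" then show "L2 f \<and> h1 (mk f)"
    unfolding H1_def using weak_deriv_imp_h1 h1I by blast
next
  assume a: "L2 f \<and> h1 (mk f)"
  have "has_weak_deriv f (fn (dx (mk f)))"
    by (rule has_weak_deriv_cong_AE[OF L2_fn _ L2_fn L2_fn fn_mk _ h1_imp_weak_deriv]) (use a in auto)
  then show "H1 f" using a by (auto simp: H1_def)
qed

lemma weak_deriv_dx:
  assumes "H1 f" shows "L2 (weak_deriv f)" "mk (weak_deriv f) = dx (mk f)"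
proof -
  have "\<exists>g. L2 g \<and> has_weak_deriv f g" using assms by (simp add: H1_def)
  then have "L2 (weak_deriv f) \<and> has_weak_deriv f (weak_deriv f)"
    unfolding weak_deriv_def by (rule someI_ex)
  moreover from this assms have "(\<lambda>n. D n (mk f)) \<longlonglongrightarrow> mk (weak_deriv f)"
    by (intro weak_deriv_imp_h1) (auto simp: H1_def)
  ultimately show "L2 (weak_deriv f)" "mk (weak_deriv f) = dx (mk f)" using h1I(2) by auto
qed

text \<open>
  As the norm of a pair it inherits the triangle inequality from the product space.
\<close>

definition h1_norm :: "l2 \<Rightarrow> real" where "h1_norm F = norm (F, dx F)"

lemma H1_norm_h1_norm: "H1 f \<Longrightarrow> H1_norm f = h1_norm (mk f)"
  using weak_deriv_dx[of f] by (simp add: H1_norm_def h1_norm_def norm_Pair L2_norm_mk H1_iff)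

lemma norm_le_h1_norm: "norm F \<le> h1_norm F" "norm (dx F) \<le> h1_norm F"
  unfolding h1_norm_def by (rule norm_fst_le norm_snd_le)+
lemma h1_norm_nonneg [simp]: "h1_norm F \<ge> 0" by (simp add: h1_norm_def)
lemma h1_norm_add: "h1 F \<Longrightarrow> h1 G \<Longrightarrow> h1_norm (F + G) \<le> h1_norm F + h1_norm G"
  using norm_triangle_ineq[of "(F, dx F)" "(G, dx G)"] by (simp add: h1_norm_def h1_add)
lemma h1_norm_conjug: "h1 F \<Longrightarrow> h1_norm (conjug F) = h1_norm F"
  by (simp add: h1_norm_def h1_conjug norm_Pair)
lemma h1_norm_cscale: "h1 F \<Longrightarrow> h1_norm (cscale c F) = cmod c * h1_norm F"
  by (simp add: h1_norm_def h1_cscale norm_Pair power_mult_distrib distrib_left[symmetric] real_sqrt_mult)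

lemma H1_cnj: "H1 f \<Longrightarrow> H1 (\<lambda>x. cnj (f x))"
  by (auto simp: H1_iff L2_cnj conjug_mk[symmetric] h1_conjug)
lemma H1_diff: "H1 f \<Longrightarrow> H1 g \<Longrightarrow> H1 (\<lambda>x. f x - g x)"
  using L2_add[of f "\<lambda>x. (-1) * g x"] by (auto simp: H1_iff mk_diff h1_diff dest: L2_cmult[of _ "-1"])
lemma H1_add: "H1 f \<Longrightarrow> H1 g \<Longrightarrow> H1 (\<lambda>x. f x + g x)"
  by (auto simp: H1_iff mk_add h1_add L2_add)
lemma H1_norm_cnj: "H1 f \<Longrightarrow> H1_norm (\<lambda>x. cnj (f x)) = H1_norm f"
  by (simp add: H1_norm_h1_norm H1_cnj) (simp add: H1_iff conjug_mk[symmetric] h1_norm_conjug)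
lemma H1_norm_add: "H1 f \<Longrightarrow> H1 g \<Longrightarrow> H1_norm (\<lambda>x. f x + g x) \<le> H1_norm f + H1_norm g"
  by (simp add: H1_norm_h1_norm H1_add) (simp add: H1_iff mk_add h1_norm_add)
lemma L2_zero: "L2 (\<lambda>_. 0)" by (simp add: L2_def)
lemma h1_0: "h1 0" "dx 0 = 0"
  by (rule h1I[of 0 0]; simp add: D_def shift_scaleR[of _ 0 0, simplified])+
lemma H1_norm_0: "H1_norm (\<lambda>_. 0) = 0"
  by (subst H1_norm_h1_norm) (auto simp: H1_iff L2_zero zero_l2_def[symmetric] h1_0 h1_norm_def)
lemma H1_norm_nonneg: "H1_norm f \<ge> 0" by (simp add: H1_norm_def)

section \<open>Boundedness of the mass below the threshold\<close>

text \<open>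
  The derivative in the dual norm is uniform over bounded sets of \<open>H\<^sup>1\<close>, so that the argument
  \<open>\<eta>\<close> of the functional may vary with time as long as it is continuous in \<open>H\<^sup>1\<close>.
\<close>

lemma Hm1_derivative_quotient:
  assumes w: "has_Hm1_derivative w W t" and H: "\<And>s. H1 (\<eta> s)"
    and c: "((\<lambda>s. H1_norm (\<lambda>x. \<eta> s x - \<eta> t x)) \<longlongrightarrow> 0) (at t)"
  shows "((\<lambda>s. (pairing (w s) (\<eta> s) - pairing (w t) (\<eta> s)) / of_real (s - t)) \<longlongrightarrow> W (\<eta> t)) (at t)"
proof (rule tendstoI)
  fix e :: real assume e: "e > 0"
  have hm: "Hm1 W" and q: "\<And>\<epsilon>. \<epsilon> > 0 \<Longrightarrow> \<forall>\<^sub>F s in at t. \<forall>\<phi>. H1 \<phi> \<longrightarrow>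
        cmod ((pairing (w s) \<phi> - pairing (w t) \<phi>) / of_real (s - t) - W \<phi>) \<le> \<epsilon> * H1_norm \<phi>"
    using w by (auto simp: has_Hm1_derivative_def)
  obtain C where C: "\<And>\<phi>. H1 \<phi> \<Longrightarrow> cmod (W \<phi>) \<le> C * H1_norm \<phi>" using hm by (auto simp: Hm1_def)
  define M where "M = H1_norm (\<eta> t) + 1"
  have M: "M > 0" using H1_norm_nonneg[of "\<eta> t"] by (simp add: M_def)
  define d where "d = min 1 (e / (2 * (\<bar>C\<bar> + 1)))"
  have d: "d > 0" using e by (simp add: d_def)
  have "\<forall>\<^sub>F s in at t. H1_norm (\<lambda>x. \<eta> s x - \<eta> t x) < d" using c d by (rule order_tendstoD)
  moreover have "\<forall>\<^sub>F s in at t. \<forall>\<phi>. H1 \<phi> \<longrightarrow>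
        cmod ((pairing (w s) \<phi> - pairing (w t) \<phi>) / of_real (s - t) - W \<phi>) \<le> e / (4 * M) * H1_norm \<phi>"
    by (rule q) (use e M in auto)
  ultimately show "\<forall>\<^sub>F s in at t. dist ((pairing (w s) (\<eta> s) - pairing (w t) (\<eta> s)) / of_real (s - t)) (W (\<eta> t)) < e"
  proof eventually_elim
    case (elim s)
    let ?\<delta> = "\<lambda>x. \<eta> s x - \<eta> t x" and ?q = "(pairing (w s) (\<eta> s) - pairing (w t) (\<eta> s)) / of_real (s - t)"
    have h: "H1 ?\<delta>" by (intro H1_diff H)
    have "\<forall>\<phi> \<psi>. H1 \<phi> \<longrightarrow> H1 \<psi> \<longrightarrow> W (\<lambda>x. \<phi> x + \<psi> x) = W \<phi> + W \<psi>"
      using hm unfolding Hm1_def by blast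
    from this[rule_format, OF H[of t] h] have "W (\<lambda>x. \<eta> t x + ?\<delta> x) = W (\<eta> t) + W ?\<delta>" .
    then have Weq: "W (\<eta> s) = W (\<eta> t) + W ?\<delta>" by simp
    have "H1_norm (\<lambda>x. \<eta> t x + ?\<delta> x) \<le> H1_norm (\<eta> t) + H1_norm ?\<delta>" by (intro H1_norm_add H h)
    then have "H1_norm (\<eta> s) \<le> M" using elim(1) by (simp add: M_def d_def)
    then have "cmod (?q - W (\<eta> s)) \<le> e / (4 * M) * M"
      using elim(2) H[of s] e M by (intro order_trans[OF elim(2)[rule_format, OF H] mult_left_mono]) auto
    then have 1: "cmod (?q - W (\<eta> s)) \<le> e / 4" using M by simp
    have "cmod (W ?\<delta>) \<le> \<bar>C\<bar> * H1_norm ?\<delta>"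
      using C[OF h] mult_right_mono[OF abs_ge_self[of C] H1_norm_nonneg[of ?\<delta>]] by linarith
    also have "\<dots> \<le> (\<bar>C\<bar> + 1) * d" using elim(1) H1_norm_nonneg[of ?\<delta>] by (intro mult_mono) auto
    also have "\<dots> \<le> (\<bar>C\<bar> + 1) * (e / (2 * (\<bar>C\<bar> + 1)))" by (intro mult_left_mono) (auto simp: d_def)
    also have "\<dots> = e / 2" by (simp add: divide_simps)
    finally have 2: "cmod (W ?\<delta>) \<le> e / 2" .
    have "?q - W (\<eta> t) = (?q - W (\<eta> s)) + W ?\<delta>" using Weq by simp
    then have "cmod (?q - W (\<eta> t)) \<le> cmod (?q - W (\<eta> s)) + cmod (W ?\<delta>)" by (metis norm_triangle_ineq)
    then show ?case using 1 2 e by (simp add: dist_norm)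
  qed
qed

lemma pairing_cnj: "pairing f (\<lambda>x. cnj (g x)) = cnj (pairing g (\<lambda>x. cnj (f x)))"
proof -
  have "cnj (pairing g (\<lambda>x. cnj (f x))) = (\<integral>x. cnj (g x * cnj (f x)) \<partial>lebesgue)"
    unfolding pairing_def by (rule Bochner_Integration.integral_cnj[symmetric])
  then show ?thesis by (simp add: pairing_def mult.commute)
qed

text \<open>
  Product rule. Only one of the two functions changes at a time; in the first increment the
  other factor is taken at the moving time, which the preceding lemma allows, and conjugation
  exchanges the roles in the second.
\<close>

lemma hermitian_pairing_quotient:
  assumes w: "has_Hm1_derivative w W t" "continuous_H1 w" and z: "has_Hm1_derivative z Z t" "continuous_H1 z"
  shows "((\<lambda>s. (pairing (w s) (\<lambda>x. cnj (z s x)) - pairing (w t) (\<lambda>x. cnj (z t x))) / of_real (s - t))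
     \<longlongrightarrow> W (\<lambda>x. cnj (z t x)) + cnj (Z (\<lambda>x. cnj (w t x)))) (at t)"
proof -
  have H: "H1 (w s)" "H1 (z s)" for s using w(2) z(2) by (auto simp: continuous_H1_def)
  have "H1_norm (\<lambda>x. cnj (z s x) - cnj (z t x)) = H1_norm (\<lambda>x. z s x - z t x)" for s
    using H1_norm_cnj[OF H1_diff[OF H(2)[of s] H(2)[of t]]] by simp
  then have "((\<lambda>s. H1_norm (\<lambda>x. cnj (z s x) - cnj (z t x))) \<longlongrightarrow> 0) (at t)"
    using z(2) by (simp add: continuous_H1_def)
  from Hm1_derivative_quotient[OF w(1) H1_cnj[OF H(2)] this]
  have 1: "((\<lambda>s. (pairing (w s) (\<lambda>x. cnj (z s x)) - pairing (w t) (\<lambda>x. cnj (z s x))) / of_real (s - t))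
     \<longlongrightarrow> W (\<lambda>x. cnj (z t x))) (at t)" .
  have "H1_norm (\<lambda>x. cnj (w t x) - cnj (w t x)) = 0"
    by (simp add: H1_norm_0)
  then have "((\<lambda>s. H1_norm (\<lambda>x. cnj (w t x) - cnj (w t x))) \<longlongrightarrow> 0) (at t)" by simp
  from Hm1_derivative_quotient[OF z(1) H1_cnj[OF H(1)] this]
  have "((\<lambda>s. (pairing (z s) (\<lambda>x. cnj (w t x)) - pairing (z t) (\<lambda>x. cnj (w t x))) / of_real (s - t))
     \<longlongrightarrow> Z (\<lambda>x. cnj (w t x))) (at t)" .
  from tendsto_add[OF 1 tendsto_cnj[OF this]] show ?thesis
    unfolding complex_cnj_divide complex_cnj_diff pairing_cnj[of "z _" "w _", symmetric] complex_cnj_complex_of_real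
      add_divide_distrib[symmetric]
    by (simp add: pairing_cnj[of "z _" "w _"])
qed

text \<open>
  The conserved quantity is \<open>E\<close>. In its derivative the kinetic and the nonlinear contributions
  are hermitian forms \<open>K\<close> and \<open>N\<close> in \<open>u\<close>, \<open>v\<close>, with the same \<open>N\<close> in both equations; they
  cancel in \<open>Im\<close> of the cross terms and are real on the diagonal. The remaining terms cancel
  by the choice of the coefficients in \<open>E\<close>.
\<close>

lemma mass_bounded:
  fixes \<gamma> \<kappa> g :: real
  assumes pos: "\<gamma> > 0" "\<gamma> < \<kappa>" and sol: "global_solution \<gamma> \<kappa> g g g u v"
  shows "\<exists>C>0. \<forall>t. (L2_norm (u t))\<^sup>2 + (L2_norm (v t))\<^sup>2 \<le> C"
proof -
  have cu: "continuous_H1 u" and cv: "continuous_H1 v" using sol by (auto simp: global_solution_def)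
  have H: "H1 (u t)" "H1 (v t)" for t using cu cv by (auto simp: continuous_H1_def)
  have L: "L2 (u t)" "L2 (v t)" for t using H by (auto simp: H1_iff)
  define P where "P w z s = pairing (w s) (\<lambda>x. cnj (z s x))" for w z :: "real \<Rightarrow> real \<Rightarrow> complex" and s
  have norm_P: "P w w s = of_real ((L2_norm (w s))\<^sup>2)" for w s
  proof -
    have "P w w s = (\<integral>x. of_real ((cmod (w s x))\<^sup>2) \<partial>lebesgue)"
      unfolding P_def pairing_def complex_norm_square ..
    also have "\<dots> = of_real (\<integral>x. (cmod (w s x))\<^sup>2 \<partial>lebesgue)" by (rule integral_complex_of_real)
    finally show ?thesis by (simp add: L2_norm_def)
  qed
  define E where "E s = \<kappa> * (Re (P u u s) + Re (P v v s)) + 2 * \<gamma> * Im (P v u s)" for s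
  have "(E has_real_derivative 0) (at t)" for t
  proof -
    obtain u' v' where du: "has_Hm1_derivative u u' t" and dv: "has_Hm1_derivative v v' t"
      and eq: "\<And>\<phi>. H1 \<phi> \<Longrightarrow> \<i> * u' \<phi> = minus_dxx (u t) \<phi> + of_real \<kappa> * pairing (v t) \<phi>
             + \<i> * of_real \<gamma> * pairing (u t) \<phi>
             - pairing (\<lambda>x. of_real (g * (cmod (u t x))\<^sup>2 + g * (cmod (v t x))\<^sup>2) * u t x) \<phi>"
        "\<And>\<phi>. H1 \<phi> \<Longrightarrow> \<i> * v' \<phi> = minus_dxx (v t) \<phi> + of_real \<kappa> * pairing (u t) \<phi>
             - \<i> * of_real \<gamma> * pairing (v t) \<phi>
             - pairing (\<lambda>x. of_real (g * (cmod (u t x))\<^sup>2 + g * (cmod (v t x))\<^sup>2) * v t x) \<phi>"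
      using sol unfolding global_solution_def by blast
    define G where "G x = complex_of_real (g * (cmod (u t x))\<^sup>2 + g * (cmod (v t x))\<^sup>2)" for x
    define K where "K f h = minus_dxx f (\<lambda>x. cnj (h x))" for f h :: "real \<Rightarrow> complex"
    define N where "N f h = pairing (\<lambda>x. G x * f x) (\<lambda>x. cnj (h x))" for f h :: "real \<Rightarrow> complex"
    have K: "K f h = cnj (K h f)" if "H1 f" "H1 h" for f h
    proof -
      have "K f h = pair (dx (mk f)) (conjug (dx (mk h)))" if "H1 f" "H1 h" for f h
        using that weak_deriv_dx[OF that(1)] weak_deriv_dx[OF H1_cnj[OF that(2)]]
        by (simp add: K_def minus_dxx_def pairing_mk conjug_mk[symmetric] h1_conjug H1_iff)
      then show ?thesis using that pair_conjug_conjug[of "conjug (dx (mk f))" "dx (mk h)"] by (simp add: pair_commute)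
    qed
    have N: "N f h = cnj (N h f)" for f h
    proof -
      have "cnj (N h f) = (\<integral>x. cnj (G x * h x * cnj (f x)) \<partial>lebesgue)"
        unfolding N_def pairing_def by (rule Bochner_Integration.integral_cnj[symmetric])
      also have "\<dots> = N f h" unfolding N_def pairing_def
        by (rule Bochner_Integration.integral_cong) (auto simp: G_def mult_ac)
      finally show ?thesis by simp
    qed
    have P: "P f h s = cnj (P h f s)" for f h s unfolding P_def by (rule pairing_cnj)
    let ?cu = "\<lambda>x. cnj (u t x)" and ?cv = "\<lambda>x. cnj (v t x)"
    have e: "\<i> * u' ?cu = K (u t) (u t) + of_real \<kappa> * P v u t + \<i> * of_real \<gamma> * P u u t - N (u t) (u t)"
      "\<i> * v' ?cv = K (v t) (v t) + of_real \<kappa> * P u v t - \<i> * of_real \<gamma> * P v v t - N (v t) (v t)"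
      "\<i> * u' ?cv = K (u t) (v t) + of_real \<kappa> * P v v t + \<i> * of_real \<gamma> * P u v t - N (u t) (v t)"
      "\<i> * v' ?cu = K (v t) (u t) + of_real \<kappa> * P u u t - \<i> * of_real \<gamma> * P v u t - N (v t) (u t)"
      unfolding K_def N_def P_def G_def by (rule eq H1_cnj H)+
    have lim: "((\<lambda>s. (P w z s - P w z t) / of_real (s - t)) \<longlongrightarrow> W (\<lambda>x. cnj (z t x)) + cnj (Z (\<lambda>x. cnj (w t x)))) (at t)"
      if "has_Hm1_derivative w W t" "continuous_H1 w" "has_Hm1_derivative z Z t" "continuous_H1 z" for w z W Z
      unfolding P_def by (rule hermitian_pairing_quotient[OF that])
    let ?L = "of_real \<kappa> * ((u' ?cu + cnj (u' ?cu)) + (v' ?cv + cnj (v' ?cv))) - \<i> * of_real (2 * \<gamma>) * (v' ?cu + cnj (u' ?cv))"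
    have "((\<lambda>s. of_real \<kappa> * ((P u u s - P u u t) / of_real (s - t) + (P v v s - P v v t) / of_real (s - t))
       - \<i> * of_real (2 * \<gamma>) * ((P v u s - P v u t) / of_real (s - t))) \<longlongrightarrow> ?L) (at t)"
      by (intro tendsto_intros lim du dv cu cv)
    from tendsto_Re[OF this] have lE: "((\<lambda>s. (E s - E t) / (s - t)) \<longlongrightarrow> Re ?L) (at t)"
    proof (rule Lim_transform_eventually)
      show "\<forall>\<^sub>F s in at t. Re (of_real \<kappa> * ((P u u s - P u u t) / of_real (s - t) + (P v v s - P v v t) / of_real (s - t))
       - \<i> * of_real (2 * \<gamma>) * ((P v u s - P v u t) / of_real (s - t))) = (E s - E t) / (s - t)"
      proof (rule always_eventually, rule allI)
        fix s
        define r where "r = s - t"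
        show "Re (of_real \<kappa> * ((P u u s - P u u t) / of_real (s - t) + (P v v s - P v v t) / of_real (s - t))
       - \<i> * of_real (2 * \<gamma>) * ((P v u s - P v u t) / of_real (s - t))) = (E s - E t) / (s - t)"
          unfolding r_def[symmetric]
          by (simp add: E_def Re_divide_of_real Im_divide_of_real diff_divide_distrib add_divide_distrib algebra_simps)
      qed
    qed
    have uu: "2 * Re (u' ?cu) = 2 * \<kappa> * Im (P v u t) + 2 * \<gamma> * Re (P u u t)"
      using arg_cong[OF e(1), of Im] K[OF H(1) H(1), of t t] N[of "u t" "u t"] by (simp add: complex_eq_iff)
    have vv: "2 * Re (v' ?cv) = - 2 * \<kappa> * Im (P v u t) - 2 * \<gamma> * Re (P v v t)"
      using arg_cong[OF e(2), of Im] K[OF H(2) H(2), of t t] N[of "v t" "v t"] P[of u v t] by (simp add: complex_eq_iff)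
    have vu: "Im (v' ?cu) - Im (u' ?cv) = - \<kappa> * Re (P u u t) + \<kappa> * Re (P v v t)"
      using arg_cong[OF e(3), of Re] arg_cong[OF e(4), of Re] K[OF H(1) H(2), of t t] N[of "u t" "v t"] P[of u v t] by simp
    have "Re ?L = \<kappa> * (2 * Re (u' ?cu) + 2 * Re (v' ?cv)) + 2 * \<gamma> * (Im (v' ?cu) - Im (u' ?cv))" by simp
    also have "\<dots> = 0" unfolding uu vv vu by (simp add: algebra_simps)
    finally show ?thesis using lE by (simp add: has_field_derivative_iff)
  qed
  then have const: "E t = E 0" for t using DERIV_isconst_all by blast
  have bound: "2 * \<bar>Im (P v u t)\<bar> \<le> (L2_norm (u t))\<^sup>2 + (L2_norm (v t))\<^sup>2" for t
  proof -
    have "\<bar>Im (P v u t)\<bar> \<le> cmod (P v u t)" by (rule abs_Im_le_cmod)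
    also have "\<dots> \<le> L2_norm (v t) * L2_norm (u t)"
      using cmod_pair_le[of "mk (v t)" "conjug (mk (u t))"] L
      by (simp add: P_def pairing_mk L2_cnj conjug_mk L2_norm_mk) (simp add: conjug_mk[symmetric])
    finally show ?thesis using sum_squares_bound[of "L2_norm (v t)" "L2_norm (u t)"] by simp
  qed
  have "(L2_norm (u t))\<^sup>2 + (L2_norm (v t))\<^sup>2 \<le> \<bar>E 0\<bar> / (\<kappa> - \<gamma>) + 1" for t
  proof -
    let ?Q = "(L2_norm (u t))\<^sup>2 + (L2_norm (v t))\<^sup>2"
    have "E 0 = \<kappa> * ?Q + \<gamma> * (2 * Im (P v u t))" using const[of t] by (simp add: E_def norm_P)
    moreover have "\<gamma> * (2 * Im (P v u t)) \<ge> \<gamma> * (- ?Q)" using bound[of t] pos by (intro mult_left_mono) auto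
    ultimately have "(\<kappa> - \<gamma>) * ?Q \<le> \<bar>E 0\<bar>" by (simp add: algebra_simps)
    then have "?Q \<le> \<bar>E 0\<bar> / (\<kappa> - \<gamma>)" using pos by (simp add: pos_le_divide_eq mult.commute)
    then show ?thesis by simp
  qed
  then show ?thesis using pos by (intro exI[of _ "\<bar>E 0\<bar> / (\<kappa> - \<gamma>) + 1"]) (auto intro: add_nonneg_pos)
qed

section \<open>Ordinary differential equations in Banach spaces\<close>

lemma integral_deriv_halfline:
  fixes g :: "real \<Rightarrow> 'a::banach"
  assumes "continuous_on {0..} g" "t \<ge> 0"
  shows "((\<lambda>t. integral {0..t} g) has_vector_derivative g t) (at t within {0..})"
proof -
  have "((\<lambda>t. integral {0..t} g) has_vector_derivative g t) (at t within {0..t+1})"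
    using assms by (intro integral_has_vector_derivative) (auto intro: continuous_on_subset)
  moreover have "at t within {0..t+1} = at t within {0..}"
    by (rule at_within_nhd[of _ "{..<t+1}"]) auto
  ultimately show ?thesis by simp
qed

lemma integral_cont_halfline:
  fixes g :: "real \<Rightarrow> 'a::banach"
  assumes "continuous_on {0..} g"
  shows "continuous_on {0..} (\<lambda>t. integral {0..t} g)"
  unfolding continuous_on_eq_continuous_within
  using has_vector_derivative_continuous[OF integral_deriv_halfline[OF assms]] by auto

text \<open>
  Picard iteration in the space of bounded continuous functions. The unknown is \<open>z = y / E\<close>
  with the weight \<open>E = exp (2 \<integral> L)\<close>; because \<open>\<integral> L E = (E - 1) / 2\<close>, the integral operator is a
  contraction with factor \<open>1/2\<close> on the whole half-line. So global existence comes in one step,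
  even for unbounded \<open>L\<close>. Arguments \<open>t < 0\<close> are treated as \<open>0\<close>.
\<close>

theorem global_ode:
  fixes f :: "real \<Rightarrow> 'a::banach \<Rightarrow> 'a" and L :: "real \<Rightarrow> real"
  assumes cont: "\<And>y. continuous_on {0..} y \<Longrightarrow> continuous_on {0..} (\<lambda>t. f t (y t))"
    and lip: "\<And>t x y. t \<ge> 0 \<Longrightarrow> norm (f t x - f t y) \<le> L t * norm (x - y)"
    and zero: "\<And>t. f t 0 = 0" and L: "continuous_on {0..} L" "\<And>t. t \<ge> 0 \<Longrightarrow> L t \<ge> 0"
  obtains y where "y 0 = yi" "\<And>t. t \<ge> 0 \<Longrightarrow> (y has_vector_derivative f t (y t)) (at t within {0..})"
proof -
  define W where "W t = integral {0..t} L" for t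
  have Wd: "(W has_real_derivative L t) (at t within {0..})" if "t \<ge> 0" for t
    unfolding W_def using integral_deriv_halfline[OF L(1) that] by (simp add: has_real_derivative_iff_has_vector_derivative)
  have Wc: "continuous_on {0..} W" unfolding W_def by (rule integral_cont_halfline[OF L(1)])
  define E where "E t = exp (2 * W t)" for t
  have E0: "E 0 = 1" by (simp add: E_def W_def)
  have Epos: "E t > 0" for t by (simp add: E_def)
  have Ec: "continuous_on {0..} E" unfolding E_def by (intro continuous_intros Wc)
  have Ed: "(E has_real_derivative 2 * (L t * E t)) (at t within {0..})" if "t \<ge> 0" for t
    unfolding E_def by (rule derivative_eq_intros Wd[OF that] refl)+ simp
  have Eint: "((\<lambda>r. L r * E r) has_integral (E s - 1) / 2) {0..s}" if "s \<ge> 0" for s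
  proof -
    have "((\<lambda>t. E t / 2) has_vector_derivative L t * E t) (at t within {0..s})" if "t \<in> {0..s}" for t
    proof -
      have "((\<lambda>t. E t / 2) has_real_derivative (2 * (L t * E t)) / 2) (at t within {0..s})"
        using that by (intro DERIV_cdivide has_field_derivative_subset[OF Ed]) auto
      then show ?thesis by (simp add: has_real_derivative_iff_has_vector_derivative)
    qed
    from fundamental_theorem_of_calculus[OF that this] show ?thesis by (simp add: E0 diff_divide_distrib)
  qed
  define g where "g z r = f r (E r *\<^sub>R apply_bcontfun z r)" for z :: "real \<Rightarrow>\<^sub>C 'a" and r
  have gc: "continuous_on {0..} (g z)" for z
    unfolding g_def by (intro cont continuous_intros Ec continuous_on_apply_bcontfun)
  have gi: "g z integrable_on {0..s}" for z s
    by (intro integrable_continuous_real continuous_on_subset[OF gc]) auto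
  have bound: "norm (integral {0..s} (g z) - integral {0..s} (g z')) \<le> B * ((E s - 1) / 2)"
    if "s \<ge> 0" "\<And>r. norm (apply_bcontfun z r - apply_bcontfun z' r) \<le> B" for s z z' B
  proof -
    have B0: "B \<ge> 0" using that(2)[of 0] norm_ge_zero order_trans by blast
    have "norm (integral {0..s} (\<lambda>r. g z r - g z' r)) \<le> integral {0..s} (\<lambda>r. B * (L r * E r))"
    proof (rule integral_norm_bound_integral)
      show "(\<lambda>r. g z r - g z' r) integrable_on {0..s}" by (intro integrable_diff gi)
      show "(\<lambda>r. B * (L r * E r)) integrable_on {0..s}"
        using has_integral_mult_right[OF Eint[OF that(1)], of B] by (auto simp: integrable_on_def)
      fix r assume r: "r \<in> {0..s}"
      then have "norm (g z r - g z' r) \<le> L r * norm (E r *\<^sub>R apply_bcontfun z r - E r *\<^sub>R apply_bcontfun z' r)"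
        unfolding g_def by (intro lip) auto
      also have "\<dots> = (L r * E r) * norm (apply_bcontfun z r - apply_bcontfun z' r)"
        using Epos[of r] by (simp add: scaleR_diff_right[symmetric])
      also have "\<dots> \<le> (L r * E r) * B"
        using r L(2)[of r] Epos[of r] by (intro mult_left_mono that(2)) auto
      finally show "norm (g z r - g z' r) \<le> B * (L r * E r)" by (simp add: mult.commute)
    qed
    also have "integral {0..s} (\<lambda>r. B * (L r * E r)) = B * ((E s - 1) / 2)"
      using has_integral_mult_right[OF Eint[OF that(1)], of B] by (rule integral_unique)
    finally show ?thesis by (simp add: Henstock_Kurzweil_Integration.integral_diff gi)
  qed
  have bound': "inverse (E s) * (B * ((E s - 1) / 2)) \<le> B / 2" if "B \<ge> 0" for s B
    using Epos[of s] that by (simp add: divide_simps algebra_simps)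
  define h where "h z t = (let s = max 0 t in inverse (E s) *\<^sub>R (yi + integral {0..s} (g z)))" for z t
  have hE: "h z t \<in> UNIV" for z t by simp
  have g0: "g 0 = (\<lambda>_. 0)" by (auto simp: g_def zero)
  have E1: "E s \<ge> 1" if "s \<ge> 0" for s
  proof -
    have "0 \<le> (E s - 1) / 2"
      using has_integral_nonneg[OF Eint[OF that]] L(2) Epos by (simp add: less_imp_le)
    then show ?thesis by simp
  qed
  have "h z \<in> bcontfun" for z
  proof (rule bcontfun_normI)
    have c: "continuous_on {0..} (\<lambda>s. inverse (E s) *\<^sub>R (yi + integral {0..s} (g z)))"
      using Epos by (intro continuous_intros Ec integral_cont_halfline gc) (auto simp: less_imp_neq[symmetric])
    show "continuous_on UNIV (h z)"
      unfolding h_def Let_def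
      by (rule continuous_on_compose2[OF c, of UNIV "max 0"]) (auto intro!: continuous_intros)
    show "norm (h z t) \<le> norm yi + norm z / 2" for t
    proof -
      define s where "s = max 0 t"
      have s: "s \<ge> 0" by (simp add: s_def)
      have "norm (h z t) \<le> inverse (E s) * (norm yi + norm (integral {0..s} (g z)))"
        using Epos[of s] unfolding h_def s_def[symmetric] Let_def by (simp add: norm_triangle_ineq)
      also have "\<dots> = inverse (E s) * norm yi + inverse (E s) * norm (integral {0..s} (g z))" by (simp add: distrib_left)
      also have "inverse (E s) * norm yi \<le> norm yi"
        using E1[OF s] by (intro mult_left_le_one_le) (auto simp: inverse_le_1_iff)
      also have "norm (integral {0..s} (g z)) \<le> norm z * ((E s - 1) / 2)"
        using bound[OF s, of z 0 "norm z"] norm_bounded[of z] by (simp add: g0)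
      then have "inverse (E s) * norm (integral {0..s} (g z)) \<le> inverse (E s) * (norm z * ((E s - 1) / 2))"
        using Epos[of s] by (intro mult_left_mono) auto
      also note bound'[of "norm z" s]
      finally show ?thesis by simp
    qed
  qed
  then have hB: "apply_bcontfun (Bcontfun (h z)) = h z" for z by (rule Bcontfun_inverse)
  have "\<exists>!z. Bcontfun (h z) = z"
  proof (rule banach_fix_type[of "1/2"])
    show "\<forall>z z'. dist (Bcontfun (h z)) (Bcontfun (h z')) \<le> 1/2 * dist z z'"
    proof (intro allI dist_bound)
      fix z z' :: "real \<Rightarrow>\<^sub>C 'a" and t :: real
      define s where "s = max 0 t"
      have s: "s \<ge> 0" by (simp add: s_def)
      have "dist (h z t) (h z' t) = inverse (E s) * norm (integral {0..s} (g z) - integral {0..s} (g z'))"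
        using Epos[of s] unfolding h_def s_def[symmetric] Let_def dist_norm by (simp add: scaleR_diff_right[symmetric])
      also have "\<dots> \<le> inverse (E s) * (dist z z' * ((E s - 1) / 2))"
        using Epos[of s] by (intro mult_left_mono bound[OF s]) (auto simp: dist_norm[symmetric] dist_bounded)
      also have "\<dots> \<le> 1/2 * dist z z'" using bound'[of "dist z z'" s] by simp
      finally show "dist (apply_bcontfun (Bcontfun (h z)) t) (apply_bcontfun (Bcontfun (h z')) t) \<le> 1/2 * dist z z'"
        by (simp only: hB)
    qed
  qed auto
  then obtain z where z: "Bcontfun (h z) = z" by blast
  have z': "apply_bcontfun z = h z" using hB[of z] unfolding z .
  define y where "y t = E t *\<^sub>R apply_bcontfun z t" for t
  have yeq: "y t = yi + integral {0..t} (\<lambda>r. f r (y r))" if "t \<ge> 0" for t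
    using Epos[of t] that unfolding y_def g_def[symmetric] by (subst z') (simp add: h_def max_def)
  have yc: "continuous_on {0..} y"
    unfolding y_def by (intro continuous_intros Ec continuous_on_apply_bcontfun)
  show thesis
  proof (rule that[of y])
    show "y 0 = yi" using yeq[of 0] by simp
    show "(y has_vector_derivative f t (y t)) (at t within {0..})" if "t \<ge> 0" for t
    proof (rule has_vector_derivative_transform[of t "{0..}" y "\<lambda>t. yi + integral {0..t} (\<lambda>r. f r (y r))"])
      show "((\<lambda>t. yi + integral {0..t} (\<lambda>r. f r (y r))) has_vector_derivative f t (y t)) (at t within {0..})"
        using has_vector_derivative_add[OF has_vector_derivative_const integral_deriv_halfline[OF cont[OF yc] that]] by simp
    qed (use that yeq in auto)
  qed
qed

lemma gronwall:
  fixes y y' :: "real \<Rightarrow> real"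
  assumes d: "\<And>t. 0 \<le> t \<Longrightarrow> t \<le> T \<Longrightarrow> (y has_real_derivative y' t) (at t within {0..T})"
    and le: "\<And>t. 0 \<le> t \<Longrightarrow> t \<le> T \<Longrightarrow> y' t \<le> a * y t + b" and ab: "a \<ge> 0" "b \<ge> 0" and t: "0 \<le> t" "t \<le> T"
  shows "y t \<le> exp (a * t) * (y 0 + b * t)"
proof -
  define z where "z s = exp (- a * s) * y s - b * s" for s
  have zd: "(z has_real_derivative (exp (- a * s) * (y' s - a * y s) - b)) (at s within {0..T})" if "0 \<le> s" "s \<le> T" for s
    unfolding z_def by (rule derivative_eq_intros d[OF that] refl)+ (simp add: algebra_simps)
  have "z t \<le> z 0"
  proof (rule DERIV_nonpos_imp_decreasing_open[OF t(1)])
    fix s assume s: "0 < s" "s < t"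
    have "at s within {0..T} = at s" using s t by (intro at_within_interior) auto
    then have "(z has_real_derivative (exp (- a * s) * (y' s - a * y s) - b)) (at s)" using zd[of s] s t by simp
    moreover have "exp (- a * s) * (y' s - a * y s) - b \<le> 0"
    proof -
      have "exp (- a * s) * (y' s - a * y s) \<le> exp (- a * s) * b"
        using le[of s] s t by (intro mult_left_mono) auto
      also have "\<dots> \<le> 1 * b" using ab s by (intro mult_right_mono) auto
      finally show ?thesis by simp
    qed
    ultimately show "\<exists>d. (z has_real_derivative d) (at s) \<and> d \<le> 0" by blast
  next
    show "continuous_on {0..t} z"
      unfolding continuous_on_eq_continuous_within
      using zd t by (auto intro!: continuous_within_subset[OF DERIV_continuous[OF zd]])
  qed
  then have "exp (- a * t) * y t \<le> y 0 + b * t" by (simp add: z_def)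
  then have "exp (a * t) * (exp (- a * t) * y t) \<le> exp (a * t) * (y 0 + b * t)" by (intro mult_left_mono) auto
  then show ?thesis by (simp add: mult.assoc[symmetric] exp_add[symmetric])
qed

lemma norm_sq_derivative:
  fixes \<phi> :: "real \<Rightarrow> 'a::real_inner"
  assumes "(\<phi> has_vector_derivative \<phi>') (at t within S)"
  shows "((\<lambda>t. (norm (\<phi> t))\<^sup>2) has_real_derivative 2 * inner (\<phi> t) \<phi>') (at t within S)"
  unfolding power2_norm_eq_inner has_field_derivative_def
  using has_derivative_inner[OF assms[unfolded has_vector_derivative_def] assms[unfolded has_vector_derivative_def]]
  by (rule has_derivative_eq_rhs) (auto simp: inner_commute algebra_simps)

lemma quadratic_remainder_has_derivative:
  assumes "bounded_linear f'" "\<And>y. norm (f y - f x - f' (y - x)) \<le> C * (norm (y - x))\<^sup>2"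
  shows "(f has_derivative f') (at x)"
  unfolding has_derivative_iff_norm
proof (intro conjI assms(1))
  have "((\<lambda>y. C * norm (y - x)) \<longlongrightarrow> C * 0) (at x)"
    by (intro tendsto_mult tendsto_const tendsto_norm_zero LIM_zero tendsto_ident_at)
  then show "((\<lambda>y. norm (f y - f x - f' (y - x)) / norm (y - x)) \<longlongrightarrow> 0) (at x)"
  proof (rule tendsto_0_le[where K=1, OF tendsto_eq_rhs])
    show "\<forall>\<^sub>F y in at x. norm (norm (f y - f x - f' (y - x)) / norm (y - x)) \<le> norm (C * norm (y - x)) * 1"
    proof (rule eventually_at_filter[THEN iffD2], rule always_eventually, intro allI impI)
      fix y assume "y \<noteq> x"
      then have "norm (f y - f x - f' (y - x)) / norm (y - x) \<le> C * norm (y - x)"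
        using assms(2)[of y] by (simp add: divide_simps power2_eq_square mult.assoc)
      then show "norm (norm (f y - f x - f' (y - x)) / norm (y - x)) \<le> norm (C * norm (y - x)) * 1" by simp
    qed
  qed simp
qed

section \<open>The truncated cubic nonlinearity\<close>

text \<open>
  Cubic on the unit disc and linear outside. \<open>Fc\<close> is the gradient of the function \<open>z \<mapsto> Gc
  (|z|\<^sup>2)\<close>: the truncation keeps the equation Hamiltonian and gauge invariant, so mass and
  energy survive.
\<close>

definition Fc :: "complex \<Rightarrow> complex" where "Fc z = of_real (min ((cmod z)\<^sup>2) 1) * z"
definition Gc :: "real \<Rightarrow> real" where "Gc s = (if s \<le> 1 then s\<^sup>2 / 4 else s / 2 - 1 / 4)"

lemma Fc_lipschitz: "cmod (Fc z - Fc w) \<le> 3 * cmod (z - w)"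
proof -
  have aux: "cmod (Fc z - Fc w) \<le> 3 * cmod (z - w)" if le: "cmod w \<le> cmod z" for z w
  proof -
    define a b where "a = min ((cmod z)\<^sup>2) 1" and "b = min ((cmod w)\<^sup>2) 1"
    have ab: "b \<le> a" unfolding a_def b_def by (intro min.mono power_mono le) auto
    have a1: "0 \<le> a" "a \<le> 1" by (auto simp: a_def)
    have tri: "cmod z - cmod w \<le> cmod (z - w)" by (rule norm_triangle_ineq2)
    have "Fc z - Fc w = of_real a * (z - w) + of_real (a - b) * w"
      by (simp add: Fc_def a_def b_def algebra_simps)
    then have "cmod (Fc z - Fc w) \<le> cmod (of_real a * (z - w)) + cmod (of_real (a - b) * w)"
      by (metis norm_triangle_ineq)
    also have "\<dots> = a * cmod (z - w) + (a - b) * cmod w"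
      using ab a1 by (simp add: norm_mult del: of_real_diff)
    also have "a * cmod (z - w) \<le> 1 * cmod (z - w)" using a1 by (intro mult_right_mono) auto
    also have "(a - b) * cmod w \<le> 2 * cmod (z - w)"
    proof (cases "cmod w \<le> 1")
      case True
      define x y where "x = min (cmod z) 1" and "y = cmod w"
      have xy: "0 \<le> y" "y \<le> 1" "y \<le> x" "x \<le> 1" "x \<le> cmod z" using True le by (auto simp: x_def y_def)
      have "a = x\<^sup>2" using abs_square_le_1[of "cmod z"] by (auto simp: a_def x_def min_def)
      moreover have "b = y\<^sup>2" using True power_mono[of "cmod w" 1 2] by (auto simp: b_def y_def)
      ultimately have "(a - b) * cmod w = (x - y) * ((x + y) * y)" by (simp add: y_def power2_eq_square algebra_simps)
      also have "\<dots> \<le> (x - y) * (2 * 1)" using xy by (intro mult_left_mono mult_mono) auto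
      also have "\<dots> \<le> 2 * cmod (z - w)" using xy tri by (simp add: y_def)
      finally show ?thesis .
    next
      case False
      then have "b = 1" "a = 1" using power_mono[of 1 "cmod w" 2] le power_mono[of 1 "cmod z" 2] by (auto simp: a_def b_def)
      then show ?thesis by simp
    qed
    finally show ?thesis by simp
  qed
  show ?thesis
  proof (cases "cmod w \<le> cmod z")
    case False
    then show ?thesis using aux[of z w] by (simp add: norm_minus_commute)
  qed (rule aux)
qed

text \<open>
  \<open>Gc\<close> is convex with derivative \<open>min s 1 / 2\<close>, so the remainder is nonnegative. It is
  quadratic in \<open>b - a\<close> rather than in \<open>b\<^sup>2 - a\<^sup>2\<close> since \<open>Gc\<close> is affine where \<open>a\<close> and \<open>b\<close> are
  large; the four cases are those of the two pieces of \<open>Gc\<close>.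
\<close>

lemma Gc_remainder:
  assumes "a \<ge> 0" "b \<ge> (0::real)"
  shows "0 \<le> Gc (b\<^sup>2) - Gc (a\<^sup>2) - min (a\<^sup>2) 1 / 2 * (b\<^sup>2 - a\<^sup>2)"
    "Gc (b\<^sup>2) - Gc (a\<^sup>2) - min (a\<^sup>2) 1 / 2 * (b\<^sup>2 - a\<^sup>2) \<le> 3 * (b - a)\<^sup>2"
proof -
  have sq1: "c\<^sup>2 \<le> 1 \<longleftrightarrow> c \<le> 1" if "c \<ge> 0" for c :: real
    using that abs_square_le_1[of c] by simp
  let ?R = "Gc (b\<^sup>2) - Gc (a\<^sup>2) - min (a\<^sup>2) 1 / 2 * (b\<^sup>2 - a\<^sup>2)"
  consider "a \<le> 1" "b \<le> 1" | "a > 1" "b > 1" | "a \<le> 1" "b > 1" | "a > 1" "b \<le> 1" by linarith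
  then have "0 \<le> ?R \<and> ?R \<le> 3 * (b - a)\<^sup>2"
  proof cases
    case 1
    then have R: "?R = (b - a)\<^sup>2 * ((b + a)\<^sup>2 / 4)"
      using sq1 assms by (simp add: Gc_def min_def power2_eq_square algebra_simps) (simp add: field_simps)
    have "(b + a)\<^sup>2 \<le> 2\<^sup>2" using 1 assms by (intro power_mono) auto
    then have "(b - a)\<^sup>2 * ((b + a)\<^sup>2 / 4) \<le> (b - a)\<^sup>2 * 3" by (intro mult_left_mono) auto
    then show ?thesis unfolding R by (simp add: mult.commute)
  next
    case 2
    then have R: "?R = 0" using sq1[of a] sq1[of b] assms by (simp add: Gc_def min_def field_simps)
    show ?thesis by (simp only: R) simp
  next
    case 3
    define x y where "x = 1 - a" and "y = b - 1"
    have xy: "0 \<le> x" "x \<le> 1" "0 \<le> y" "a = 1 - x" "b = 1 + y" using 3 assms by (auto simp: x_def y_def)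
    have R: "?R = x * (2 - x) * (2 * (y * (2 + y)) + x * (2 - x)) / 4"
      using sq1[of a] sq1[of b] assms 3 xy(4,5)
      by (simp add: Gc_def min_def power2_eq_square) (simp add: field_simps)
    have p0: "0 \<le> x * (2 - x)" "x * (2 - x) \<le> 2 * x"
      using xy mult_left_mono[of "2 - x" 2 x] by (auto simp: mult.commute)
    have "x * (2 - x) * (2 * (y * (2 + y)) + x * (2 - x)) \<le> 2 * x * (2 * (y * (2 + y)) + 2 * x)"
      by (rule mult_mono[OF p0(2) add_left_mono[OF p0(2)]])
         (use xy in simp, rule add_nonneg_nonneg[OF _ p0(1)], use xy in simp)
    also have "\<dots> = 4 * x\<^sup>2 + 8 * (x * y) + 4 * (x * y\<^sup>2)" by (simp add: power2_eq_square algebra_simps)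
    also have "\<dots> \<le> 4 * x\<^sup>2 + 8 * (x * y) + 4 * (1 * y\<^sup>2)" using xy by (intro add_mono mult_left_mono mult_right_mono) auto
    also have "\<dots> \<le> 12 * (x + y)\<^sup>2" using xy by (simp add: power2_sum)
    finally have le: "x * (2 - x) * (2 * (y * (2 + y)) + x * (2 - x)) \<le> 12 * (x + y)\<^sup>2" .
    have ba: "b - a = x + y" using xy by simp
    have "?R \<le> 3 * (b - a)\<^sup>2" unfolding R ba using le by linarith
    moreover have "?R \<ge> 0" unfolding R using p0 xy by (intro divide_nonneg_nonneg mult_nonneg_nonneg add_nonneg_nonneg) auto
    ultimately show ?thesis by blast
  next
    case 4
    then have R: "?R = (1 - b)\<^sup>2 * ((1 + b)\<^sup>2 / 4)"
      using sq1[of a] sq1[of b] assms by (simp add: Gc_def min_def power2_eq_square) (simp add: field_simps)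
    have "(1 + b)\<^sup>2 \<le> 2\<^sup>2" using 4 assms by (intro power_mono) auto
    then have "(1 - b)\<^sup>2 * ((1 + b)\<^sup>2 / 4) \<le> (1 - b)\<^sup>2 * 3" by (intro mult_left_mono) auto
    moreover have "(1 - b)\<^sup>2 \<le> (a - b)\<^sup>2" using 4 by (intro power_mono) auto
    moreover have "(a - b)\<^sup>2 = (b - a)\<^sup>2" by (rule power2_commute)
    ultimately show ?thesis unfolding R by simp
  qed
  then show "0 \<le> ?R" "?R \<le> 3 * (b - a)\<^sup>2" by auto
qed

lemma potential_remainder:
  "\<bar>Gc ((cmod w)\<^sup>2) - Gc ((cmod z)\<^sup>2) - Re (Fc z * cnj (w - z))\<bar> \<le> 4 * (cmod (w - z))\<^sup>2"
proof -
  define m where "m = min ((cmod z)\<^sup>2) 1"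
  have m: "0 \<le> m" "m \<le> 1" by (auto simp: m_def)
  have e: "(cmod w)\<^sup>2 - (cmod z)\<^sup>2 = 2 * Re (z * cnj (w - z)) + (cmod (w - z))\<^sup>2"
    unfolding cmod_power2 by (simp add: power2_eq_square algebra_simps)
  have F: "Re (Fc z * cnj (w - z)) = m * Re (z * cnj (w - z))"
    by (simp add: Fc_def m_def mult.assoc del: complex_cnj_diff)
  let ?R = "Gc ((cmod w)\<^sup>2) - Gc ((cmod z)\<^sup>2) - m / 2 * ((cmod w)\<^sup>2 - (cmod z)\<^sup>2)"
  have R: "0 \<le> ?R" "?R \<le> 3 * (cmod w - cmod z)\<^sup>2"
    using Gc_remainder[of "cmod z" "cmod w"] by (auto simp: m_def)
  have "(cmod w - cmod z)\<^sup>2 \<le> (cmod (w - z))\<^sup>2"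
    using norm_triangle_ineq3[of w z] by (metis abs_ge_zero power2_abs power_mono)
  moreover have "Gc ((cmod w)\<^sup>2) - Gc ((cmod z)\<^sup>2) - Re (Fc z * cnj (w - z)) = ?R + m / 2 * (cmod (w - z))\<^sup>2"
    unfolding F e by (simp add: field_simps)
  moreover have "0 \<le> m / 2 * (cmod (w - z))\<^sup>2" "m / 2 * (cmod (w - z))\<^sup>2 \<le> 1 * (cmod (w - z))\<^sup>2"
    by (rule mult_nonneg_nonneg, use m in simp, simp) (rule mult_right_mono, use m in auto)
  ultimately show ?thesis using R by linarith
qed

definition F :: "l2 \<Rightarrow> l2" where "F f = mk (\<lambda>x. Fc (fn f x))"
definition \<Gamma> :: "l2 \<Rightarrow> real" where "\<Gamma> f = (\<integral>x. Gc ((cmod (fn f x))\<^sup>2) \<partial>lebesgue)"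

lemma L2_Fc: "L2 f \<Longrightarrow> L2 (\<lambda>x. Fc (f x))"
proof (rule L2_lipschitz[where c=3 and F=Fc and f=f])
  show "Fc \<in> borel_measurable borel" unfolding Fc_def by measurable
  show "cmod (Fc z) \<le> 3 * cmod z" for z using Fc_lipschitz[of z 0] by (simp add: Fc_def)
qed

lemma fn_F: "AE x in lebesgue. fn (F f) x = Fc (fn f x)"
  unfolding F_def by (intro fn_mk L2_Fc L2_fn)

lemma norm_l2_le:
  fixes f g :: l2
  assumes "AE x in lebesgue. cmod (fn f x) \<le> c * cmod (fn g x)" "c \<ge> 0"
  shows "norm f \<le> c * norm g"
proof -
  have "(norm f)\<^sup>2 \<le> (\<integral>x. c\<^sup>2 * (cmod (fn g x))\<^sup>2 \<partial>lebesgue)"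
    unfolding norm_l2_sq
  proof (rule integral_mono_AE)
    show "integrable lebesgue (\<lambda>x. (cmod (fn f x))\<^sup>2)" "integrable lebesgue (\<lambda>x. c\<^sup>2 * (cmod (fn g x))\<^sup>2)"
      by (auto intro!: integrable_mult_right L2_integrable)
    show "AE x in lebesgue. (cmod (fn f x))\<^sup>2 \<le> c\<^sup>2 * (cmod (fn g x))\<^sup>2"
      using assms(1) by eventually_elim (metis norm_ge_zero power_mono power_mult_distrib)
  qed
  also have "\<dots> = (c * norm g)\<^sup>2" by (simp add: norm_l2_sq power_mult_distrib)
  finally show ?thesis by (rule power2_le_imp_le) (use assms(2) in simp)
qed

lemma F_lipschitz: "norm (F f - F g) \<le> 3 * norm (f - g)"
  by (rule norm_l2_le) (use fn_F[of f] fn_F[of g] fn_minus[of f g] fn_minus[of "F f" "F g"] in \<open>eventually_elim, simp add: Fc_lipschitz\<close>, simp)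

lemma F_0: "F 0 = 0"
  by (rule l2_eqI) (use fn_F[of 0] fn_0 in \<open>eventually_elim, simp add: Fc_def\<close>)

lemma norm_F_le: "norm (F f) \<le> 3 * norm f"
  using F_lipschitz[of f 0] by (simp add: F_0)

lemma norm_F_le1: "norm (F f) \<le> norm f"
proof -
  have "AE x in lebesgue. cmod (fn (F f) x) \<le> 1 * cmod (fn f x)"
    using fn_F[of f] by eventually_elim (auto simp: Fc_def norm_mult intro!: mult_left_le_one_le)
  from norm_l2_le[OF this] show ?thesis by simp
qed

lemma inner_F_ii: "inner (F f) (cscale \<i> f) = 0"
proof -
  have "inner (F f) (cscale \<i> f) = (\<integral>x. 0 \<partial>(lebesgue :: real measure))"
    unfolding inner_l2_def
    by (rule integral_cong_AE)
       (use fn_F[of f] fn_cscale[of \<i> f] in \<open>auto intro!: borel_measurable_integrable integrable_inner elim!: eventually_elim2 simp: Fc_def algebra_simps\<close>)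
  then show ?thesis by simp
qed

lemma F_shift: "F (shift a f) = shift a (F f)"
  by (rule l2_eqI) (use fn_F[of "shift a f"] fn_shift[of a f] AE_shift[OF fn_F[of f], of a] fn_shift[of a "F f"] in \<open>eventually_elim, simp\<close>)

lemma continuous_F: "continuous_on S F"
  by (rule lipschitz_on_continuous_on[of 3]) (auto simp: lipschitz_on_def dist_norm F_lipschitz)

lemma Gc_bounds: "s \<ge> 0 \<Longrightarrow> 0 \<le> Gc s" "s \<ge> 0 \<Longrightarrow> Gc s \<le> s / 2"
  using mult_left_le[of s s] by (auto simp: Gc_def power2_eq_square)

lemma measurable_Gc: "Gc \<in> borel_measurable borel"
  unfolding Gc_def by measurable

lemma integrable_Gc: "integrable lebesgue (\<lambda>x. Gc ((cmod (fn f x))\<^sup>2))"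
proof (rule Bochner_Integration.integrable_bound)
  show "integrable lebesgue (\<lambda>x. (cmod (fn f x))\<^sup>2)" by (intro L2_integrable L2_fn)
  show "(\<lambda>x. Gc ((cmod (fn f x))\<^sup>2)) \<in> borel_measurable lebesgue"
    by (intro measurable_compose[OF _ measurable_Gc]) measurable
  have "\<bar>Gc s\<bar> \<le> \<bar>s\<bar>" if "s \<ge> 0" for s using Gc_bounds[OF that] that by simp
  then show "AE x in lebesgue. norm (Gc ((cmod (fn f x))\<^sup>2)) \<le> norm ((cmod (fn f x))\<^sup>2)" by simp
qed

lemma \<Gamma>_bounds: "0 \<le> \<Gamma> f" "\<Gamma> f \<le> (norm f)\<^sup>2 / 2"
proof -
  show "0 \<le> \<Gamma> f" unfolding \<Gamma>_def by (intro Bochner_Integration.integral_nonneg) (simp add: Gc_bounds)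
  have "\<Gamma> f \<le> (\<integral>x. (cmod (fn f x))\<^sup>2 / 2 \<partial>lebesgue)"
    unfolding \<Gamma>_def
  proof (rule integral_mono[OF integrable_Gc])
    show "Gc ((cmod (fn f x))\<^sup>2) \<le> (cmod (fn f x))\<^sup>2 / 2" for x by (rule Gc_bounds) simp
  qed (auto intro!: L2_integrable)
  then show "\<Gamma> f \<le> (norm f)\<^sup>2 / 2" by (simp add: norm_l2_sq)
qed

text \<open>
  Integrating the pointwise quadratic remainder gives a remainder quadratic in the norm of
  \<open>L\<^sup>2\<close>; this is where the truncation matters, since the cubic power is not even defined on
  \<open>L\<^sup>2\<close>.
\<close>

lemma \<Gamma>_derivative: "(\<Gamma> has_derivative (\<lambda>h. inner (F f) h)) (at f)"
proof (rule quadratic_remainder_has_derivative[where C=4])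
  show "bounded_linear (inner (F f))" by (rule bounded_linear_inner_right)
  fix g
  let ?r = "\<lambda>x. Gc ((cmod (fn g x))\<^sup>2) - Gc ((cmod (fn f x))\<^sup>2) - Re (fn (F f) x * cnj (fn (g - f) x))"
  have I: "integrable lebesgue ?r"
    by (intro Bochner_Integration.integrable_diff integrable_Gc integrable_inner)
  have "\<Gamma> g - \<Gamma> f - inner (F f) (g - f) = (\<integral>x. ?r x \<partial>lebesgue)"
    unfolding \<Gamma>_def inner_l2_def
    by (simp only: Bochner_Integration.integral_diff integrable_Gc integrable_inner Bochner_Integration.integrable_diff)
  also have "norm \<dots> \<le> (\<integral>x. norm (?r x) \<partial>lebesgue)" by (rule integral_norm_bound)
  also have "\<dots> \<le> (\<integral>x. 4 * (cmod (fn (g - f) x))\<^sup>2 \<partial>lebesgue)"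
  proof (rule integral_mono_AE)
    show "AE x in lebesgue. norm (?r x) \<le> 4 * (cmod (fn (g - f) x))\<^sup>2"
      using fn_F[of f] fn_minus[of g f]
    proof eventually_elim
      case (elim x)
      then show ?case using potential_remainder[of "fn g x" "fn f x"] by simp
    qed
  qed (rule integrable_norm[OF I], intro integrable_mult_right L2_integrable L2_fn)
  finally show "norm (\<Gamma> g - \<Gamma> f - inner (F f) (g - f)) \<le> 4 * (norm (g - f))\<^sup>2" by (simp add: norm_l2_sq)
qed

lemma F_eq_cubic:
  assumes "AE x in lebesgue. cmod (fn f x) \<le> 1"
  shows "AE x in lebesgue. fn (F f) x = of_real ((cmod (fn f x))\<^sup>2) * fn f x"
  using fn_F[of f] assms
  by eventually_elim (auto simp: Fc_def min_def power_le_one)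

section \<open>Approximate solutions\<close>

lemma inner_mi_A: "inner f (cscale (- \<i>) (A n f)) = 0"
proof -
  have "inner f (cscale (- \<i>) (A n f)) = inner (A n f) (cscale (- \<i>) f)"
    by (simp add: A_cscale[symmetric] inner_A_sym)
  also have "\<dots> = inner (D n f) (cscale (- \<i>) (D n f))" by (simp add: inner_A D_cscale)
  also have "\<dots> = 0" by (simp add: cscale_minus_left)
  finally show ?thesis .
qed

text \<open>
  The common form of all estimates: \<open>- i A n\<close> is skew-adjoint and does not contribute to the
  growth of the norm, however large it is.
\<close>

lemma skew_gronwall:
  assumes d: "\<And>t. 0 \<le> t \<Longrightarrow> t \<le> T \<Longrightarrow> (w has_vector_derivative cscale (- \<i>) (A n (w t)) + p t) (at t within {0..T})"
    and p: "\<And>t. 0 \<le> t \<Longrightarrow> t \<le> T \<Longrightarrow> inner (w t) (p t) \<le> L * (norm (w t))\<^sup>2 + B"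
    and LB: "L \<ge> 0" "B \<ge> 0" and t: "0 \<le> t" "t \<le> T"
  shows "(norm (w t))\<^sup>2 \<le> exp (2 * L * T) * ((norm (w 0))\<^sup>2 + 2 * B * T)"
proof -
  have "(norm (w t))\<^sup>2 \<le> exp (2 * L * t) * ((norm (w 0))\<^sup>2 + 2 * B * t)"
  proof (rule gronwall[of T _ "\<lambda>t. 2 * inner (w t) (cscale (- \<i>) (A n (w t)) + p t)"])
    show "((\<lambda>t. (norm (w t))\<^sup>2) has_real_derivative 2 * inner (w t) (cscale (- \<i>) (A n (w t)) + p t)) (at t within {0..T})"
      if "0 \<le> t" "t \<le> T" for t by (rule norm_sq_derivative[OF d[OF that]])
    show "2 * inner (w t) (cscale (- \<i>) (A n (w t)) + p t) \<le> 2 * L * (norm (w t))\<^sup>2 + 2 * B" if "0 \<le> t" "t \<le> T" for t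
      using p[OF that] by (simp add: inner_add_right inner_mi_A)
  qed (use LB t in auto)
  also have "\<dots> \<le> exp (2 * L * T) * ((norm (w 0))\<^sup>2 + 2 * B * T)"
  proof (rule mult_mono)
    show "exp (2 * L * t) \<le> exp (2 * L * T)" using mult_left_mono[OF t(2), of "2 * L"] LB by simp
    show "(norm (w 0))\<^sup>2 + 2 * B * t \<le> (norm (w 0))\<^sup>2 + 2 * B * T" using mult_left_mono[OF t(2), of "2 * B"] LB by simp
  qed (use LB t in simp_all)
  finally show ?thesis .
qed

lemma C1_lipschitz_on_interval:
  fixes f f' :: "real \<Rightarrow> real"
  assumes d: "\<And>t. t \<ge> 0 \<Longrightarrow> (f has_real_derivative f' t) (at t within {0..})" and c: "continuous_on {0..} f'"
  obtains K where "K \<ge> 0" "\<And>s t. 0 \<le> s \<Longrightarrow> s \<le> T \<Longrightarrow> 0 \<le> t \<Longrightarrow> t \<le> T \<Longrightarrow> \<bar>f s - f t\<bar> \<le> K * \<bar>s - t\<bar>"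
proof -
  have "compact (f' ` {0..T})" by (intro compact_continuous_image continuous_on_subset[OF c]) auto
  then obtain K where K: "K > 0" "\<forall>x\<in>{0..T}. \<bar>f' x\<bar> \<le> K"
    using compact_imp_bounded[of "f' ` {0..T}"] unfolding bounded_pos by auto
  show thesis
  proof (rule that[of K])
    fix s t :: real assume st: "0 \<le> s" "s \<le> T" "0 \<le> t" "t \<le> T"
    have "norm (f s - f t) \<le> K * norm (s - t)"
    proof (rule field_differentiable_bound[of "{0..T}" f f'])
      show "(f has_field_derivative f' z) (at z within {0..T})" if "z \<in> {0..T}" for z
        using that by (intro has_field_derivative_subset[OF d]) auto
    qed (use K st in auto)
    then show "\<bar>f s - f t\<bar> \<le> K * \<bar>s - t\<bar>" by simp
  qed (use K in simp)
qed

lemma quotient_split: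
  fixes x y f :: "'a::real_normed_vector"
  assumes "c > 0" shows "(1 / c) *\<^sub>R (x - (y + c *\<^sub>R f)) + f = inverse c *\<^sub>R (x - y)"
proof -
  have "(1 / c) *\<^sub>R (x - (y + c *\<^sub>R f)) = (1 / c) *\<^sub>R (x - y) - (1 / c) *\<^sub>R (c *\<^sub>R f)"
    by (simp only: diff_diff_eq[symmetric] scaleR_diff_right)
  then show ?thesis using assms by (simp add: inverse_eq_divide)
qed

text \<open>
  The scalar equation with coefficient \<open>g \<rho>(t)\<close> on the half-line. For \<open>|f| \<le> r\<close> the term \<open>N t
  f = d F (f / r)\<close> equals \<open>(d / r\<^sup>3) |f|\<^sup>2 f = g \<rho> |f|\<^sup>2 f\<close>. The truncation height \<open>r = R \<rho>\<close>
  may grow with time, and putting all time dependence into the two scalars \<open>d\<close> and \<open>r\<close> lets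
  the energy be differentiated by the chain rule from the derivative of a single functional
  \<open>\<Gamma>\<close>. The lower bound on \<open>R\<close> is what \<open>truncation_inactive\<close> requires.
\<close>

locale nls =
  fixes g R :: real and \<rho> \<rho>' :: "real \<Rightarrow> real" and \<phi>0 :: l2 and C0 :: real
  assumes \<rho>_ge: "\<And>t. t \<ge> 0 \<Longrightarrow> \<rho> t \<ge> 1" and \<rho>_deriv: "\<And>t. t \<ge> 0 \<Longrightarrow> (\<rho> has_real_derivative \<rho>' t) (at t within {0..})"
    and \<rho>'_cont: "continuous_on {0..} \<rho>'" and \<rho>'_ge: "\<And>t. t \<ge> 0 \<Longrightarrow> \<rho>' t \<ge> 0" and R_ge: "R \<ge> 1"
    and data: "\<And>n. norm (A n \<phi>0) \<le> C0" and real_data: "conjug \<phi>0 = \<phi>0"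
    and R_large: "R \<ge> 16 * (norm \<phi>0)\<^sup>2 * (norm (dx \<phi>0))\<^sup>2 + 80 * \<bar>g\<bar> * ((norm \<phi>0)\<^sup>2)\<^sup>2"
begin

definition d :: "real \<Rightarrow> real" where "d t = g * R ^ 3 * \<rho> t ^ 4"
definition r :: "real \<Rightarrow> real" where "r t = R * \<rho> t"
definition N :: "real \<Rightarrow> l2 \<Rightarrow> l2" where "N t f = d t *\<^sub>R F (inverse (r t) *\<^sub>R f)"
definition q :: real where "q = (norm \<phi>0)\<^sup>2"

lemma \<rho>_cont: "continuous_on {0..} \<rho>"
  unfolding continuous_on_eq_continuous_within using \<rho>_deriv DERIV_continuous by blast
lemma d_cont: "continuous_on {0..} d" unfolding d_def by (intro continuous_intros \<rho>_cont)
lemma r_cont: "continuous_on {0..} r" unfolding r_def by (intro continuous_intros \<rho>_cont)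
lemma r_ge: "t \<ge> 0 \<Longrightarrow> r t \<ge> 1" using \<rho>_ge[of t] R_ge mult_mono[of 1 R 1 "\<rho> t"] by (simp add: r_def)
lemma r_pos: "t \<ge> 0 \<Longrightarrow> r t > 0" using r_ge[of t] by simp
lemma q_nonneg: "q \<ge> 0" by (simp add: q_def)

lemma \<rho>_mono: assumes "0 \<le> s" "s \<le> t" shows "\<rho> s \<le> \<rho> t"
proof (rule DERIV_nonneg_imp_increasing_open[OF assms(2)])
  show "\<exists>y. (\<rho> has_real_derivative y) (at x) \<and> 0 \<le> y" if "s < x" "x < t" for x
    using \<rho>_deriv[of x] \<rho>'_ge[of x] at_within_interior[of x "{0..}"] that assms by auto
  show "continuous_on {s..t} \<rho>" using assms by (intro continuous_on_subset[OF \<rho>_cont]) auto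
qed

lemma N_lipschitz: assumes "t \<ge> 0" shows "norm (N t f - N t h) \<le> 3 * \<bar>d t\<bar> * norm (f - h)"
proof -
  have i: "0 \<le> inverse (r t)" "inverse (r t) \<le> 1" using r_ge[OF assms] by (auto simp: inverse_le_1_iff)
  have "norm (N t f - N t h) \<le> \<bar>d t\<bar> * (3 * norm (inverse (r t) *\<^sub>R f - inverse (r t) *\<^sub>R h))"
    unfolding N_def scaleR_diff_right[of "d t", symmetric] norm_scaleR[of "d t"] by (intro mult_left_mono F_lipschitz) auto
  also have "norm (inverse (r t) *\<^sub>R f - inverse (r t) *\<^sub>R h) = inverse (r t) * norm (f - h)"
    using i by (simp add: scaleR_diff_right[symmetric])
  also have "\<dots> \<le> 1 * norm (f - h)" using i by (intro mult_right_mono) auto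
  finally show ?thesis by (simp add: mult_left_mono)
qed

lemma N_0: "N t 0 = 0" by (simp add: N_def F_0)
lemma N_shift: "N t (shift a f) = shift a (N t f)"
  by (simp add: N_def shift_scaleR[symmetric] F_shift)
lemma inner_N: "inner f (cscale (-\<i>) (N t f)) = 0"
proof (cases "r t = 0")
  case True then show ?thesis by (simp add: N_def F_0)
next
  case False
  define y where "y = inverse (r t) *\<^sub>R f"
  have f: "f = r t *\<^sub>R y" using False by (simp add: y_def)
  have "inner f (cscale (-\<i>) (N t f)) = r t * d t * inner y (cscale (-\<i>) (F y))"
    unfolding N_def y_def[symmetric] by (subst f) (simp add: cscale_scaleR)
  also have "inner y (cscale (-\<i>) (F y)) = inner (F y) (cscale \<i> y)"
    using inner_cscale[of "-\<i>" "F y" y] by (simp add: inner_commute)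
  finally show ?thesis by (simp add: inner_F_ii)
qed

lemma N_time_lipschitz:
  obtains K where "K \<ge> 0" "\<And>s t f. 0 \<le> s \<Longrightarrow> s \<le> T \<Longrightarrow> 0 \<le> t \<Longrightarrow> t \<le> T \<Longrightarrow> norm (N s f - N t f) \<le> K * \<bar>s - t\<bar> * norm f"
proof -
  have dd: "(d has_real_derivative g * R ^ 3 * (4 * \<rho> t ^ 3 * \<rho>' t)) (at t within {0..})" if "t \<ge> 0" for t
    unfolding d_def by (rule derivative_eq_intros \<rho>_deriv[OF that] refl)+ simp
  obtain K1 where K1: "K1 \<ge> 0" "\<And>s t. 0 \<le> s \<Longrightarrow> s \<le> T \<Longrightarrow> 0 \<le> t \<Longrightarrow> t \<le> T \<Longrightarrow> \<bar>d s - d t\<bar> \<le> K1 * \<bar>s - t\<bar>"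
  proof -
    have "continuous_on {0..} (\<lambda>t. g * R ^ 3 * (4 * \<rho> t ^ 3 * \<rho>' t))" by (intro continuous_intros \<rho>_cont \<rho>'_cont)
    from C1_lipschitz_on_interval[OF dd this, of T] that show thesis by blast
  qed
  obtain K2 where K2: "K2 \<ge> 0" "\<And>s t. 0 \<le> s \<Longrightarrow> s \<le> T \<Longrightarrow> 0 \<le> t \<Longrightarrow> t \<le> T \<Longrightarrow> \<bar>\<rho> s - \<rho> t\<bar> \<le> K2 * \<bar>s - t\<bar>"
    using C1_lipschitz_on_interval[OF \<rho>_deriv \<rho>'_cont] by blast
  have "compact (d ` {0..T})" by (intro compact_continuous_image continuous_on_subset[OF d_cont]) auto
  then obtain M where M: "M > 0" "\<forall>x\<in>{0..T}. \<bar>d x\<bar> \<le> M"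
    using compact_imp_bounded[of "d ` {0..T}"] unfolding bounded_pos by auto
  show thesis
  proof (rule that[of "K1 * 3 + M * 3 * (R * K2)"])
    show "K1 * 3 + M * 3 * (R * K2) \<ge> 0" using K1(1) K2(1) M(1) R_ge by simp
    fix s t :: real and f :: l2 assume st: "0 \<le> s" "s \<le> T" "0 \<le> t" "t \<le> T"
    have rs: "r s \<ge> 1" "r t \<ge> 1" using r_ge st by auto
    let ?i = "inverse (r s)" and ?j = "inverse (r t)"
    have ij: "\<bar>?i - ?j\<bar> \<le> R * K2 * \<bar>s - t\<bar>"
    proof -
      have "?i - ?j = ?i * (r t - r s) * ?j" using rs by (simp add: field_simps)
      then have "\<bar>?i - ?j\<bar> = ?i * ?j * \<bar>r t - r s\<bar>"
        using rs by (simp only: abs_mult) simp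
      also have "\<bar>r t - r s\<bar> = R * \<bar>\<rho> s - \<rho> t\<bar>"
        using R_ge by (simp add: r_def right_diff_distrib[symmetric] abs_mult abs_minus_commute)
      finally have "\<bar>?i - ?j\<bar> = ?i * ?j * (R * \<bar>\<rho> s - \<rho> t\<bar>)" .
      also have "\<dots> \<le> 1 * (R * \<bar>\<rho> s - \<rho> t\<bar>)"
        using rs R_ge by (intro mult_right_mono mult_le_one) (auto simp: inverse_le_1_iff)
      also have "\<dots> \<le> R * (K2 * \<bar>s - t\<bar>)" using K2(2)[OF st] R_ge by simp
      finally show ?thesis by (simp add: mult.assoc)
    qed
    have "N s f - N t f = (d s - d t) *\<^sub>R F (?i *\<^sub>R f) + d t *\<^sub>R (F (?i *\<^sub>R f) - F (?j *\<^sub>R f))"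
      by (simp add: N_def algebra_simps)
    then have "norm (N s f - N t f) \<le> \<bar>d s - d t\<bar> * norm (F (?i *\<^sub>R f)) + \<bar>d t\<bar> * norm (F (?i *\<^sub>R f) - F (?j *\<^sub>R f))"
      using norm_triangle_ineq[of "(d s - d t) *\<^sub>R F (?i *\<^sub>R f)" "d t *\<^sub>R (F (?i *\<^sub>R f) - F (?j *\<^sub>R f))"] by simp
    also have "\<dots> \<le> (K1 * \<bar>s - t\<bar>) * (3 * norm f) + M * (3 * (R * K2 * \<bar>s - t\<bar> * norm f))"
    proof (intro add_mono mult_mono)
      show "norm (F (?i *\<^sub>R f)) \<le> 3 * norm f"
        using norm_F_le[of "?i *\<^sub>R f"] rs mult_right_mono[of ?i 1 "norm f"] by (simp add: inverse_le_1_iff)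
      have "norm (F (?i *\<^sub>R f) - F (?j *\<^sub>R f)) \<le> 3 * norm (?i *\<^sub>R f - ?j *\<^sub>R f)" by (rule F_lipschitz)
      also have "norm (?i *\<^sub>R f - ?j *\<^sub>R f) = \<bar>?i - ?j\<bar> * norm f" by (simp add: scaleR_diff_left[symmetric])
      also have "\<dots> \<le> R * K2 * \<bar>s - t\<bar> * norm f" by (intro mult_right_mono ij) auto
      finally show "norm (F (?i *\<^sub>R f) - F (?j *\<^sub>R f)) \<le> 3 * (R * K2 * \<bar>s - t\<bar> * norm f)" by simp
    qed (use K1 M st K1(2)[OF st] in auto)
    finally show "norm (N s f - N t f) \<le> (K1 * 3 + M * 3 * (R * K2)) * \<bar>s - t\<bar> * norm f" by (simp add: algebra_simps)
  qed
qed

definition L :: "real \<Rightarrow> real" where "L T = 3 * (\<bar>g\<bar> * R ^ 3 * \<rho> T ^ 4)"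

lemma d_le: assumes "0 \<le> t" "t \<le> T" shows "3 * \<bar>d t\<bar> \<le> L T"
proof -
  have "\<rho> t ^ 4 \<le> \<rho> T ^ 4" using \<rho>_mono[OF assms] \<rho>_ge[OF assms(1)] by (intro power_mono) auto
  then have "\<bar>g\<bar> * R ^ 3 * \<rho> t ^ 4 \<le> \<bar>g\<bar> * R ^ 3 * \<rho> T ^ 4" using R_ge by (intro mult_left_mono) auto
  then show ?thesis using R_ge \<rho>_ge[OF assms(1)] by (simp add: d_def L_def abs_mult)
qed

lemma L_nonneg: "T \<ge> 0 \<Longrightarrow> L T \<ge> 0" using R_ge by (simp add: L_def)

lemma N_lip_T: "0 \<le> t \<Longrightarrow> t \<le> T \<Longrightarrow> norm (N t f - N t h) \<le> L T * norm (f - h)"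
  by (rule order_trans[OF N_lipschitz mult_right_mono[OF d_le norm_ge_zero]])
lemma norm_N_T: "0 \<le> t \<Longrightarrow> t \<le> T \<Longrightarrow> norm (N t f) \<le> L T * norm f"
  using N_lip_T[of t T f 0] by (simp add: N_0)

definition rhs :: "nat \<Rightarrow> real \<Rightarrow> l2 \<Rightarrow> l2" where "rhs n t f = cscale (-\<i>) (A n f - N t f)"

lemma N_cont: assumes "continuous_on {0..} y" shows "continuous_on {0..} (\<lambda>t. N t (y t))"
  unfolding N_def
  by (intro continuous_intros d_cont continuous_on_compose2[OF continuous_F[of UNIV]] r_cont assms)
     (use r_pos in force)+

lemma approximation_exists:
  "\<exists>y. y 0 = \<phi>0 \<and> (\<forall>t\<ge>0. (y has_vector_derivative rhs n t (y t)) (at t within {0..}))"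
proof -
  have c: "continuous_on {0..} (\<lambda>t. rhs n t (y t))" if "continuous_on {0..} y" for y
    unfolding rhs_def
    by (intro bounded_linear.continuous_on[OF bounded_linear_cscale] continuous_intros
        bounded_linear.continuous_on[OF bounded_linear_A] that N_cont)
  have l: "norm (rhs n t x - rhs n t y) \<le> (4 / (mesh n)\<^sup>2 + 3 * \<bar>d t\<bar>) * norm (x - y)" if "t \<ge> 0" for t x y
  proof -
    have "rhs n t x - rhs n t y = cscale (-\<i>) (A n (x - y) - (N t x - N t y))"
      by (simp add: rhs_def cscale_diff A_diff)
    then have "norm (rhs n t x - rhs n t y) \<le> norm (A n (x - y)) + norm (N t x - N t y)"
      by (simp add: norm_triangle_ineq4)
    also have "\<dots> \<le> (4 / (mesh n)\<^sup>2 + 3 * \<bar>d t\<bar>) * norm (x - y)"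
      unfolding distrib_right by (intro add_mono norm_A_le N_lipschitz that)
    finally show ?thesis .
  qed
  have z: "rhs n t 0 = 0" for t
    using A_scaleR[of n 0 0] by (simp add: rhs_def N_0)
  obtain y where "y 0 = \<phi>0" "\<And>t. t \<ge> 0 \<Longrightarrow> (y has_vector_derivative rhs n t (y t)) (at t within {0..})"
    by (rule global_ode[where f="rhs n" and L="\<lambda>t. 4 / (mesh n)\<^sup>2 + 3 * \<bar>d t\<bar>" and yi=\<phi>0, OF c l z]) (auto intro!: continuous_intros d_cont)
  then show ?thesis by blast
qed

definition \<phi> :: "nat \<Rightarrow> real \<Rightarrow> l2" where
  "\<phi> n = (SOME y. y 0 = \<phi>0 \<and> (\<forall>t\<ge>0. (y has_vector_derivative rhs n t (y t)) (at t within {0..})))"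

lemma \<phi>_spec: "\<phi> n 0 = \<phi>0 \<and> (\<forall>t\<ge>0. (\<phi> n has_vector_derivative rhs n t (\<phi> n t)) (at t within {0..}))"
  unfolding \<phi>_def by (rule someI_ex[OF approximation_exists])

lemma \<phi>_0 [simp]: "\<phi> n 0 = \<phi>0" using \<phi>_spec[of n] by (rule conjunct1)

lemma \<phi>_deriv: "t \<ge> 0 \<Longrightarrow> (\<phi> n has_vector_derivative rhs n t (\<phi> n t)) (at t within {0..})"
  using conjunct2[OF \<phi>_spec[of n]] by blast

lemma \<phi>_deriv_T: "0 \<le> t \<Longrightarrow> (\<phi> n has_vector_derivative rhs n t (\<phi> n t)) (at t within {0..T})"
  using has_vector_derivative_within_subset[OF \<phi>_deriv, of t "{0..T}" n] by auto

lemma norm_\<phi>: assumes "t \<ge> 0" shows "norm (\<phi> n t) = norm \<phi>0"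
proof -
  have zd: "((\<lambda>t. (norm (\<phi> n t))\<^sup>2) has_real_derivative 0) (at t within {0..})" if "t \<in> {0..}" for t
  proof -
    have "inner (\<phi> n t) (rhs n t (\<phi> n t)) = 0"
      by (simp add: rhs_def cscale_diff inner_diff_right inner_mi_A inner_N)
    then show ?thesis using norm_sq_derivative[OF \<phi>_deriv[of t n]] that by simp
  qed
  obtain c where c: "\<forall>t\<in>{0..}. (norm (\<phi> n t))\<^sup>2 = c"
    using has_field_derivative_zero_constant[OF convex_real_interval(1) zd] by (rule exE)
  have "(norm (\<phi> n t))\<^sup>2 = (norm (\<phi> n 0))\<^sup>2"
    using bspec[OF c, of t] bspec[OF c, of 0] assms by simp
  then show ?thesis unfolding \<phi>_0 by (rule power2_eq_imp_eq) simp_all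
qed

lemma norm_D_\<phi>0: "norm (D n \<phi>0) \<le> norm (dx \<phi>0)"
  by (rule norm_D_le_dx[OF h1_of_bounded_A(1)[OF data]])

text \<open>
  Translations commute with the equation, so the translate of a solution is a solution and
  Gronwall compares the two. The result is a bound in \<open>H\<^sup>1\<close> which is uniform in \<open>n\<close>, at every
  scale \<open>m\<close>.
\<close>

lemma translation_bound:
  assumes t: "0 \<le> t" "t \<le> T"
  shows "norm (shift (mesh m) (\<phi> n t) - \<phi> n t) \<le> exp (L T * T) * norm (dx \<phi>0) * mesh m"
proof -
  define w where "w t = shift (mesh m) (\<phi> n t) - \<phi> n t" for t
  define p where "p t = cscale \<i> (N t (shift (mesh m) (\<phi> n t)) - N t (\<phi> n t))" for t
  have T: "T \<ge> 0" using t by simp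
  have "(norm (w t))\<^sup>2 \<le> exp (2 * L T * T) * ((norm (w 0))\<^sup>2 + 2 * 0 * T)"
  proof (rule skew_gronwall[of T w n p])
    fix t assume t: "0 \<le> t" "t \<le> T"
    have "(w has_vector_derivative shift (mesh m) (rhs n t (\<phi> n t)) - rhs n t (\<phi> n t)) (at t within {0..T})"
      unfolding w_def by (intro derivative_intros bounded_linear.has_vector_derivative[OF bounded_linear_shift] \<phi>_deriv_T t)
    moreover have "shift (mesh m) (rhs n t (\<phi> n t)) - rhs n t (\<phi> n t) = cscale (-\<i>) (A n (w t)) + p t"
      by (simp add: rhs_def p_def w_def shift_cscale shift_diff shift_uminus N_shift A_shift A_diff cscale_diff cscale_minus_left)
    ultimately show "(w has_vector_derivative cscale (-\<i>) (A n (w t)) + p t) (at t within {0..T})" by simp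
    have "inner (w t) (p t) \<le> norm (w t) * norm (p t)" by (rule norm_cauchy_schwarz)
    also have "norm (p t) \<le> L T * norm (w t)" unfolding p_def w_def using N_lip_T[OF t] by simp
    finally show "inner (w t) (p t) \<le> L T * (norm (w t))\<^sup>2 + 0"
      by (simp add: power2_eq_square mult_left_mono mult.left_commute)
  qed (use t L_nonneg T in auto)
  also have "norm (w 0) = mesh m * norm (D m \<phi>0)" by (simp add: w_def D_def)
  finally have "(norm (w t))\<^sup>2 \<le> (exp (L T * T) * (mesh m * norm (D m \<phi>0)))\<^sup>2"
    by (simp add: power_mult_distrib exp_double[symmetric] mult.assoc)
  then have "norm (w t) \<le> exp (L T * T) * (mesh m * norm (D m \<phi>0))"
    by (rule power2_le_imp_le) simp
  also have "\<dots> \<le> exp (L T * T) * (mesh m * norm (dx \<phi>0))"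
    by (intro mult_left_mono norm_D_\<phi>0) auto
  finally show ?thesis by (simp add: w_def mult_ac)
qed

text \<open>
  The same comparison with a translation in time. The nonlinearity depends on time, but only
  in a Lipschitz way. The velocity at time \<open>0\<close> is bounded uniformly in \<open>n\<close> by the assumption
  on the datum, and dividing the increments by \<open>s\<close> propagates the bound.
\<close>

lemma velocity_bound:
  assumes T: "T \<ge> 0"
  obtains V where "V \<ge> 0" "\<And>n t. 0 \<le> t \<Longrightarrow> t \<le> T \<Longrightarrow> norm (rhs n t (\<phi> n t)) \<le> V"
proof -
  \<comment> \<open>Increments of size at most one are compared on \<open>[0, T]\<close>, so they involve times up to \<open>T + 1\<close>.\<close>
  define T' where "T' = T + 1"
  obtain K where K: "K \<ge> 0" "\<And>s t f. 0 \<le> s \<Longrightarrow> s \<le> T' \<Longrightarrow> 0 \<le> t \<Longrightarrow> t \<le> T' \<Longrightarrow> norm (N s f - N t f) \<le> K * \<bar>s - t\<bar> * norm f"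
    using N_time_lipschitz[of T'] by blast
  define l where "l = L T' + 1"
  have l: "l \<ge> 0" "L T' \<ge> 0" using L_nonneg[of T'] T by (auto simp: l_def T'_def)
  define V0 where "V0 = C0 + L T' * norm \<phi>0"
  define V where "V = sqrt (exp (2 * l * T) * (V0\<^sup>2 + 2 * (K * norm \<phi>0)\<^sup>2 * T))"
  have init: "norm (rhs n 0 \<phi>0) \<le> V0" for n
  proof -
    have "norm (rhs n 0 \<phi>0) \<le> norm (A n \<phi>0) + norm (N 0 \<phi>0)" by (simp add: rhs_def norm_triangle_ineq4)
    also have "\<dots> \<le> V0" unfolding V0_def by (intro add_mono data norm_N_T) (use T in \<open>auto simp: T'_def\<close>)
    finally show ?thesis .
  qed
  have quot: "((\<lambda>s. inverse s *\<^sub>R (\<phi> n (t + s) - \<phi> n t)) \<longlongrightarrow> rhs n t (\<phi> n t)) (at_right 0)" if t: "t \<ge> 0" for n t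
  proof -
    let ?f = "rhs n t (\<phi> n t)"
    have "(\<phi> n has_vector_derivative ?f) (at t within {t<..})"
      using t by (intro has_vector_derivative_within_subset[OF \<phi>_deriv]) auto
    then have "((\<lambda>y. (1 / norm (y - t)) *\<^sub>R (\<phi> n y - (\<phi> n t + (y - t) *\<^sub>R ?f))) \<longlongrightarrow> 0) (at_right t)"
      unfolding has_vector_derivative_def has_derivative_within by blast
    then have "((\<lambda>y. (1 / norm (y - t)) *\<^sub>R (\<phi> n y - (\<phi> n t + (y - t) *\<^sub>R ?f)) + ?f) \<longlongrightarrow> 0 + ?f) (at_right t)"
      by (intro tendsto_add tendsto_const)
    moreover have "\<forall>\<^sub>F y in at_right t. (1 / norm (y - t)) *\<^sub>R (\<phi> n y - (\<phi> n t + (y - t) *\<^sub>R ?f)) + ?f = inverse (y - t) *\<^sub>R (\<phi> n y - \<phi> n t)"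
      unfolding eventually_at_right_field
    proof (intro exI[of _ "t + 1"] conjI allI impI)
      fix y assume y: "t < y" "y < t + 1"
      have "norm (y - t) = y - t" "0 < y - t" using y by auto
      then show "(1 / norm (y - t)) *\<^sub>R (\<phi> n y - (\<phi> n t + (y - t) *\<^sub>R ?f)) + ?f = inverse (y - t) *\<^sub>R (\<phi> n y - \<phi> n t)"
        by (simp only: quotient_split)
    qed simp
    ultimately have *: "((\<lambda>y. inverse (y - t) *\<^sub>R (\<phi> n y - \<phi> n t)) \<longlongrightarrow> 0 + ?f) (at_right t)"
      by (rule Lim_transform_eventually)
    have "filterlim (\<lambda>s. t + s) (at_right t) (at_right 0)"
      unfolding filterlim_def at_right_to_0[of t] add.commute[of t] by (rule order_refl)
    from filterlim_compose[OF * this] show ?thesis unfolding add_diff_cancel_left' add_0 .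
  qed
  have main: "(norm (\<phi> n (t + s) - \<phi> n t))\<^sup>2 \<le> exp (2 * l * T) * ((norm (\<phi> n s - \<phi>0))\<^sup>2 + 2 * (K * s * norm \<phi>0)\<^sup>2 * T)"
    if s: "0 < s" "s \<le> 1" and t: "0 \<le> t" "t \<le> T" for n s t
  proof -
    define w where "w t = \<phi> n (t + s) - \<phi> n t" for t
    define p where "p t = cscale \<i> (N (t + s) (\<phi> n (t + s)) - N t (\<phi> n t))" for t
    have "(norm (w t))\<^sup>2 \<le> exp (2 * l * T) * ((norm (w 0))\<^sup>2 + 2 * (K * s * norm \<phi>0)\<^sup>2 * T)"
    proof (rule skew_gronwall[of T w n p])
      fix t assume t: "0 \<le> t" "t \<le> T"
      have "((\<lambda>t. \<phi> n (t + s)) has_vector_derivative rhs n (t + s) (\<phi> n (t + s))) (at t within {0..T})"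
      proof -
        have "(\<phi> n has_vector_derivative rhs n (t + s) (\<phi> n (t + s))) (at (t + s) within (\<lambda>t. t + s) ` {0..T})"
          using t s by (intro has_vector_derivative_within_subset[OF \<phi>_deriv]) auto
        moreover have "((\<lambda>t. t + s) has_vector_derivative 1) (at t within {0..T})"
          unfolding has_real_derivative_iff_has_vector_derivative[symmetric]
          by (rule derivative_eq_intros refl)+ simp
        ultimately show ?thesis
          using vector_diff_chain_within[of "\<lambda>t. t + s" 1 t "{0..T}" "\<phi> n"] by (simp add: o_def)
      qed
      then have "(w has_vector_derivative rhs n (t + s) (\<phi> n (t + s)) - rhs n t (\<phi> n t)) (at t within {0..T})"
        unfolding w_def by (intro has_vector_derivative_diff \<phi>_deriv_T t)
      moreover have "rhs n (t + s) (\<phi> n (t + s)) - rhs n t (\<phi> n t) = cscale (-\<i>) (A n (w t)) + p t"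
        by (simp add: rhs_def p_def w_def A_diff cscale_diff cscale_minus_left)
      ultimately show "(w has_vector_derivative cscale (-\<i>) (A n (w t)) + p t) (at t within {0..T})" by simp
      have "norm (p t) = norm ((N (t + s) (\<phi> n (t + s)) - N (t + s) (\<phi> n t)) + (N (t + s) (\<phi> n t) - N t (\<phi> n t)))"
        by (simp add: p_def)
      also have "\<dots> \<le> L T' * norm (w t) + K * s * norm \<phi>0"
        unfolding w_def using t s K(2)[of "t + s" t "\<phi> n t"]
        by (intro norm_triangle_le add_mono N_lip_T) (auto simp: T'_def norm_\<phi>)
      finally have p: "norm (p t) \<le> L T' * norm (w t) + K * s * norm \<phi>0" .
      have "inner (w t) (p t) \<le> norm (w t) * norm (p t)" by (rule norm_cauchy_schwarz)
      also have "\<dots> \<le> norm (w t) * (L T' * norm (w t) + K * s * norm \<phi>0)" by (intro mult_left_mono p) auto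
      also have "\<dots> = L T' * (norm (w t))\<^sup>2 + norm (w t) * (K * s * norm \<phi>0)" by (simp add: power2_eq_square algebra_simps)
      also have "norm (w t) * (K * s * norm \<phi>0) \<le> (norm (w t))\<^sup>2 + (K * s * norm \<phi>0)\<^sup>2"
      proof -
        have "0 \<le> norm (w t) * (K * s * norm \<phi>0)" using K(1) s by simp
        then show ?thesis using sum_squares_bound[of "norm (w t)" "K * s * norm \<phi>0"] by linarith
      qed
      finally show "inner (w t) (p t) \<le> l * (norm (w t))\<^sup>2 + (K * s * norm \<phi>0)\<^sup>2" by (simp add: l_def algebra_simps)
    qed (use t l in auto)
    then show ?thesis by (simp add: w_def)
  qed
  have bound: "norm (rhs n t (\<phi> n t)) \<le> V" if t: "0 \<le> t" "t \<le> T" for n t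
  proof -
    have "(norm (rhs n t (\<phi> n t)))\<^sup>2 \<le> exp (2 * l * T) * ((norm (rhs n 0 \<phi>0))\<^sup>2 + 2 * (K * norm \<phi>0)\<^sup>2 * T)"
    proof (rule tendsto_le[of "at_right (0::real)"])
      show "((\<lambda>s. (norm (inverse s *\<^sub>R (\<phi> n (t + s) - \<phi> n t)))\<^sup>2) \<longlongrightarrow> (norm (rhs n t (\<phi> n t)))\<^sup>2) (at_right 0)"
        by (intro tendsto_power tendsto_norm quot t)
      show "((\<lambda>s. exp (2 * l * T) * ((norm (inverse s *\<^sub>R (\<phi> n s - \<phi>0)))\<^sup>2 + 2 * (K * norm \<phi>0)\<^sup>2 * T)) \<longlongrightarrow>
         exp (2 * l * T) * ((norm (rhs n 0 \<phi>0))\<^sup>2 + 2 * (K * norm \<phi>0)\<^sup>2 * T)) (at_right 0)"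
        using quot[of 0 n] by (intro tendsto_mult tendsto_add tendsto_power tendsto_norm tendsto_const) simp
      show "\<forall>\<^sub>F s in at_right 0. (norm (inverse s *\<^sub>R (\<phi> n (t + s) - \<phi> n t)))\<^sup>2 \<le>
         exp (2 * l * T) * ((norm (inverse s *\<^sub>R (\<phi> n s - \<phi>0)))\<^sup>2 + 2 * (K * norm \<phi>0)\<^sup>2 * T)"
        unfolding eventually_at_right_field
      proof (intro exI[of _ 1] conjI allI impI)
        fix s :: real assume s: "0 < s" "s < 1"
        have "(inverse s)\<^sup>2 * (norm (\<phi> n (t + s) - \<phi> n t))\<^sup>2
          \<le> (inverse s)\<^sup>2 * (exp (2 * l * T) * ((norm (\<phi> n s - \<phi>0))\<^sup>2 + 2 * (K * s * norm \<phi>0)\<^sup>2 * T))"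
          using s t by (intro mult_left_mono main) auto
        also have "\<dots> = exp (2 * l * T) * ((inverse s)\<^sup>2 * (norm (\<phi> n s - \<phi>0))\<^sup>2 + 2 * (K * norm \<phi>0)\<^sup>2 * T)"
          using s by (simp add: field_simps power2_eq_square)
        finally show "(norm (inverse s *\<^sub>R (\<phi> n (t + s) - \<phi> n t)))\<^sup>2 \<le>
         exp (2 * l * T) * ((norm (inverse s *\<^sub>R (\<phi> n s - \<phi>0)))\<^sup>2 + 2 * (K * norm \<phi>0)\<^sup>2 * T)"
          using s by (simp add: power_mult_distrib)
      qed simp
    qed simp
    also have "\<dots> \<le> exp (2 * l * T) * (V0\<^sup>2 + 2 * (K * norm \<phi>0)\<^sup>2 * T)"
      by (intro mult_left_mono add_mono power_mono init) auto
    finally show ?thesis unfolding V_def by (rule real_le_rsqrt)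
  qed
  have "V \<ge> 0" unfolding V_def using T by (intro real_sqrt_ge_zero mult_nonneg_nonneg add_nonneg_nonneg) auto
  then show thesis using bound by (rule that)
qed

lemma A_bound:
  assumes T: "T \<ge> 0"
  obtains C where "C \<ge> 0" "\<And>n t. 0 \<le> t \<Longrightarrow> t \<le> T \<Longrightarrow> norm (A n (\<phi> n t)) \<le> C"
proof -
  obtain V where V: "V \<ge> 0" "\<And>n t. 0 \<le> t \<Longrightarrow> t \<le> T \<Longrightarrow> norm (rhs n t (\<phi> n t)) \<le> V"
    using velocity_bound[OF T] by blast
  have "norm (A n (\<phi> n t)) \<le> V + L T * norm \<phi>0" if t: "0 \<le> t" "t \<le> T" for n t
  proof -
    have "norm (A n (\<phi> n t)) \<le> norm (A n (\<phi> n t) - N t (\<phi> n t)) + norm (N t (\<phi> n t))"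
      by (metis diff_add_cancel norm_triangle_ineq)
    also have "norm (A n (\<phi> n t) - N t (\<phi> n t)) \<le> V" using V(2)[OF t, of n] by (simp add: rhs_def)
    also have "norm (N t (\<phi> n t)) \<le> L T * norm \<phi>0" using norm_N_T[OF t, of "\<phi> n t"] norm_\<phi>[OF t(1)] by simp
    finally show ?thesis by simp
  qed
  then show thesis using that[of "V + L T * norm \<phi>0"] V(1) L_nonneg[OF T] by simp
qed

text \<open>
  For \<open>w = \<phi> (n+1) - \<phi> n\<close> the discretization error is \<open>(k\<^sup>2/4) A A (\<phi> n)\<close> with the finer
  operator \<open>A\<close>. Tested against \<open>w\<close> it equals \<open>(k\<^sup>2/4) \<langle>A (\<phi> (n+1)), - i A (\<phi> n)\<rangle>\<close>, because the
  contribution of \<open>\<phi> n\<close> to \<open>w\<close> vanishes by skew symmetry. The first factor is bounded by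
  \<open>A_bound\<close>; the second is a finer difference of a coarser solution and is only controlled by
  \<open>k\<^sup>2 \<parallel>A (\<phi> n)\<parallel> \<le> 2 \<parallel>T (\<phi> n) - \<phi> n\<parallel> = O(k)\<close>. So \<open>\<parallel>w\<parallel>\<^sup>2 = O(k)\<close>.
\<close>

lemma consecutive_bound:
  assumes T: "T \<ge> 0"
  obtains M where "M \<ge> 0" "\<And>n t. 0 \<le> t \<Longrightarrow> t \<le> T \<Longrightarrow> norm (\<phi> (Suc n) t - \<phi> n t) \<le> M * sqrt (1/2) ^ n"
proof -
  obtain C where C: "C \<ge> 0" "\<And>n t. 0 \<le> t \<Longrightarrow> t \<le> T \<Longrightarrow> norm (A n (\<phi> n t)) \<le> C"
    using A_bound[OF T] by blast
  define E where "E = exp (L T * T) * norm (dx \<phi>0)"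
  have E: "E \<ge> 0" by (simp add: E_def)
  define M where "M = sqrt (exp (2 * L T * T) * (C * E * T))"
  have "norm (\<phi> (Suc n) t - \<phi> n t) \<le> M * sqrt (1/2) ^ n" if t: "0 \<le> t" "t \<le> T" for n t
  proof -
    define k where "k = mesh (Suc n)"
    let ?A = "A (Suc n)"
    define w where "w t = \<phi> (Suc n) t - \<phi> n t" for t
    define p where "p t = cscale \<i> (N t (\<phi> (Suc n) t) - N t (\<phi> n t)) + (k\<^sup>2/4) *\<^sub>R cscale (-\<i>) (?A (?A (\<phi> n t)))" for t
    have "(norm (w t))\<^sup>2 \<le> exp (2 * L T * T) * ((norm (w 0))\<^sup>2 + 2 * (C * E * k / 2) * T)"
    proof (rule skew_gronwall[of T w "Suc n" p])
      fix t assume t: "0 \<le> t" "t \<le> T"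
      have "(w has_vector_derivative rhs (Suc n) t (\<phi> (Suc n) t) - rhs n t (\<phi> n t)) (at t within {0..T})"
        unfolding w_def by (intro has_vector_derivative_diff \<phi>_deriv_T t)
      moreover have "rhs (Suc n) t (\<phi> (Suc n) t) - rhs n t (\<phi> n t) = cscale (-\<i>) (?A (w t)) + p t"
      proof -
        have "A n (\<phi> n t) = ?A (\<phi> n t) - (k\<^sup>2/4) *\<^sub>R ?A (?A (\<phi> n t))"
          using A_Suc_diff[of n "\<phi> n t"] by (simp add: k_def algebra_simps)
        then show ?thesis
          by (simp add: rhs_def p_def w_def A_diff cscale_diff cscale_minus_left cscale_scaleR)
      qed
      ultimately show "(w has_vector_derivative cscale (-\<i>) (?A (w t)) + p t) (at t within {0..T})" by simp
      have 1: "inner (w t) (cscale \<i> (N t (\<phi> (Suc n) t) - N t (\<phi> n t))) \<le> L T * (norm (w t))\<^sup>2"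
      proof -
        have "inner (w t) (cscale \<i> (N t (\<phi> (Suc n) t) - N t (\<phi> n t))) \<le> norm (w t) * norm (cscale \<i> (N t (\<phi> (Suc n) t) - N t (\<phi> n t)))"
          by (rule norm_cauchy_schwarz)
        also have "\<dots> \<le> norm (w t) * (L T * norm (w t))"
          unfolding w_def using N_lip_T[OF t] by (intro mult_left_mono) auto
        finally show ?thesis by (simp add: power2_eq_square mult_ac)
      qed
      have "inner (w t) (cscale (-\<i>) (?A (?A (\<phi> n t)))) = inner (?A (w t)) (cscale (-\<i>) (?A (\<phi> n t)))"
        by (simp add: A_cscale[symmetric] inner_A_sym)
      also have "\<dots> = inner (?A (\<phi> (Suc n) t)) (cscale (-\<i>) (?A (\<phi> n t)))"
        by (simp add: w_def A_diff inner_diff_left cscale_minus_left)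
      also have "\<dots> \<le> norm (?A (\<phi> (Suc n) t)) * norm (cscale (-\<i>) (?A (\<phi> n t)))" by (rule norm_cauchy_schwarz)
      also have "\<dots> \<le> C * norm (?A (\<phi> n t))" using C(2)[OF t] by (simp add: mult_right_mono)
      finally have 3: "inner (w t) (cscale (-\<i>) (?A (?A (\<phi> n t)))) \<le> C * norm (?A (\<phi> n t))" .
      have "(k\<^sup>2/4) * inner (w t) (cscale (-\<i>) (?A (?A (\<phi> n t)))) \<le> C / 4 * (k\<^sup>2 * norm (?A (\<phi> n t)))"
        using mult_left_mono[OF 3, of "k\<^sup>2/4"] by (simp add: mult_ac)
      also have "\<dots> \<le> C / 4 * (2 * (E * k))"
        using sq_norm_A_le[of "Suc n" "\<phi> n t"] translation_bound[OF t, of "Suc n" n] C(1)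
        by (intro mult_left_mono) (auto simp: k_def E_def)
      finally have 2: "(k\<^sup>2/4) * inner (w t) (cscale (-\<i>) (?A (?A (\<phi> n t)))) \<le> C * E * k / 2" by simp
      show "inner (w t) (p t) \<le> L T * (norm (w t))\<^sup>2 + C * E * k / 2"
        using 1 2 by (simp add: p_def inner_add_right)
    qed (use t L_nonneg T C E in \<open>auto simp: k_def\<close>)
    also have "\<dots> = exp (2 * L T * T) * (C * E * T) * mesh (Suc n)" by (simp add: w_def k_def)
    also have "\<dots> \<le> exp (2 * L T * T) * (C * E * T) * mesh n"
      using C E T by (intro mult_left_mono mult_nonneg_nonneg) (auto simp: mesh_Suc[of n])
    also have "\<dots> = (M * sqrt (1/2) ^ n)\<^sup>2"
    proof -
      have "(sqrt (1/2) ^ n)\<^sup>2 = mesh n" by (simp add: mesh_def power_even_eq[symmetric] power_mult[symmetric] mult.commute[of n] power_mult)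
      moreover have "M\<^sup>2 = exp (2 * L T * T) * (C * E * T)" unfolding M_def using C E T by (intro real_sqrt_pow2) auto
      ultimately show ?thesis by (simp add: power_mult_distrib)
    qed
    finally show ?thesis unfolding w_def by (rule power2_le_imp_le) (simp add: M_def C E T)
  qed
  moreover have "M \<ge> 0" by (simp add: M_def C E T)
  ultimately show thesis using that by blast
qed

end

section \<open>The energy estimate\<close>

lemma bounded_linear_D: "bounded_linear (D n)"
proof (rule bounded_linear_intro[where K="2 / mesh n"])
  fix f
  have "norm (D n f) = norm (shift (mesh n) f - f) / mesh n"
    by (simp add: D_def divide_inverse mult.commute)
  also have "\<dots> \<le> (2 * norm f) / mesh n"
    using norm_triangle_ineq4[of "shift (mesh n) f" f] by (intro divide_right_mono) auto
  finally show "norm (D n f) \<le> norm f * (2 / mesh n)" by (simp add: mult.commute)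
qed (rule D_add, rule D_scaleR)

text \<open>
  Exponents of \<open>R\<close> and \<open>\<rho>\<close> in the energy estimate.
\<close>

lemma cancel_powers:
  fixes a b :: real assumes "a > 0" "b > 0"
  shows "c * a ^ 4 * b ^ 5 * (q / (2 * a\<^sup>2 * b\<^sup>2)) = c * a\<^sup>2 * q * b ^ 3 / 2"
    and "c * a ^ 4 * (5 * b ^ 4 * e) * (q / (2 * a\<^sup>2 * b\<^sup>2)) = 5/2 * (c * a\<^sup>2 * q * (b\<^sup>2 * e))"
    and "c * a ^ 3 * b ^ 3 * e * (q / (a * b)) = c * a\<^sup>2 * q * (b\<^sup>2 * e)"
    and "c * a ^ 4 * b ^ 5 * (e / (a * b\<^sup>2) * z) = c * a ^ 3 * b ^ 3 * e * z"
    and "c * a ^ 3 * b ^ 4 = c * a ^ 4 * b ^ 5 * inverse (a * b)"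
    and "inverse ((a * b)\<^sup>2) * q / 2 = q / (2 * a\<^sup>2 * b\<^sup>2)"
  using assms by (simp_all add: divide_simps eval_nat_numeral)

context nls begin

text \<open>
  The energy \<open>\<langle>A \<phi>, \<phi>\<rangle> / 2 - P\<close>, where \<open>P = d r \<Gamma> (\<phi> / r)\<close>, changes only through the explicit
  time dependence of \<open>d\<close> and \<open>r\<close>. That change is at most \<open>(5/2 + 1) |g| R\<^sup>2 q \<rho>\<^sup>2 \<rho>'\<close>, the
  derivative of the term \<open>(7/6) |g| R\<^sup>2 q \<rho>\<^sup>3\<close> subtracted in \<open>e\<close>, so \<open>e\<close> decreases. In twice
  the energy this term contributes \<open>7/3\<close> and \<open>2 P\<close> at time \<open>t\<close> contributes \<open>1\<close>, while \<open>P\<close> at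
  time \<open>0\<close> is absorbed by the subtracted term; \<open>5\<close> is a round upper bound.
\<close>

lemma energy_bound:
  assumes t: "t \<ge> 0"
  shows "(norm (D n (\<phi> n t)))\<^sup>2 \<le> (norm (dx \<phi>0))\<^sup>2 + 5 * \<bar>g\<bar> * R\<^sup>2 * q * \<rho> t ^ 3"
proof -
  define y where "y t = inverse (r t) *\<^sub>R \<phi> n t" for t
  define P where "P t = g * R ^ 4 * \<rho> t ^ 5 * \<Gamma> (y t)" for t
  define e where "e t = inner (A n (\<phi> n t)) (\<phi> n t) / 2 - P t - 7/6 * \<bar>g\<bar> * R\<^sup>2 * q * \<rho> t ^ 3" for t
  define e' where "e' t = - (g * R ^ 4 * (5 * \<rho> t ^ 4 * \<rho>' t) * \<Gamma> (y t) - g * R ^ 3 * \<rho> t ^ 3 * \<rho>' t * inner (F (y t)) (\<phi> n t))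
     - 7/6 * \<bar>g\<bar> * R\<^sup>2 * q * (3 * \<rho> t ^ 2 * \<rho>' t)" for t
  have nq: "(norm (\<phi> n t))\<^sup>2 = q" if "t \<ge> 0" for t using norm_\<phi>[OF that] by (simp add: q_def)
  have ny: "norm (y t) = inverse (r t) * norm (\<phi> n t)" if "t \<ge> 0" for t
    using r_pos[OF that] by (simp add: y_def)
  have \<Gamma>y: "\<Gamma> (y t) \<le> q / (2 * R\<^sup>2 * \<rho> t ^ 2)" if "t \<ge> 0" for t
  proof -
    have "(norm (y t))\<^sup>2 = inverse ((r t)\<^sup>2) * q"
      by (simp only: ny[OF that] power_mult_distrib nq[OF that] power_inverse)
    then have "\<Gamma> (y t) \<le> inverse ((R * \<rho> t)\<^sup>2) * q / 2"
      using \<Gamma>_bounds(2)[of "y t"] by (simp only: r_def)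
    also have "\<dots> = q / (2 * R\<^sup>2 * \<rho> t ^ 2)" by (rule cancel_powers(6)) (use R_ge \<rho>_ge[OF that] in auto)
    finally show ?thesis .
  qed
  have PB: "\<bar>P t\<bar> \<le> \<bar>g\<bar> * R\<^sup>2 * q * \<rho> t ^ 3 / 2" if "t \<ge> 0" for t
  proof -
    have p: "\<rho> t > 0" "R > 0" using \<rho>_ge[OF that] R_ge by auto
    have "\<bar>P t\<bar> = \<bar>g\<bar> * R ^ 4 * \<rho> t ^ 5 * \<Gamma> (y t)" using p \<Gamma>_bounds(1)[of "y t"] by (simp add: P_def abs_mult)
    also have "\<dots> \<le> \<bar>g\<bar> * R ^ 4 * \<rho> t ^ 5 * (q / (2 * R\<^sup>2 * \<rho> t ^ 2))"
      using p by (intro mult_left_mono \<Gamma>y that) auto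
    also have "\<dots> = \<bar>g\<bar> * R\<^sup>2 * q * \<rho> t ^ 3 / 2" by (rule cancel_powers(1)[OF p(2,1)])
    finally show ?thesis .
  qed
  have ed: "(e has_real_derivative e' t) (at t within {0..})" if t: "t \<ge> 0" for t
  proof -
    have p: "\<rho> t > 0" "R > 0" "r t > 0" using \<rho>_ge[OF t] R_ge r_pos[OF t] by auto
    let ?f = "rhs n t (\<phi> n t)"
    have A: "((\<lambda>t. inner (A n (\<phi> n t)) (\<phi> n t)) has_real_derivative 2 * inner (A n (\<phi> n t)) ?f) (at t within {0..})"
    proof -
      have "((\<lambda>t. (norm (D n (\<phi> n t)))\<^sup>2) has_real_derivative 2 * inner (D n (\<phi> n t)) (D n ?f)) (at t within {0..})"
      proof (rule norm_sq_derivative)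
        show "((\<lambda>t. D n (\<phi> n t)) has_vector_derivative D n ?f) (at t within {0..})"
          by (rule bounded_linear.has_vector_derivative[OF bounded_linear_D]) (rule \<phi>_deriv[OF t])
      qed
      then show ?thesis by (simp only: norm_D_sq inner_A)
    qed
    have rd: "((\<lambda>t. inverse (r t)) has_real_derivative - (\<rho>' t / (R * \<rho> t ^ 2))) (at t within {0..})"
      unfolding r_def
      by (rule DERIV_cong[OF DERIV_inverse'[OF DERIV_cmult[OF \<rho>_deriv[OF t]]]])
         (use p in \<open>simp_all add: divide_simps power2_eq_square\<close>)
    have yd: "(y has_vector_derivative inverse (r t) *\<^sub>R ?f - (\<rho>' t / (R * \<rho> t ^ 2)) *\<^sub>R \<phi> n t) (at t within {0..})"
      unfolding y_def
      by (rule has_vector_derivative_eq_rhs[OF has_vector_derivative_scaleR[OF rd \<phi>_deriv[OF t]]]) simp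
    have "((\<lambda>t. \<Gamma> (y t)) has_derivative (\<lambda>h. inner (F (y t)) (h *\<^sub>R (inverse (r t) *\<^sub>R ?f - (\<rho>' t / (R * \<rho> t ^ 2)) *\<^sub>R \<phi> n t)))) (at t within {0..})"
      by (rule has_derivative_compose[OF yd[unfolded has_vector_derivative_def] \<Gamma>_derivative])
    then have \<Gamma>d: "((\<lambda>t. \<Gamma> (y t)) has_real_derivative
        (inverse (r t) * inner (F (y t)) ?f - \<rho>' t / (R * \<rho> t ^ 2) * inner (F (y t)) (\<phi> n t))) (at t within {0..})"
      unfolding has_field_derivative_def by (rule has_derivative_eq_rhs) (auto simp: inner_diff_right algebra_simps)
    have "(e has_real_derivative (2 * inner (A n (\<phi> n t)) ?f / 2 -
       (g * R ^ 4 * (5 * \<rho> t ^ 4 * \<rho>' t) * \<Gamma> (y t) + g * R ^ 4 * \<rho> t ^ 5 *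
         (inverse (r t) * inner (F (y t)) ?f - \<rho>' t / (R * \<rho> t ^ 2) * inner (F (y t)) (\<phi> n t))) -
         7/6 * \<bar>g\<bar> * R\<^sup>2 * q * (3 * \<rho> t ^ 2 * \<rho>' t))) (at t within {0..})"
    proof -
      have p5: "((\<lambda>t. \<rho> t ^ 5) has_real_derivative 5 * \<rho> t ^ 4 * \<rho>' t) (at t within {0..})"
        using DERIV_power[OF \<rho>_deriv[OF t], of 5] by (simp add: mult_ac)
      have p3: "((\<lambda>t. \<rho> t ^ 3) has_real_derivative 3 * \<rho> t ^ 2 * \<rho>' t) (at t within {0..})"
        using DERIV_power[OF \<rho>_deriv[OF t], of 3] by (simp add: mult_ac)
      show ?thesis
        unfolding e_def P_def
        by (rule DERIV_cong[OF DERIV_diff[OF DERIV_diff[OF DERIV_cdivide[OF A]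
              DERIV_mult[OF DERIV_cmult[OF p5] \<Gamma>d]] DERIV_cmult[OF p3]]])
           (simp only: add.commute mult.commute)
    qed
    moreover have "inner (A n (\<phi> n t)) ?f = g * R ^ 4 * \<rho> t ^ 5 * (inverse (r t) * inner (F (y t)) ?f)"
    proof -
      have "inner (A n (\<phi> n t) - N t (\<phi> n t)) ?f = 0" by (simp add: rhs_def cscale_minus_left)
      then have "inner (A n (\<phi> n t)) ?f = d t * inner (F (y t)) ?f"
        by (simp add: inner_diff_left N_def y_def)
      also have "d t = g * R ^ 4 * \<rho> t ^ 5 * inverse (r t)"
        unfolding d_def r_def by (rule cancel_powers(5)[OF p(2,1)])
      finally show ?thesis by simp
    qed
    moreover have "g * R ^ 4 * \<rho> t ^ 5 * (\<rho>' t / (R * \<rho> t ^ 2) * inner (F (y t)) (\<phi> n t)) = g * R ^ 3 * \<rho> t ^ 3 * \<rho>' t * inner (F (y t)) (\<phi> n t)"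
      by (rule cancel_powers(4)[OF p(2,1)])
    ultimately show ?thesis unfolding e'_def by (simp add: algebra_simps)
  qed
  have e'_le: "e' t \<le> 0" if t: "t \<ge> 0" for t
  proof -
    have p: "\<rho> t > 0" "R > 0" "r t > 0" "\<rho>' t \<ge> 0" using \<rho>_ge[OF t] R_ge r_pos[OF t] \<rho>'_ge[OF t] by auto
    have "\<bar>g * R ^ 4 * (5 * \<rho> t ^ 4 * \<rho>' t) * \<Gamma> (y t)\<bar> = \<bar>g\<bar> * R ^ 4 * (5 * \<rho> t ^ 4 * \<rho>' t) * \<Gamma> (y t)"
      using p \<Gamma>_bounds(1)[of "y t"] by (simp add: abs_mult)
    also have "\<dots> \<le> \<bar>g\<bar> * R ^ 4 * (5 * \<rho> t ^ 4 * \<rho>' t) * (q / (2 * R\<^sup>2 * \<rho> t ^ 2))"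
      using p by (intro mult_left_mono \<Gamma>y t) auto
    also have "\<dots> = 5/2 * (\<bar>g\<bar> * R\<^sup>2 * q * (\<rho> t ^ 2 * \<rho>' t))" by (rule cancel_powers(2)[OF p(2,1)])
    finally have 1: "\<bar>g * R ^ 4 * (5 * \<rho> t ^ 4 * \<rho>' t) * \<Gamma> (y t)\<bar> \<le> 5/2 * (\<bar>g\<bar> * R\<^sup>2 * q * (\<rho> t ^ 2 * \<rho>' t))" .
    have "\<bar>inner (F (y t)) (\<phi> n t)\<bar> \<le> norm (F (y t)) * norm (\<phi> n t)" by (rule Cauchy_Schwarz_ineq2)
    also have "\<dots> \<le> norm (y t) * norm (\<phi> n t)" by (intro mult_right_mono norm_F_le1) auto
    also have "\<dots> = q / (R * \<rho> t)" using ny[OF t] nq[OF t] by (simp add: r_def power2_eq_square divide_inverse)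
    finally have i: "\<bar>inner (F (y t)) (\<phi> n t)\<bar> \<le> q / (R * \<rho> t)" .
    have "\<bar>g * R ^ 3 * \<rho> t ^ 3 * \<rho>' t * inner (F (y t)) (\<phi> n t)\<bar> = \<bar>g\<bar> * R ^ 3 * \<rho> t ^ 3 * \<rho>' t * \<bar>inner (F (y t)) (\<phi> n t)\<bar>"
      using p by (simp add: abs_mult)
    also have "\<dots> \<le> \<bar>g\<bar> * R ^ 3 * \<rho> t ^ 3 * \<rho>' t * (q / (R * \<rho> t))"
      using p by (intro mult_left_mono i) auto
    also have "\<dots> = \<bar>g\<bar> * R\<^sup>2 * q * (\<rho> t ^ 2 * \<rho>' t)" by (rule cancel_powers(3)[OF p(2,1)])
    finally have 2: "\<bar>g * R ^ 3 * \<rho> t ^ 3 * \<rho>' t * inner (F (y t)) (\<phi> n t)\<bar> \<le> \<bar>g\<bar> * R\<^sup>2 * q * (\<rho> t ^ 2 * \<rho>' t)" .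
    have 3: "7/6 * \<bar>g\<bar> * R\<^sup>2 * q * (3 * \<rho> t ^ 2 * \<rho>' t) = 7/2 * (\<bar>g\<bar> * R\<^sup>2 * q * (\<rho> t ^ 2 * \<rho>' t))" by simp
    show ?thesis using 1 2 unfolding e'_def 3 by linarith
  qed
  have "e t \<le> e 0"
  proof (rule DERIV_nonpos_imp_decreasing_open[OF t])
    show "\<exists>y. (e has_real_derivative y) (at x) \<and> y \<le> 0" if "0 < x" "x < t" for x
      using ed[of x] e'_le[of x] at_within_interior[of x "{0..}"] that by auto
    have "continuous_on {0..} e" unfolding continuous_on_eq_continuous_within using ed DERIV_continuous by blast
    then show "continuous_on {0..t} e" by (rule continuous_on_subset) auto
  qed
  moreover have "inner (A n (\<phi> n t)) (\<phi> n t) / 2 = e t + P t + 7/6 * \<bar>g\<bar> * R\<^sup>2 * q * \<rho> t ^ 3" by (simp add: e_def)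
  moreover have "e 0 = inner (A n \<phi>0) \<phi>0 / 2 - P 0 - 7/6 * \<bar>g\<bar> * R\<^sup>2 * q * \<rho> 0 ^ 3" by (simp add: e_def)
  moreover have "0 \<le> \<bar>g\<bar> * R\<^sup>2 * q * \<rho> 0 ^ 3" using \<rho>_ge[of 0] q_nonneg by simp
  moreover have "0 \<le> \<bar>g\<bar> * R\<^sup>2 * q * \<rho> t ^ 3" using \<rho>_ge[OF t] q_nonneg by simp
  moreover have "inner (A n \<phi>0) \<phi>0 \<le> (norm (dx \<phi>0))\<^sup>2"
    unfolding norm_D_sq[symmetric] by (intro power_mono norm_D_\<phi>0) auto
  ultimately have "inner (A n (\<phi> n t)) (\<phi> n t) \<le> (norm (dx \<phi>0))\<^sup>2 + 5 * (\<bar>g\<bar> * R\<^sup>2 * q * \<rho> t ^ 3)"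
    using PB[of 0] PB[OF t] by linarith
  then show ?thesis by (simp add: norm_D_sq mult.assoc)
qed

end

section \<open>The limit\<close>

text \<open>
  From \<open>f a = f b - \<integral> f'\<close> over \<open>[a, b]\<close>: \<open>|f a|\<^sup>2 \<le> 2 |f b|\<^sup>2 + 2 l \<parallel>f'\<parallel>\<^sup>2\<close> for \<open>b\<close> in \<open>[a, a
  + l]\<close>. Average over \<open>b\<close>, and choose \<open>l\<close> close to \<open>\<parallel>f\<parallel> / \<parallel>f'\<parallel>\<close>.
\<close>

lemma sup_bound:
  assumes h: "h1 f"
  shows "AE x in lebesgue. (cmod (fn f x))\<^sup>2 \<le> 4 * norm f * norm (dx f)"
proof -
  obtain N where N: "negligible N" "\<And>a b. a \<notin> N \<Longrightarrow> b \<notin> N \<Longrightarrow> a < b \<Longrightarrow> fn f b - fn f a = integral {a..b} (fn (dx f))"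
    using weak_FTC[OF L2_fn L2_fn h1_imp_weak_deriv[OF h]] by metis
  have AN: "AE x in lebesgue. x \<notin> N" using N(1) by (intro AE_not_in) (simp add: negligible_iff_null_sets)
  define u v where "u = norm f" and "v = norm (dx f)"
  have uv: "u \<ge> 0" "v \<ge> 0" by (auto simp: u_def v_def)
  have key: "l * (cmod (fn f a))\<^sup>2 \<le> 2 * u\<^sup>2 + 2 * l\<^sup>2 * v\<^sup>2" if a: "a \<notin> N" and l: "l > 0" for a l
  proof -
    define S where "S = {a..a+l}"
    have sq: "(cmod (fn f a))\<^sup>2 \<le> 2 * (cmod (fn f b))\<^sup>2 + 2 * (l * v\<^sup>2)" if b: "b \<notin> N" "b \<in> S" "b \<noteq> a" for b
    proof -
      have ab: "a < b" "b \<le> a + l" using b by (auto simp: S_def)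
      have "(cmod (integral {a..a + (b - a)} (fn (dx f))))\<^sup>2 \<le> (b - a) * (\<integral>x. (cmod (fn (dx f) x))\<^sup>2 * indicator {a..a+(b-a)} x \<partial>lebesgue)"
        using ab by (intro integral_sq_le) auto
      also have "\<dots> \<le> l * v\<^sup>2"
      proof (rule mult_mono)
        have "integrable lebesgue (\<lambda>x. (cmod (fn (dx f) x))\<^sup>2 * indicator {a..a+(b-a)} x)"
          using integrable_mult_indicator[OF _ L2_integrable[OF L2_fn], of "{a..a+(b-a)}" "dx f"] by (simp add: mult.commute)
        then show "(\<integral>x. (cmod (fn (dx f) x))\<^sup>2 * indicator {a..a+(b-a)} x \<partial>lebesgue) \<le> v\<^sup>2"
          unfolding v_def norm_l2_sq by (rule integral_mono) (auto intro: L2_integrable simp: indicator_def)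
      qed (use ab l in \<open>auto intro!: Bochner_Integration.integral_nonneg\<close>)
      finally have 1: "(cmod (integral {a..b} (fn (dx f))))\<^sup>2 \<le> l * v\<^sup>2" by simp
      have "fn f a = fn f b + - integral {a..b} (fn (dx f))" using N(2)[OF a b(1) ab(1)] by (simp add: algebra_simps)
      then have "(cmod (fn f a))\<^sup>2 \<le> 2 * (cmod (fn f b))\<^sup>2 + 2 * (cmod (- integral {a..b} (fn (dx f))))\<^sup>2"
        using norm_add_sq_le by metis
      then show ?thesis using 1 by simp
    qed
    have Aa: "AE x in lebesgue. x \<notin> {a}"
      using negligible_finite[of "{a}"] by (intro AE_not_in) (simp add: negligible_iff_null_sets)
    have I1: "integrable lebesgue (\<lambda>b. indicator S b * (2 * (cmod (fn f b))\<^sup>2))"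
      using integrable_mult_indicator[OF _ integrable_mult_right[OF L2_integrable[OF L2_fn]], of S 2 f] by (simp add: S_def)
    have I2: "integrable lebesgue (\<lambda>b. indicator S b * (2 * (l * v\<^sup>2)))"
      by (intro integrable_mult_left integrable_real_indicator) (auto simp: S_def emeasure_lborel_Icc_eq)
    have "(\<integral>b. indicator S b * (cmod (fn f a))\<^sup>2 \<partial>lebesgue) \<le> (\<integral>b. indicator S b * (2 * (cmod (fn f b))\<^sup>2) + indicator S b * (2 * (l * v\<^sup>2)) \<partial>lebesgue)"
    proof (rule integral_mono_AE)
      show "integrable lebesgue (\<lambda>b. indicator S b * (cmod (fn f a))\<^sup>2)"
        by (intro integrable_mult_left integrable_real_indicator) (auto simp: S_def emeasure_lborel_Icc_eq)
      show "AE b in lebesgue. indicator S b * (cmod (fn f a))\<^sup>2 \<le> indicator S b * (2 * (cmod (fn f b))\<^sup>2) + indicator S b * (2 * (l * v\<^sup>2))"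
        using AN Aa by eventually_elim (use sq in \<open>auto simp: indicator_def\<close>)
    qed (intro Bochner_Integration.integrable_add I1 I2)
    also have "\<dots> = (\<integral>b. indicator S b * (2 * (cmod (fn f b))\<^sup>2) \<partial>lebesgue) + (\<integral>b. indicator S b * (2 * (l * v\<^sup>2)) \<partial>lebesgue)"
      by (rule Bochner_Integration.integral_add[OF I1 I2])
    also have "(\<integral>b. indicator S b * (2 * (l * v\<^sup>2)) \<partial>lebesgue) = l * (2 * (l * v\<^sup>2))"
      using l by (simp add: S_def measure_completion)
    also have "(\<integral>b. indicator S b * (2 * (cmod (fn f b))\<^sup>2) \<partial>lebesgue) \<le> (\<integral>b. 2 * (cmod (fn f b))\<^sup>2 \<partial>lebesgue)"
      by (rule integral_mono[OF I1]) (auto intro!: L2_integrable simp: indicator_def)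
    also have "\<dots> = 2 * u\<^sup>2" by (simp add: u_def norm_l2_sq)
    also have "(\<integral>b. indicator S b * (cmod (fn f a))\<^sup>2 \<partial>lebesgue) = l * (cmod (fn f a))\<^sup>2"
      using l by (simp add: S_def measure_completion)
    finally show ?thesis by (simp add: power2_eq_square mult_ac)
  qed
  have "(cmod (fn f a))\<^sup>2 \<le> 4 * u * v" if a: "a \<notin> N" for a
  proof (rule field_le_epsilon)
    fix e :: real assume e: "e > 0"
    define w where "w = (cmod (fn f a))\<^sup>2"
    have w: "l * w \<le> 2 * u\<^sup>2 + 2 * l\<^sup>2 * v\<^sup>2" if "l > 0" for l using key[OF a that] by (simp add: w_def)
    show "(cmod (fn f a))\<^sup>2 \<le> 4 * u * v + e"
    proof (cases "v = 0")
      case True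
      define l where "l = (2 * u\<^sup>2 + 1) / e"
      have l: "l > 0" using e by (simp add: l_def add_nonneg_pos)
      have "l * w \<le> l * e" using w[OF l] True e by (simp add: l_def)
      then have "w \<le> e" using l by simp
      then show ?thesis using True by (simp add: w_def)
    next
      case False
      \<comment> \<open>The optimal length \<open>u / v\<close>, made positive also for \<open>u = 0\<close>.\<close>
      define l where "l = (u + e / (4 * v)) / v"
      have v: "v > 0" using False uv by simp
      have l: "l > 0" using v uv e by (simp add: l_def add_nonneg_pos)
      have lv: "l * v = u + e / (4 * v)" using v by (simp add: l_def)
      have ul: "u \<le> l * v" unfolding lv using e v by simp
      have "l * w \<le> 2 * (l * v)\<^sup>2 + 2 * l\<^sup>2 * v\<^sup>2"
        using w[OF l] power_mono[OF ul uv(1), of 2] by simp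
      also have "\<dots> = l * (4 * v * (l * v))" by (simp add: power2_eq_square algebra_simps)
      finally have "w \<le> 4 * v * (l * v)" using l by simp
      also have "\<dots> = 4 * u * v + e" unfolding lv using v by (simp add: field_simps)
      finally show ?thesis by (simp add: w_def)
    qed
  qed
  then show ?thesis using AN unfolding u_def v_def by (auto elim: eventually_mono)
qed

lemma collect_terms:
  fixes a b c d h j l m p v x y :: real
  shows "(a * b + a * (v * x)) + j * x * p = a * b + (a * v + j * p) * x"
    and "(a + b + c) * h + d + (l + m) * h = ((b + m) + (a + c + l)) * h + d"
    and "(x - a * c) - (y - b * c) = (x - y) - (a - b) * c"
  by (simp_all add: algebra_simps)

lemma norm_diff3:
  fixes a b c d :: "'a::real_normed_vector"
  assumes "norm (a - b) \<le> x" "norm (b - c) \<le> y" "norm (c - d) \<le> z"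
  shows "norm (a - d) \<le> x + y + z"
proof -
  have "a - d = ((a - b) + (b - c)) + (c - d)" by simp
  then show ?thesis using norm_triangle_mono[OF norm_triangle_mono[OF assms(1,2)] assms(3)] by simp
qed

lemma norm_mi: "norm (cscale (-\<i>) f) = norm f" by simp

context nls begin

definition \<Phi> :: "real \<Rightarrow> l2" where "\<Phi> t = lim (\<lambda>n. \<phi> n t)"

lemma sqrt_half: "0 \<le> sqrt (1/2)" "sqrt (1/2) < (1::real)" by (auto simp: real_less_lsqrt)

lemma \<phi>_converges:
  assumes T: "T \<ge> 0"
  obtains e where "e \<longlonglongrightarrow> 0" "\<And>n t. 0 \<le> t \<Longrightarrow> t \<le> T \<Longrightarrow> norm (\<phi> n t - \<Phi> t) \<le> e n"
proof -
  obtain M where M: "M \<ge> 0" "\<And>n t. 0 \<le> t \<Longrightarrow> t \<le> T \<Longrightarrow> norm (\<phi> (Suc n) t - \<phi> n t) \<le> M * sqrt (1/2) ^ n"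
    using consecutive_bound[OF T] by metis
  show thesis
  proof (rule that[of "\<lambda>n. M * sqrt (1/2) ^ n / (1 - sqrt (1/2))"])
    have "(\<lambda>n. M * sqrt (1/2) ^ n / (1 - sqrt (1/2))) \<longlonglongrightarrow> M * 0 / (1 - sqrt (1/2))"
      using sqrt_half by (intro tendsto_divide tendsto_mult tendsto_const LIMSEQ_realpow_zero) auto
    then show "(\<lambda>n. M * sqrt (1/2) ^ n / (1 - sqrt (1/2))) \<longlonglongrightarrow> 0" by simp
    show "norm (\<phi> n t - \<Phi> t) \<le> M * sqrt (1/2) ^ n / (1 - sqrt (1/2))" if "0 \<le> t" "t \<le> T" for n t
      unfolding \<Phi>_def by (rule geometric_limit(2)[OF M(2)[OF that] sqrt_half])
  qed
qed

lemma \<Phi>_lim: assumes "t \<ge> 0" shows "(\<lambda>n. \<phi> n t) \<longlonglongrightarrow> \<Phi> t"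
proof -
  obtain e where e: "e \<longlonglongrightarrow> 0" "\<And>n s. 0 \<le> s \<Longrightarrow> s \<le> t \<Longrightarrow> norm (\<phi> n s - \<Phi> s) \<le> e n"
    using \<phi>_converges[OF assms] by metis
  show ?thesis by (rule LIM_zero_cancel, rule Lim_null_comparison[OF _ e(1)]) (use e(2)[of t] assms in simp)
qed

lemma \<Phi>_0: "\<Phi> 0 = \<phi>0"
  using LIMSEQ_unique[OF \<Phi>_lim[of 0]] by simp

lemma norm_\<Phi>: assumes "t \<ge> 0" shows "norm (\<Phi> t) = norm \<phi>0"
  using LIMSEQ_unique[OF tendsto_norm[OF \<Phi>_lim[OF assms]]] norm_\<phi>[OF assms] by simp

lemma A_\<Phi>_bound:
  assumes T: "T \<ge> 0"
  obtains C where "C \<ge> 0" "\<And>n t. 0 \<le> t \<Longrightarrow> t \<le> T \<Longrightarrow> norm (A n (\<Phi> t)) \<le> C" "\<And>n t. 0 \<le> t \<Longrightarrow> t \<le> T \<Longrightarrow> norm (A n (\<phi> n t)) \<le> C"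
proof -
  obtain C where C: "C \<ge> 0" "\<And>n t. 0 \<le> t \<Longrightarrow> t \<le> T \<Longrightarrow> norm (A n (\<phi> n t)) \<le> C"
    using A_bound[OF T] by metis
  have "norm (A n (\<Phi> t)) \<le> C" if t: "0 \<le> t" "t \<le> T" for n t
  proof (rule tendsto_upperbound)
    show "(\<lambda>m. norm (A n (\<phi> m t))) \<longlonglongrightarrow> norm (A n (\<Phi> t))"
      by (intro tendsto_norm bounded_linear.tendsto[OF bounded_linear_A] \<Phi>_lim t)
    show "\<forall>\<^sub>F m in sequentially. norm (A n (\<phi> m t)) \<le> C"
      using eventually_ge_at_top[of n] by eventually_elim (use norm_A_mono C(2)[OF t] in \<open>blast intro: order_trans\<close>)
  qed simp
  then show thesis by (rule that[OF C(1) _ C(2)])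
qed

lemma h1_\<Phi>: assumes "t \<ge> 0" shows "h1 (\<Phi> t)"
proof -
  obtain C where "\<And>n s. 0 \<le> s \<Longrightarrow> s \<le> t \<Longrightarrow> norm (A n (\<Phi> s)) \<le> C"
    using A_\<Phi>_bound[OF assms] by metis
  from h1_of_bounded_A(1)[OF this[OF assms order_refl]] show ?thesis .
qed

lemma dx_\<Phi>_bound: assumes t: "t \<ge> 0"
  shows "(norm (dx (\<Phi> t)))\<^sup>2 \<le> (norm (dx \<phi>0))\<^sup>2 + 5 * \<bar>g\<bar> * R\<^sup>2 * q * \<rho> t ^ 3"
proof (rule tendsto_upperbound)
  show "(\<lambda>n. (norm (D n (\<Phi> t)))\<^sup>2) \<longlonglongrightarrow> (norm (dx (\<Phi> t)))\<^sup>2"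
    using h1_\<Phi>[OF t] unfolding h1_iff by (intro tendsto_power tendsto_norm)
  have "(norm (D n (\<Phi> t)))\<^sup>2 \<le> (norm (dx \<phi>0))\<^sup>2 + 5 * \<bar>g\<bar> * R\<^sup>2 * q * \<rho> t ^ 3" for n
  proof (rule tendsto_upperbound)
    show "(\<lambda>m. (norm (D n (\<phi> m t)))\<^sup>2) \<longlonglongrightarrow> (norm (D n (\<Phi> t)))\<^sup>2"
      by (intro tendsto_power tendsto_norm bounded_linear.tendsto[OF bounded_linear_D] \<Phi>_lim t)
    show "\<forall>\<^sub>F m in sequentially. (norm (D n (\<phi> m t)))\<^sup>2 \<le> (norm (dx \<phi>0))\<^sup>2 + 5 * \<bar>g\<bar> * R\<^sup>2 * q * \<rho> t ^ 3"
      using eventually_ge_at_top[of n]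
    proof eventually_elim
      case (elim m)
      have "(norm (D n (\<phi> m t)))\<^sup>2 \<le> (norm (D m (\<phi> m t)))\<^sup>2" by (intro power_mono norm_D_mono elim) auto
      then show ?case using energy_bound[OF t, of m] by linarith
    qed
  qed simp
  then show "\<forall>\<^sub>F n in sequentially. (norm (D n (\<Phi> t)))\<^sup>2 \<le> (norm (dx \<phi>0))\<^sup>2 + 5 * \<bar>g\<bar> * R\<^sup>2 * q * \<rho> t ^ 3" by simp
qed simp

lemma \<Phi>_lipschitz:
  assumes T: "T \<ge> 0"
  obtains V where "V \<ge> 0" "\<And>s t. 0 \<le> s \<Longrightarrow> s \<le> T \<Longrightarrow> 0 \<le> t \<Longrightarrow> t \<le> T \<Longrightarrow> norm (\<Phi> s - \<Phi> t) \<le> V * \<bar>s - t\<bar>"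
proof -
  obtain V where V: "V \<ge> 0" "\<And>n t. 0 \<le> t \<Longrightarrow> t \<le> T \<Longrightarrow> norm (rhs n t (\<phi> n t)) \<le> V"
    using velocity_bound[OF T] by metis
  show thesis
  proof (rule that[OF V(1)])
    fix s t :: real assume st: "0 \<le> s" "s \<le> T" "0 \<le> t" "t \<le> T"
    show "norm (\<Phi> s - \<Phi> t) \<le> V * \<bar>s - t\<bar>"
    proof (rule tendsto_upperbound)
      show "(\<lambda>n. norm (\<phi> n s - \<phi> n t)) \<longlonglongrightarrow> norm (\<Phi> s - \<Phi> t)"
        by (intro tendsto_norm tendsto_diff \<Phi>_lim st)
      have "norm (\<phi> n s - \<phi> n t) \<le> V * norm (s - t)" for n
      proof (rule differentiable_bound[of "{0..T}" "\<phi> n" "\<lambda>t h. h *\<^sub>R rhs n t (\<phi> n t)"])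
        show "(\<phi> n has_derivative (\<lambda>h. h *\<^sub>R rhs n x (\<phi> n x))) (at x within {0..T})" if "x \<in> {0..T}" for x
          using \<phi>_deriv_T[of x n T] that by (simp add: has_vector_derivative_def)
        show "onorm (\<lambda>h. h *\<^sub>R rhs n x (\<phi> n x)) \<le> V" if "x \<in> {0..T}" for x
          using that V(1) V(2)[of x n] by (intro onorm_bound) (auto simp: mult.commute[of V] intro: mult_left_mono)
      qed (use st in auto)
      then show "\<forall>\<^sub>F n in sequentially. norm (\<phi> n s - \<phi> n t) \<le> V * \<bar>s - t\<bar>" by simp
    qed simp
  qed
qed

text \<open>
  Interpolation: \<open>\<parallel>D n f\<parallel>\<^sup>2 = \<langle>A n f, f\<rangle>\<close>. It turns Lipschitz continuity in \<open>L\<^sup>2\<close> into Hoelder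
  continuity of the derivative.
\<close>

lemma dx_diff_le:
  assumes "\<And>n. norm (A n f) \<le> C" shows "norm (dx f) \<le> sqrt (C * norm f)"
proof (rule real_le_rsqrt, rule tendsto_upperbound)
  show "(\<lambda>n. (norm (D n f))\<^sup>2) \<longlonglongrightarrow> (norm (dx f))\<^sup>2"
    using h1_of_bounded_A(1)[OF assms] unfolding h1_iff by (intro tendsto_power tendsto_norm)
  show "\<forall>\<^sub>F n in sequentially. (norm (D n f))\<^sup>2 \<le> C * norm f"
    using norm_D_sq_le mult_right_mono[OF assms norm_ge_zero] by (intro always_eventually) (blast intro: order_trans)
qed simp

lemma dx_\<Phi>_modulus:
  assumes T: "T \<ge> 0"
  obtains K where "K \<ge> 0" "\<And>s t. 0 \<le> s \<Longrightarrow> s \<le> T \<Longrightarrow> 0 \<le> t \<Longrightarrow> t \<le> T \<Longrightarrow> norm (dx (\<Phi> s) - dx (\<Phi> t)) \<le> sqrt (K * \<bar>s - t\<bar>)"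
proof -
  obtain C where C: "C \<ge> 0" "\<And>n t. 0 \<le> t \<Longrightarrow> t \<le> T \<Longrightarrow> norm (A n (\<Phi> t)) \<le> C"
    using A_\<Phi>_bound[OF T] by metis
  obtain V where V: "V \<ge> 0" "\<And>s t. 0 \<le> s \<Longrightarrow> s \<le> T \<Longrightarrow> 0 \<le> t \<Longrightarrow> t \<le> T \<Longrightarrow> norm (\<Phi> s - \<Phi> t) \<le> V * \<bar>s - t\<bar>"
    using \<Phi>_lipschitz[OF T] by metis
  show thesis
  proof (rule that[of "2 * C * V"])
    fix s t :: real assume st: "0 \<le> s" "s \<le> T" "0 \<le> t" "t \<le> T"
    have "norm (A n (\<Phi> s - \<Phi> t)) \<le> 2 * C" for n
      unfolding A_diff using norm_triangle_ineq4[of "A n (\<Phi> s)" "A n (\<Phi> t)"] C(2)[of s n] C(2)[of t n] st by linarith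
    from dx_diff_le[OF this] have "norm (dx (\<Phi> s - \<Phi> t)) \<le> sqrt (2 * C * norm (\<Phi> s - \<Phi> t))" .
    also have "\<dots> \<le> sqrt (2 * C * (V * \<bar>s - t\<bar>))"
      using C(1) V(2)[OF st] by (intro real_sqrt_le_mono mult_left_mono) auto
    finally show "norm (dx (\<Phi> s) - dx (\<Phi> t)) \<le> sqrt (2 * C * V * \<bar>s - t\<bar>)"
      using h1_diff[OF h1_\<Phi>[OF st(1)] h1_\<Phi>[OF st(3)]] by (simp add: mult.assoc)
  qed (use C V in simp)
qed

text \<open>
  The functional \<open>- i (- \<Phi>\<^sub>x\<^sub>x - N t \<Phi>)\<close> on \<open>H\<^sup>1\<close>, which is going to be the time derivative.
\<close>

definition \<Lambda> :: "real \<Rightarrow> l2 \<Rightarrow> complex" where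
  "\<Lambda> t \<eta> = - \<i> * (pair (dx (\<Phi> t)) (dx \<eta>) - pair (N t (\<Phi> t)) \<eta>)"

lemma Re_\<Lambda>: "h1 \<eta> \<Longrightarrow> Re (\<Lambda> t (conjug \<eta>)) = inner (cscale (-\<i>) (dx (\<Phi> t))) (dx \<eta>) - inner (cscale (-\<i>) (N t (\<Phi> t))) \<eta>"
  using Re_pair[of "cscale (-\<i>) (dx (\<Phi> t))" "conjug (dx \<eta>)"] Re_pair[of "cscale (-\<i>) (N t (\<Phi> t))" "conjug \<eta>"]
  by (simp add: \<Lambda>_def h1_conjug pair_cscale_left algebra_simps)

text \<open>
  The mean value inequality for \<open>\<phi> n\<close>, tested with \<open>\<eta>\<close>, passes to the limit. It needs that \<open>D
  n (\<phi> n r)\<close> is close to the derivative of \<open>\<Phi> t\<close>, uniformly for \<open>r\<close> near \<open>t\<close>: this is split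
  into the approximation error at time \<open>r\<close>, the modulus of continuity of the derivative, and
  the convergence of the quotients at time \<open>t\<close>. The bound depends on \<open>\<eta>\<close> only through its norm
  in \<open>H\<^sup>1\<close>, as the dual norm demands.
\<close>

lemma increment_estimate:
  assumes T: "T \<ge> 0"
  obtains \<omega> where "continuous_on {0..} \<omega>" "\<omega> 0 = 0"
    "\<And>s t \<eta>. 0 \<le> s \<Longrightarrow> s \<le> T \<Longrightarrow> 0 \<le> t \<Longrightarrow> t \<le> T \<Longrightarrow> h1 \<eta> \<Longrightarrow>
      \<bar>inner (\<Phi> s - \<Phi> t) \<eta> - (s - t) * Re (\<Lambda> t (conjug \<eta>))\<bar> \<le> \<bar>s - t\<bar> * (\<omega> \<bar>s - t\<bar> * h1_norm \<eta>)"
proof -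
  obtain C where C: "C \<ge> 0" "\<And>n t. 0 \<le> t \<Longrightarrow> t \<le> T \<Longrightarrow> norm (A n (\<Phi> t)) \<le> C"
    "\<And>n t. 0 \<le> t \<Longrightarrow> t \<le> T \<Longrightarrow> norm (A n (\<phi> n t)) \<le> C"
    using A_\<Phi>_bound[OF T] by metis
  obtain V where V: "V \<ge> 0" "\<And>s t. 0 \<le> s \<Longrightarrow> s \<le> T \<Longrightarrow> 0 \<le> t \<Longrightarrow> t \<le> T \<Longrightarrow> norm (\<Phi> s - \<Phi> t) \<le> V * \<bar>s - t\<bar>"
    using \<Phi>_lipschitz[OF T] by metis
  obtain K where K: "K \<ge> 0" "\<And>s t. 0 \<le> s \<Longrightarrow> s \<le> T \<Longrightarrow> 0 \<le> t \<Longrightarrow> t \<le> T \<Longrightarrow> norm (dx (\<Phi> s) - dx (\<Phi> t)) \<le> sqrt (K * \<bar>s - t\<bar>)"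
    using dx_\<Phi>_modulus[OF T] by metis
  obtain J where J: "J \<ge> 0" "\<And>s t f. 0 \<le> s \<Longrightarrow> s \<le> T \<Longrightarrow> 0 \<le> t \<Longrightarrow> t \<le> T \<Longrightarrow> norm (N s f - N t f) \<le> J * \<bar>s - t\<bar> * norm f"
    using N_time_lipschitz[of T] by metis
  obtain e where e: "e \<longlonglongrightarrow> 0" "\<And>n t. 0 \<le> t \<Longrightarrow> t \<le> T \<Longrightarrow> norm (\<phi> n t - \<Phi> t) \<le> e n"
    using \<phi>_converges[OF T] by metis
  define \<omega> where "\<omega> \<tau> = sqrt (K * \<tau>) + (L T * V + J * norm \<phi>0) * \<tau>" for \<tau>
  define E where "E n = sqrt (2 * C * e n) + C * mesh n + L T * e n" for n
  have E0: "E \<longlonglongrightarrow> 0"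
  proof -
    have "E \<longlonglongrightarrow> sqrt (2 * C * 0) + C * 0 + L T * 0"
      unfolding E_def by (intro tendsto_intros e(1) mesh_tendsto)
    then show ?thesis by simp
  qed
  show thesis
  proof (rule that[of \<omega>])
    show "continuous_on {0..} \<omega>" unfolding \<omega>_def by (intro continuous_intros)
    show "\<omega> 0 = 0" by (simp add: \<omega>_def)
    fix s t \<eta> assume st: "0 \<le> s" "s \<le> T" "0 \<le> t" "t \<le> T" and \<eta>: "h1 \<eta>"
    define c0 where "c0 = Re (\<Lambda> t (conjug \<eta>))"
    define \<tau> where "\<tau> = \<bar>s - t\<bar>"
    define B where "B n = (\<omega> \<tau> + E n) * h1_norm \<eta> + norm (dx (\<Phi> t)) * norm (D n \<eta> - dx \<eta>)" for n
    have step: "\<bar>inner (rhs n r (\<phi> n r)) \<eta> - c0\<bar> \<le> B n" if r: "0 \<le> r" "r \<le> T" "\<bar>r - t\<bar> \<le> \<tau>" for n r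
    proof -
      have \<omega>r: "sqrt (K * \<bar>r - t\<bar>) + (L T * V + J * norm \<phi>0) * \<bar>r - t\<bar> \<le> \<omega> \<tau>"
        unfolding \<omega>_def using r(3) K(1) L_nonneg[OF T] V(1) J(1)
        by (intro add_mono real_sqrt_le_mono mult_left_mono) auto
      have "inner (rhs n r (\<phi> n r)) \<eta> = inner (cscale (-\<i>) (D n (\<phi> n r))) (D n \<eta>) - inner (cscale (-\<i>) (N r (\<phi> n r))) \<eta>"
        by (simp add: rhs_def cscale_diff inner_diff_left A_cscale[symmetric] inner_A D_cscale)
      then have split: "inner (rhs n r (\<phi> n r)) \<eta> - c0 =
          inner (cscale (-\<i>) (D n (\<phi> n r) - dx (\<Phi> t))) (D n \<eta>) + inner (cscale (-\<i>) (dx (\<Phi> t))) (D n \<eta> - dx \<eta>)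
          - inner (cscale (-\<i>) (N r (\<phi> n r) - N t (\<Phi> t))) \<eta>"
        unfolding c0_def Re_\<Lambda>[OF \<eta>] by (simp add: cscale_diff inner_diff_left inner_diff_right)
      have 1: "norm (D n (\<phi> n r) - dx (\<Phi> t)) \<le> sqrt (2 * C * e n) + sqrt (K * \<bar>r - t\<bar>) + C * mesh n"
      proof -
        have a: "norm (D n (\<phi> n r) - D n (\<Phi> r)) \<le> sqrt (2 * C * e n)"
        proof (rule real_le_rsqrt)
          have "(norm (D n (\<phi> n r - \<Phi> r)))\<^sup>2 \<le> norm (A n (\<phi> n r - \<Phi> r)) * norm (\<phi> n r - \<Phi> r)" by (rule norm_D_sq_le)
          also have "\<dots> \<le> (2 * C) * e n"
          proof (rule mult_mono)
            show "norm (A n (\<phi> n r - \<Phi> r)) \<le> 2 * C"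
              unfolding A_diff using norm_triangle_ineq4[of "A n (\<phi> n r)" "A n (\<Phi> r)"] C(2)[OF r(1,2), of n] C(3)[OF r(1,2), of n] by linarith
            show "norm (\<phi> n r - \<Phi> r) \<le> e n" by (rule e(2)[OF r(1,2)])
          qed (use C in auto)
          finally show "(norm (D n (\<phi> n r) - D n (\<Phi> r)))\<^sup>2 \<le> 2 * C * e n" by (simp add: D_diff)
        qed
        have b: "norm (D n (\<Phi> r) - D n (\<Phi> t)) \<le> sqrt (K * \<bar>r - t\<bar>)"
          using norm_D_le_dx[OF h1_diff(1)[OF h1_\<Phi>[OF r(1)] h1_\<Phi>[OF st(3)]], of n] K(2)[OF r(1,2) st(3,4)]
          by (simp add: D_diff h1_diff(2)[OF h1_\<Phi>[OF r(1)] h1_\<Phi>[OF st(3)]])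
        have c: "norm (D n (\<Phi> t) - dx (\<Phi> t)) \<le> C * mesh n"
          by (rule h1_of_bounded_A(2)[OF C(2)[OF st(3,4)]])
        show ?thesis by (rule norm_diff3[OF a b c])
      qed
      have 2: "norm (N r (\<phi> n r) - N t (\<Phi> t)) \<le> L T * e n + (L T * V + J * norm \<phi>0) * \<bar>r - t\<bar>"
      proof -
        have a: "norm (N r (\<phi> n r) - N r (\<Phi> r)) \<le> L T * e n"
          by (rule order_trans[OF N_lip_T[OF r(1,2)] mult_left_mono[OF e(2)[OF r(1,2)] L_nonneg[OF T]]])
        have b: "norm (N r (\<Phi> r) - N r (\<Phi> t)) \<le> L T * (V * \<bar>r - t\<bar>)"
          by (rule order_trans[OF N_lip_T[OF r(1,2)] mult_left_mono[OF V(2)[OF r(1,2) st(3,4)] L_nonneg[OF T]]])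
        have c: "norm (N r (\<Phi> t) - N t (\<Phi> t)) \<le> J * \<bar>r - t\<bar> * norm \<phi>0"
          using J(2)[OF r(1,2) st(3,4), of "\<Phi> t"] norm_\<Phi>[OF st(3)] by simp
        show ?thesis using norm_diff3[OF a b c] unfolding collect_terms(1) .
      qed
      have i1: "\<bar>inner (cscale (-\<i>) (D n (\<phi> n r) - dx (\<Phi> t))) (D n \<eta>)\<bar> \<le> (sqrt (2 * C * e n) + sqrt (K * \<bar>r - t\<bar>) + C * mesh n) * h1_norm \<eta>"
      proof -
        have "\<bar>inner (cscale (-\<i>) (D n (\<phi> n r) - dx (\<Phi> t))) (D n \<eta>)\<bar> \<le> norm (cscale (-\<i>) (D n (\<phi> n r) - dx (\<Phi> t))) * norm (D n \<eta>)"
          by (rule Cauchy_Schwarz_ineq2)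
        also have "\<dots> \<le> (sqrt (2 * C * e n) + sqrt (K * \<bar>r - t\<bar>) + C * mesh n) * h1_norm \<eta>"
          unfolding norm_mi
          by (rule mult_mono[OF 1 order_trans[OF norm_D_le_dx[OF \<eta>] norm_le_h1_norm(2)] order_trans[OF norm_ge_zero 1] norm_ge_zero])
        finally show ?thesis .
      qed
      have i2: "\<bar>inner (cscale (-\<i>) (dx (\<Phi> t))) (D n \<eta> - dx \<eta>)\<bar> \<le> norm (dx (\<Phi> t)) * norm (D n \<eta> - dx \<eta>)"
        using Cauchy_Schwarz_ineq2[of "cscale (-\<i>) (dx (\<Phi> t))" "D n \<eta> - dx \<eta>"] unfolding norm_mi .
      have i3: "\<bar>inner (cscale (-\<i>) (N r (\<phi> n r) - N t (\<Phi> t))) \<eta>\<bar> \<le> (L T * e n + (L T * V + J * norm \<phi>0) * \<bar>r - t\<bar>) * h1_norm \<eta>"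
      proof -
        have "\<bar>inner (cscale (-\<i>) (N r (\<phi> n r) - N t (\<Phi> t))) \<eta>\<bar> \<le> norm (cscale (-\<i>) (N r (\<phi> n r) - N t (\<Phi> t))) * norm \<eta>"
          by (rule Cauchy_Schwarz_ineq2)
        also have "\<dots> \<le> (L T * e n + (L T * V + J * norm \<phi>0) * \<bar>r - t\<bar>) * h1_norm \<eta>"
          unfolding norm_mi
          by (rule mult_mono[OF 2 norm_le_h1_norm(1) order_trans[OF norm_ge_zero 2] norm_ge_zero])
        finally show ?thesis .
      qed
      have "\<bar>inner (rhs n r (\<phi> n r)) \<eta> - c0\<bar> \<le> (sqrt (2 * C * e n) + sqrt (K * \<bar>r - t\<bar>) + C * mesh n) * h1_norm \<eta>
          + norm (dx (\<Phi> t)) * norm (D n \<eta> - dx \<eta>) + (L T * e n + (L T * V + J * norm \<phi>0) * \<bar>r - t\<bar>) * h1_norm \<eta>"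
        unfolding split using i1 i2 i3 by linarith
      also have "\<dots> = ((sqrt (K * \<bar>r - t\<bar>) + (L T * V + J * norm \<phi>0) * \<bar>r - t\<bar>) + E n) * h1_norm \<eta> + norm (dx (\<Phi> t)) * norm (D n \<eta> - dx \<eta>)"
        unfolding E_def by (rule collect_terms(2))
      also have "\<dots> \<le> B n"
        unfolding B_def by (intro add_right_mono mult_right_mono \<omega>r h1_norm_nonneg)
      finally show ?thesis .
    qed
    have mv: "\<bar>inner (\<phi> n s - \<phi> n t) \<eta> - (s - t) * c0\<bar> \<le> B n * \<tau>" for n
    proof -
      define S where "S = {min s t..max s t}"
      have "norm ((inner (\<phi> n s) \<eta> - s * c0) - (inner (\<phi> n t) \<eta> - t * c0)) \<le> B n * norm (s - t)"
      proof (rule field_differentiable_bound[of S "\<lambda>r. inner (\<phi> n r) \<eta> - r * c0" "\<lambda>r. inner (rhs n r (\<phi> n r)) \<eta> - c0"])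
        fix r assume r: "r \<in> S"
        have r': "0 \<le> r" "r \<le> T" "\<bar>r - t\<bar> \<le> \<tau>" using r st by (auto simp: S_def \<tau>_def min_def max_def split: if_splits)
        have "((\<lambda>r. inner (\<phi> n r) \<eta>) has_vector_derivative inner (rhs n r (\<phi> n r)) \<eta>) (at r within S)"
          by (rule bounded_linear.has_vector_derivative[OF bounded_linear_inner_left has_vector_derivative_within_subset[OF \<phi>_deriv[OF r'(1)]]])
             (use st in \<open>auto simp: S_def\<close>)
        then show "((\<lambda>r. inner (\<phi> n r) \<eta> - r * c0) has_field_derivative inner (rhs n r (\<phi> n r)) \<eta> - c0) (at r within S)"
          by (auto intro!: derivative_eq_intros simp: has_real_derivative_iff_has_vector_derivative[symmetric])
        show "norm (inner (rhs n r (\<phi> n r)) \<eta> - c0) \<le> B n" using step[OF r'] by simp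
      qed (auto simp: S_def)
      then show ?thesis unfolding collect_terms(3) inner_diff_left \<tau>_def real_norm_def .
    qed
    have l1: "(\<lambda>n. B n * \<tau>) \<longlonglongrightarrow> ((\<omega> \<tau> + 0) * h1_norm \<eta> + norm (dx (\<Phi> t)) * 0) * \<tau>"
      unfolding B_def using \<eta> unfolding h1_iff
      by (intro tendsto_mult tendsto_add tendsto_const E0 tendsto_norm_zero LIM_zero)
    have l2: "(\<lambda>n. \<bar>inner (\<phi> n s - \<phi> n t) \<eta> - (s - t) * c0\<bar>) \<longlonglongrightarrow> \<bar>inner (\<Phi> s - \<Phi> t) \<eta> - (s - t) * c0\<bar>"
      by (intro tendsto_rabs tendsto_diff tendsto_inner tendsto_const \<Phi>_lim st)
    have "\<bar>inner (\<Phi> s - \<Phi> t) \<eta> - (s - t) * c0\<bar> \<le> ((\<omega> \<tau> + 0) * h1_norm \<eta> + norm (dx (\<Phi> t)) * 0) * \<tau>"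
      by (rule LIMSEQ_le[OF l2 l1]) (use mv in blast)
    then show "\<bar>inner (\<Phi> s - \<Phi> t) \<eta> - (s - t) * Re (\<Lambda> t (conjug \<eta>))\<bar> \<le> \<bar>s - t\<bar> * (\<omega> \<bar>s - t\<bar> * h1_norm \<eta>)"
      by (simp add: c0_def \<tau>_def mult.commute)
  qed
qed

end

section \<open>The solution for all times\<close>

lemma F_conjug: "F (conjug f) = conjug (F f)"
  by (rule l2_eqI) (use fn_F[of "conjug f"] fn_conjug[of f] fn_F[of f] fn_conjug[of "F f"] in \<open>eventually_elim, simp add: Fc_def\<close>)

context nls begin

lemma N_conjug: "N t (conjug f) = conjug (N t f)"
  by (simp add: N_def F_conjug conjug_scaleR[symmetric])

text \<open>
  A complex functional is controlled by its real parts, since \<open>\<eta>\<close> may be multiplied by a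
  unimodular constant.
\<close>

lemma complex_increment:
  assumes T: "T \<ge> 0"
  obtains \<omega> where "continuous_on {0..} \<omega>" "\<omega> 0 = 0"
    "\<And>s t \<eta>. 0 \<le> s \<Longrightarrow> s \<le> T \<Longrightarrow> 0 \<le> t \<Longrightarrow> t \<le> T \<Longrightarrow> h1 \<eta> \<Longrightarrow>
      cmod (pair (\<Phi> s - \<Phi> t) \<eta> - of_real (s - t) * \<Lambda> t \<eta>) \<le> \<bar>s - t\<bar> * (\<omega> \<bar>s - t\<bar> * h1_norm \<eta>)"
proof -
  obtain \<omega> where \<omega>: "continuous_on {0..} \<omega>" "\<omega> 0 = 0"
    "\<And>s t \<eta>. 0 \<le> s \<Longrightarrow> s \<le> T \<Longrightarrow> 0 \<le> t \<Longrightarrow> t \<le> T \<Longrightarrow> h1 \<eta> \<Longrightarrow>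
      \<bar>inner (\<Phi> s - \<Phi> t) \<eta> - (s - t) * Re (\<Lambda> t (conjug \<eta>))\<bar> \<le> \<bar>s - t\<bar> * (\<omega> \<bar>s - t\<bar> * h1_norm \<eta>)"
    using increment_estimate[OF T] by metis
  show thesis
  proof (rule that[OF \<omega>(1,2)])
    fix s t \<eta> assume st: "0 \<le> s" "s \<le> T" "0 \<le> t" "t \<le> T" and \<eta>: "h1 \<eta>"
    define X where "X \<eta> = pair (\<Phi> s - \<Phi> t) \<eta> - of_real (s - t) * \<Lambda> t \<eta>" for \<eta>
    have re: "\<bar>Re (X \<eta>)\<bar> \<le> \<bar>s - t\<bar> * (\<omega> \<bar>s - t\<bar> * h1_norm \<eta>)" if "h1 \<eta>" for \<eta>
      using \<omega>(3)[OF st h1_conjug(1)[OF that]] that by (simp add: X_def Re_pair h1_norm_conjug del: of_real_diff)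
    have lin: "X (cscale c \<eta>) = c * X \<eta>" for c
      using \<eta> by (simp add: X_def \<Lambda>_def pair_cscale_right h1_cscale algebra_simps)
    show "cmod (pair (\<Phi> s - \<Phi> t) \<eta> - of_real (s - t) * \<Lambda> t \<eta>) \<le> \<bar>s - t\<bar> * (\<omega> \<bar>s - t\<bar> * h1_norm \<eta>)"
      unfolding X_def[symmetric]
    proof (cases "X \<eta> = 0")
      case True
      then show "cmod (X \<eta>) \<le> \<bar>s - t\<bar> * (\<omega> \<bar>s - t\<bar> * h1_norm \<eta>)" using re[OF \<eta>] by simp
    next
      case False
      define c where "c = cnj (sgn (X \<eta>))"
      have c: "cmod c = 1" using False by (simp add: c_def norm_sgn)
      have "c * X \<eta> = of_real (cmod (X \<eta>))"
      proof -
        have sq: "cnj (X \<eta>) * X \<eta> = of_real ((cmod (X \<eta>))\<^sup>2)"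
          using complex_norm_square[of "X \<eta>"] by (simp add: mult.commute)
        have "c * X \<eta> = of_real (inverse (cmod (X \<eta>))) * (cnj (X \<eta>) * X \<eta>)"
          by (simp add: c_def sgn_div_norm scaleR_conv_of_real mult.assoc)
        then show ?thesis unfolding sq using False by (simp add: power2_eq_square)
      qed
      then have "cmod (X \<eta>) = Re (X (cscale c \<eta>))" by (simp add: lin)
      also have "\<dots> \<le> \<bar>s - t\<bar> * (\<omega> \<bar>s - t\<bar> * h1_norm (cscale c \<eta>))" using re[OF h1_cscale(1)[OF \<eta>], of c] by linarith
      finally show "cmod (X \<eta>) \<le> \<bar>s - t\<bar> * (\<omega> \<bar>s - t\<bar> * h1_norm \<eta>)" using \<eta> c by (simp add: h1_norm_cscale)
    qed
  qed
qed

text \<open>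
  Complex conjugation reverses time. As the datum is real and the coefficient of the
  nonlinearity will be even in time, reflection extends the solution to negative times.
\<close>

definition \<psi> :: "real \<Rightarrow> l2" where "\<psi> t = (if t \<ge> 0 then \<Phi> t else conjug (\<Phi> (- t)))"
definition nl :: "real \<Rightarrow> l2" where "nl t = (if t \<ge> 0 then N t (\<Phi> t) else conjug (N (- t) (\<Phi> (- t))))"
definition \<Theta> :: "real \<Rightarrow> l2 \<Rightarrow> complex" where
  "\<Theta> t \<eta> = - \<i> * (pair (dx (\<psi> t)) (dx \<eta>) - pair (nl t) \<eta>)"

lemma h1_\<psi>: "h1 (\<psi> t)"
  by (simp add: \<psi>_def h1_\<Phi> h1_conjug)
lemma norm_\<psi>: "norm (\<psi> t) = norm \<phi>0"
  by (simp add: \<psi>_def norm_\<Phi>)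

lemma same_sign: obtains d :: real where "d > 0" "\<And>s. \<bar>s - t\<bar> < d \<Longrightarrow> 0 \<le> s \<and> 0 \<le> t \<or> s \<le> 0 \<and> t \<le> (0::real)"
  by (rule that[of "if t = 0 then 1 else \<bar>t\<bar>"]) (auto split: if_splits)

lemma continuous_at_0_small:
  fixes \<omega> :: "real \<Rightarrow> real"
  assumes "continuous_on {0..} \<omega>" "\<omega> 0 = 0" "e > 0"
  obtains d where "d > 0" "\<And>\<tau>. 0 \<le> \<tau> \<Longrightarrow> \<tau> < d \<Longrightarrow> \<omega> \<tau> \<le> e"
proof -
  obtain d where d: "d > 0" "\<forall>x'\<in>{0..}. dist x' 0 < d \<longrightarrow> dist (\<omega> x') (\<omega> 0) < e"
    using assms unfolding continuous_on_iff by (metis atLeast_iff order_refl)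
  show thesis by (rule that[OF d(1)]) (use d(2) assms(2) in \<open>auto simp: dist_real_def\<close>)
qed

lemma \<psi>_continuous:
  shows "((\<lambda>s. h1_norm (\<psi> s - \<psi> t)) \<longlongrightarrow> 0) (at t)"
proof -
  define T where "T = \<bar>t\<bar> + 1"
  have T: "T \<ge> 0" by (simp add: T_def)
  obtain V where V: "V \<ge> 0" "\<And>s t. 0 \<le> s \<Longrightarrow> s \<le> T \<Longrightarrow> 0 \<le> t \<Longrightarrow> t \<le> T \<Longrightarrow> norm (\<Phi> s - \<Phi> t) \<le> V * \<bar>s - t\<bar>"
    using \<Phi>_lipschitz[OF T] by metis
  obtain K where K: "K \<ge> 0" "\<And>s t. 0 \<le> s \<Longrightarrow> s \<le> T \<Longrightarrow> 0 \<le> t \<Longrightarrow> t \<le> T \<Longrightarrow> norm (dx (\<Phi> s) - dx (\<Phi> t)) \<le> sqrt (K * \<bar>s - t\<bar>)"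
    using dx_\<Phi>_modulus[OF T] by metis
  define m where "m \<tau> = V * \<tau> + sqrt (K * \<tau>)" for \<tau>
  have pos: "h1_norm (\<Phi> s - \<Phi> t) \<le> m \<bar>s - t\<bar>" if st: "0 \<le> s" "s \<le> T" "0 \<le> t" "t \<le> T" for s t
    using norm_Pair_le[of "\<Phi> s - \<Phi> t" "dx (\<Phi> s) - dx (\<Phi> t)"] V(2)[OF st] K(2)[OF st]
    by (simp add: h1_norm_def m_def h1_diff(2)[OF h1_\<Phi>[OF st(1)] h1_\<Phi>[OF st(3)]])
  obtain d where d: "d > 0" "\<And>s. \<bar>s - t\<bar> < d \<Longrightarrow> 0 \<le> s \<and> 0 \<le> t \<or> s \<le> 0 \<and> t \<le> 0"
    using same_sign[of t] by metis
  have cj0: "conjug (\<Phi> 0) = \<Phi> 0 \<Longrightarrow> \<psi> t = conjug (\<Phi> (- t))" if "t \<le> 0" for t using that by (cases "t = 0") (auto simp: \<psi>_def)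
  have ev: "\<forall>\<^sub>F s in at t. \<bar>s - t\<bar> < min 1 d"
    unfolding eventually_at using d(1) by (intro exI[of _ "min 1 d"]) (auto simp: dist_real_def)
  have neg: "h1_norm (conjug (\<Phi> (- s)) - conjug (\<Phi> (- t))) \<le> m \<bar>s - t\<bar>" if "s \<le> 0" "t \<le> 0" "- s \<le> T" "- t \<le> T" for s t
  proof -
    have "h1_norm (conjug (\<Phi> (- s)) - conjug (\<Phi> (- t))) = h1_norm (\<Phi> (- s) - \<Phi> (- t))"
      using h1_diff(1)[OF h1_\<Phi>[of "-s"] h1_\<Phi>[of "-t"]] that by (simp add: conjug_diff[symmetric] h1_norm_conjug)
    also have "\<dots> \<le> m \<bar>- s - - t\<bar>" by (rule pos) (use that in auto)
    finally show ?thesis by (simp add: abs_minus_commute)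
  qed
  show ?thesis
  proof (rule Lim_null_comparison)
    have "((\<lambda>s. m \<bar>s - t\<bar>) \<longlongrightarrow> V * \<bar>t - t\<bar> + sqrt (K * \<bar>t - t\<bar>)) (at t)"
      unfolding m_def by (intro tendsto_intros)
    then show "((\<lambda>s. m \<bar>s - t\<bar>) \<longlongrightarrow> 0) (at t)" by simp
    show "\<forall>\<^sub>F s in at t. norm (h1_norm (\<psi> s - \<psi> t)) \<le> m \<bar>s - t\<bar>"
      using ev
    proof eventually_elim
      case (elim s)
      have sT: "\<bar>s\<bar> \<le> T" "\<bar>t\<bar> \<le> T" using elim by (auto simp: T_def)
      consider "0 \<le> s" "0 \<le> t" | "s \<le> 0" "t \<le> 0" using d(2)[of s] elim by auto
      then have "h1_norm (\<psi> s - \<psi> t) \<le> m \<bar>s - t\<bar>"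
      proof cases
        case 1 then show ?thesis using pos[of s t] sT by (simp add: \<psi>_def)
      next
        case 2 then show ?thesis using neg[of s t] sT cj0[of s] cj0[of t] real_data by (simp add: \<Phi>_0)
      qed
      then show ?case by simp
    qed
  qed
qed

text \<open>
  For times of equal sign the estimate is that on the half-line, up to conjugation. At \<open>t = 0\<close>
  both signs of \<open>s\<close> occur, and the two descriptions of \<open>\<psi> 0\<close> and of the functional agree
  because the datum is real.
\<close>

lemma \<psi>_increment:
  assumes e: "e > 0"
  shows "\<forall>\<^sub>F s in at t. \<forall>\<eta>. h1 \<eta> \<longrightarrow> cmod (pair (\<psi> s - \<psi> t) \<eta> - of_real (s - t) * \<Theta> t \<eta>) \<le> \<bar>s - t\<bar> * (e * h1_norm \<eta>)"
proof -
  define T where "T = \<bar>t\<bar> + 1"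
  have T: "T \<ge> 0" by (simp add: T_def)
  obtain \<omega> where \<omega>: "continuous_on {0..} \<omega>" "\<omega> 0 = 0"
    "\<And>s t \<eta>. 0 \<le> s \<Longrightarrow> s \<le> T \<Longrightarrow> 0 \<le> t \<Longrightarrow> t \<le> T \<Longrightarrow> h1 \<eta> \<Longrightarrow>
      cmod (pair (\<Phi> s - \<Phi> t) \<eta> - of_real (s - t) * \<Lambda> t \<eta>) \<le> \<bar>s - t\<bar> * (\<omega> \<bar>s - t\<bar> * h1_norm \<eta>)"
    using complex_increment[OF T] by metis
  obtain d1 where d1: "d1 > 0" "\<And>\<tau>. 0 \<le> \<tau> \<Longrightarrow> \<tau> < d1 \<Longrightarrow> \<omega> \<tau> \<le> e"
    using continuous_at_0_small[OF \<omega>(1,2) e] by metis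
  obtain d where d: "d > 0" "\<And>s. \<bar>s - t\<bar> < d \<Longrightarrow> 0 \<le> s \<and> 0 \<le> t \<or> s \<le> 0 \<and> t \<le> 0"
    using same_sign[of t] by metis
  define D' where "D' = min 1 (min d d1)"
  have pos: "cmod (pair (\<Phi> s - \<Phi> t) \<eta> - of_real (s - t) * \<Lambda> t \<eta>) \<le> \<bar>s - t\<bar> * (e * h1_norm \<eta>)"
    if "0 \<le> s" "s \<le> T" "0 \<le> t" "t \<le> T" "h1 \<eta>" "\<bar>s - t\<bar> < d1" for s t \<eta>
    by (rule order_trans[OF \<omega>(3)[OF that(1-5)]]) (intro mult_left_mono mult_right_mono d1(2) that h1_norm_nonneg abs_ge_zero)
  have cjN: "conjug (N 0 (\<Phi> 0)) = N 0 (\<Phi> 0)" by (simp add: \<Phi>_0 N_conjug[symmetric] real_data)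
  have n\<psi>: "\<psi> t = conjug (\<Phi> (- t))" and nnl: "nl t = conjug (N (- t) (\<Phi> (- t)))" if "t \<le> 0" for t
    using that by (cases "t = 0"; simp add: \<psi>_def nl_def cjN; simp add: \<Phi>_0 real_data)+
  have "\<forall>\<^sub>F s in at t. \<bar>s - t\<bar> < D'"
    unfolding eventually_at using d(1) d1(1) by (intro exI[of _ D']) (auto simp: dist_real_def D'_def)
  then show ?thesis
  proof eventually_elim
    case (elim s)
    have sT: "\<bar>s\<bar> \<le> T" "\<bar>t\<bar> \<le> T" "\<bar>s - t\<bar> < d1" "\<bar>s - t\<bar> < d" using elim by (auto simp: T_def D'_def)
    show ?case
    proof (intro allI impI)
      fix \<eta> assume \<eta>: "h1 \<eta>"
      consider "0 \<le> s" "0 \<le> t" | "s \<le> 0" "t \<le> 0" using d(2)[OF sT(4)] by auto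
      then show "cmod (pair (\<psi> s - \<psi> t) \<eta> - of_real (s - t) * \<Theta> t \<eta>) \<le> \<bar>s - t\<bar> * (e * h1_norm \<eta>)"
      proof cases
        case 1
        then show ?thesis using pos[of s t \<eta>] sT \<eta> by (simp add: \<psi>_def \<Theta>_def nl_def \<Lambda>_def)
      next
        case 2
        have "\<Theta> t \<eta> = - cnj (\<Lambda> (- t) (conjug \<eta>))"
          using 2 \<eta> h1_\<Phi>[of "-t"]
          by (simp add: \<Theta>_def \<Lambda>_def n\<psi> nnl h1_conjug pair_conjug_conjug[symmetric] algebra_simps)
        moreover have "pair (\<psi> s - \<psi> t) \<eta> = cnj (pair (\<Phi> (- s) - \<Phi> (- t)) (conjug \<eta>))"
          using 2 by (simp add: n\<psi> conjug_diff[symmetric] pair_conjug_conjug[symmetric])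
        ultimately have "pair (\<psi> s - \<psi> t) \<eta> - of_real (s - t) * \<Theta> t \<eta> =
            cnj (pair (\<Phi> (- s) - \<Phi> (- t)) (conjug \<eta>) - of_real (- s - - t) * \<Lambda> (- t) (conjug \<eta>))"
          by (simp add: algebra_simps)
        then have "cmod (pair (\<psi> s - \<psi> t) \<eta> - of_real (s - t) * \<Theta> t \<eta>) =
            cmod (pair (\<Phi> (- s) - \<Phi> (- t)) (conjug \<eta>) - of_real (- s - - t) * \<Lambda> (- t) (conjug \<eta>))"
          by (simp only: complex_mod_cnj)
        also have "\<dots> \<le> \<bar>- s - - t\<bar> * (e * h1_norm (conjug \<eta>))"
          by (rule pos) (use 2 sT \<eta> in \<open>auto simp: h1_conjug\<close>)
        finally show ?thesis using \<eta> by (simp add: h1_norm_conjug abs_minus_commute)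
      qed
    qed
  qed
qed

text \<open>
  The supremum of \<open>|\<Phi>|\<^sup>2\<close> is bounded by \<open>4 \<parallel>\<Phi>\<parallel> \<parallel>\<Phi>\<^sub>x\<parallel>\<close>, whose square grows like \<open>R\<^sup>2 \<rho>\<^sup>3\<close> by
  the energy estimate, whereas the fourth power of the truncation height is \<open>R\<^sup>4 \<rho>\<^sup>4\<close>.
\<close>

lemma truncation_inactive:
  assumes t: "t \<ge> 0"
  shows "AE x in lebesgue. fn (N t (\<Phi> t)) x = of_real (g * \<rho> t * (cmod (fn (\<Phi> t) x))\<^sup>2) * fn (\<Phi> t) x"
proof -
  define y where "y = inverse (r t) *\<^sub>R \<Phi> t"
  have p: "\<rho> t \<ge> 1" "R \<ge> 1" "r t > 0" using \<rho>_ge[OF t] R_ge r_pos[OF t] by auto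
  define B where "B = (norm (dx \<phi>0))\<^sup>2"
  have B: "B \<ge> 0" by (simp add: B_def)
  have key: "4 * norm (\<Phi> t) * norm (dx (\<Phi> t)) \<le> (r t)\<^sup>2"
  proof (rule power2_le_imp_le)
    have "(4 * norm (\<Phi> t) * norm (dx (\<Phi> t)))\<^sup>2 = 16 * q * (norm (dx (\<Phi> t)))\<^sup>2"
      by (simp add: power_mult_distrib norm_\<Phi>[OF t] q_def)
    also have "\<dots> \<le> 16 * q * (B + 5 * \<bar>g\<bar> * R\<^sup>2 * q * \<rho> t ^ 3)"
      unfolding B_def by (intro mult_left_mono dx_\<Phi>_bound t) (simp add: q_nonneg)
    also have "\<dots> = 16 * q * B * 1 + 80 * \<bar>g\<bar> * q\<^sup>2 * (R\<^sup>2 * \<rho> t ^ 3)" by (simp add: power2_eq_square algebra_simps)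
    also have "\<dots> \<le> 16 * q * B * (R\<^sup>2 * \<rho> t ^ 4) + 80 * \<bar>g\<bar> * q\<^sup>2 * (R\<^sup>2 * \<rho> t ^ 4)"
    proof (intro add_mono mult_left_mono)
      show "1 \<le> R\<^sup>2 * \<rho> t ^ 4" using mult_mono[of 1 "R\<^sup>2" 1 "\<rho> t ^ 4"] p by (simp add: one_le_power)
      show "\<rho> t ^ 3 \<le> \<rho> t ^ 4" using p by (intro power_increasing) auto
    qed (use q_nonneg B in auto)
    also have "\<dots> = (16 * q * B + 80 * \<bar>g\<bar> * q\<^sup>2) * (R\<^sup>2 * \<rho> t ^ 4)" by (simp add: algebra_simps)
    also have "\<dots> \<le> R\<^sup>2 * (R\<^sup>2 * \<rho> t ^ 4)"
    proof (rule mult_right_mono)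
      have "16 * q * B + 80 * \<bar>g\<bar> * q\<^sup>2 \<le> R" using R_large by (simp add: B_def q_def)
      also have "R \<le> R\<^sup>2" using p by (simp add: power2_eq_square)
      finally show "16 * q * B + 80 * \<bar>g\<bar> * q\<^sup>2 \<le> R\<^sup>2" .
    qed simp
    also have "\<dots> = ((r t)\<^sup>2)\<^sup>2" by (simp add: r_def power_mult_distrib eval_nat_numeral)
    finally show "(4 * norm (\<Phi> t) * norm (dx (\<Phi> t)))\<^sup>2 \<le> ((r t)\<^sup>2)\<^sup>2" .
  qed simp
  have le: "AE x in lebesgue. cmod (fn (\<Phi> t) x) \<le> r t"
    using sup_bound[OF h1_\<Phi>[OF t]]
    by eventually_elim (use key p in \<open>auto intro: power2_le_imp_le order_trans\<close>)
  have ya: "AE x in lebesgue. fn y x = inverse (r t) *\<^sub>R fn (\<Phi> t) x" unfolding y_def by (rule fn_scaleR)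
  have y1: "AE x in lebesgue. cmod (fn y x) \<le> 1"
    using le ya by eventually_elim (use p in \<open>simp add: divide_simps\<close>)
  have coef: "d t * ((inverse (r t))\<^sup>2 * inverse (r t)) = g * \<rho> t"
    using p by (simp add: d_def r_def field_simps eval_nat_numeral)
  have "AE x in lebesgue. fn (N t (\<Phi> t)) x = d t *\<^sub>R fn (F y) x"
    unfolding N_def y_def[symmetric] by (rule fn_scaleR)
  then show ?thesis using F_eq_cubic[OF y1] ya
  proof eventually_elim
    case (elim x)
    have "fn (N t (\<Phi> t)) x = of_real (d t * ((inverse (r t))\<^sup>2 * inverse (r t))) * (of_real ((cmod (fn (\<Phi> t) x))\<^sup>2) * fn (\<Phi> t) x)"
      unfolding elim using p by (simp add: scaleR_conv_of_real power_mult_distrib norm_mult norm_inverse mult_ac)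
    then show ?case unfolding coef by (simp add: mult_ac)
  qed
qed

lemma nl_cubic: "AE x in lebesgue. fn (nl t) x = of_real (g * \<rho> \<bar>t\<bar> * (cmod (fn (\<psi> t) x))\<^sup>2) * fn (\<psi> t) x"
proof (cases "t \<ge> 0")
  case True
  then show ?thesis using truncation_inactive[OF True] by (simp add: nl_def \<psi>_def)
next
  case False
  then have "-t \<ge> 0" by simp
  from truncation_inactive[OF this] fn_conjug[of "N (-t) (\<Phi> (-t))"] fn_conjug[of "\<Phi> (-t)"] show ?thesis
    by eventually_elim (use False in \<open>simp add: nl_def \<psi>_def\<close>)
qed

end

section \<open>Growth at and above the threshold\<close>

lemma second_difference_bound:
  fixes f f' f'' :: "real \<Rightarrow> real"
  assumes d1: "\<And>x. (f has_real_derivative f' x) (at x)" and d2: "\<And>x. (f' has_real_derivative f'' x) (at x)"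
    and B: "\<And>y. \<bar>y - x\<bar> \<le> 1 \<Longrightarrow> \<bar>f'' y\<bar> \<le> B" and h: "0 < h" "h \<le> 1"
  shows "\<bar>(f x - f (h + x)) + (f x - f (- h + x))\<bar> \<le> 2 * B * h\<^sup>2"
proof -
  have B0: "B \<ge> 0" using B[of x] by simp
  have l: "\<bar>f' (x + y) - f' (x - y)\<bar> \<le> B * (2 * y)" if "0 \<le> y" "y \<le> h" for y
  proof -
    have "norm (f' (x + y) - f' (x - y)) \<le> B * norm ((x + y) - (x - y))"
    proof (rule field_differentiable_bound[of "{x-1..x+1}" f' f''])
      show "(f' has_field_derivative f'' z) (at z within {x - 1..x + 1})" for z
        using d2 by (rule has_field_derivative_at_within)
      show "norm (f'' z) \<le> B" if "z \<in> {x - 1..x + 1}" for z using B[of z] that by (auto simp: abs_le_iff)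
    qed (use that h in auto)
    then show ?thesis using that by simp
  qed
  have "norm ((f (x + h) + f (x - h)) - (f (x + 0) + f (x - 0))) \<le> (B * (2 * h)) * norm (h - 0)"
  proof (rule field_differentiable_bound[of "{0..h}" "\<lambda>y. f (x + y) + f (x - y)" "\<lambda>y. f' (x + y) - f' (x - y)"])
    fix y assume y: "y \<in> {0..h}"
    show "((\<lambda>y. f (x + y) + f (x - y)) has_field_derivative f' (x + y) - f' (x - y)) (at y within {0..h})"
      by (auto intro!: derivative_eq_intros DERIV_chain2[OF d1])
    have "\<bar>f' (x + y) - f' (x - y)\<bar> \<le> B * (2 * y)" using l y by auto
    also have "\<dots> \<le> B * (2 * h)" using y B0 by (intro mult_left_mono) auto
    finally show "norm (f' (x + y) - f' (x - y)) \<le> B * (2 * h)" by simp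
  qed (use h in auto)
  then have "\<bar>f (x + h) + f (x - h) - 2 * f x\<bar> \<le> 2 * B * h\<^sup>2"
    using h by (simp add: power2_eq_square mult_ac)
  moreover have "(f x - f (h + x)) + (f x - f (- h + x)) = - (f (x + h) + f (x - h) - 2 * f x)"
    by (simp add: add.commute[of h] add.commute[of "-h"])
  ultimately show ?thesis by simp
qed

lemma fn_A: "AE x in lebesgue. fn (A n f) x = ((fn f x - fn f (mesh n + x)) + (fn f x - fn f (- mesh n + x))) /\<^sub>R (mesh n)\<^sup>2"
  unfolding A_def
  using fn_scaleR[of "inverse ((mesh n)\<^sup>2)" "(f - shift (mesh n) f) + (f - shift (- mesh n) f)"]
    fn_plus[of "f - shift (mesh n) f" "f - shift (- mesh n) f"] fn_minus[of f "shift (mesh n) f"] fn_minus[of f "shift (- mesh n) f"]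
    fn_shift[of "mesh n" f] fn_shift[of "- mesh n" f]
  by eventually_elim simp

text \<open>
  A smooth bump: its second differences are bounded by twice the maximum of the second
  derivative and vanish outside \<open>[-1, 2]\<close>, as all steps are at most \<open>1\<close>.
\<close>

lemma initial_datum:
  obtains f C where "\<And>n. norm (A n f) \<le> C" "conjug f = f" "f \<noteq> 0"
proof -
  define c where "c = bump 1 0"
  have smc: "smooth_expr c" using smooth_expr_bump[of 1 0 0] by (simp add: c_def)
  obtain c' where c': "smooth_expr c'" "\<And>x. (c has_real_derivative c' x) (at x)" using smooth_expr_deriv[OF smc] by blast
  obtain c'' where c'': "smooth_expr c''" "\<And>x. (c' has_real_derivative c'' x) (at x)" using smooth_expr_deriv[OF c'(1)] by blast
  have "continuous_on {-2..3} c''"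
    using smooth_expr_differentiable[OF c''(1)] by (intro continuous_at_imp_continuous_on) (auto intro: field_differentiable_imp_continuous_at)
  then have "compact (c'' ` {-2..3})" by (intro compact_continuous_image) auto
  then obtain B where B: "B > 0" "\<forall>x\<in>{-2..3}. \<bar>c'' x\<bar> \<le> B"
    using compact_imp_bounded[of "c'' ` {-2..3}"] unfolding bounded_pos by auto
  have z: "c x = 0" if "x \<le> 0 \<or> 1 \<le> x" for x using bump_0[OF that] by (simp add: c_def)
  have m: "c \<in> borel_measurable borel" unfolding c_def by (intro borel_measurable_continuous_onI continuous_bump)
  have L: "L2 (\<lambda>x. of_real (c x))"
    by (rule L2_weight[OF m, of 1 0 1]) (use bump_bounds[of 1 0] z in \<open>auto simp: c_def\<close>)
  define f where "f = mk (\<lambda>x. of_real (c x))"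
  have ff: "AE x in lebesgue. fn f x = of_real (c x)" unfolding f_def by (rule fn_mk[OF L])
  have "norm (A n f) \<le> sqrt (12 * B\<^sup>2)" for n
  proof (rule real_le_rsqrt)
    have pw: "\<bar>((c x - c (mesh n + x)) + (c x - c (- mesh n + x))) / (mesh n)\<^sup>2\<bar> \<le> 2 * B * indicator {-1..2} x" for x
    proof (cases "x \<in> {-1..2}")
      case True
      have "\<bar>(c x - c (mesh n + x)) + (c x - c (- mesh n + x))\<bar> \<le> 2 * B * (mesh n)\<^sup>2"
      proof (rule second_difference_bound[OF c'(2) c''(2)])
        fix y assume "\<bar>y - x\<bar> \<le> 1"
        then have "y \<in> {-2..3}" using True by (auto simp: abs_le_iff)
        then show "\<bar>c'' y\<bar> \<le> B" using B(2) by blast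
      qed auto
      then show ?thesis using True by (simp add: abs_divide pos_divide_le_eq)
    next
      case False
      have "c x = 0" "c (mesh n + x) = 0" "c (- mesh n + x) = 0"
        by (rule z; use False mesh_pos(1)[of n] mesh_le_1[of n] in \<open>simp only: atLeastAtMost_iff de_Morgan_conj not_le, linarith\<close>)+
      then show ?thesis using B(1) by simp
    qed
    have "(norm (A n f))\<^sup>2 \<le> (\<integral>x. (2 * B)\<^sup>2 * indicator {-1..2::real} x \<partial>lebesgue)"
      unfolding norm_l2_sq
    proof (rule integral_mono_AE)
      show "AE x in lebesgue. (cmod (fn (A n f) x))\<^sup>2 \<le> (2 * B)\<^sup>2 * indicator {-1..2} x"
        using fn_A[of n f] ff AE_shift[OF ff, of "mesh n"] AE_shift[OF ff, of "- mesh n"]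
      proof eventually_elim
        case (elim x)
        have "fn (A n f) x = of_real (((c x - c (mesh n + x)) + (c x - c (- mesh n + x))) / (mesh n)\<^sup>2)"
          unfolding elim by (simp add: scaleR_conv_of_real divide_inverse mult.commute)
        then have "cmod (fn (A n f) x) \<le> 2 * B * indicator {-1..2} x" using pw[of x] by (simp only: norm_of_real)
        then have "(cmod (fn (A n f) x))\<^sup>2 \<le> (2 * B * indicator {-1..2} x)\<^sup>2" by (intro power_mono) auto
        also have "\<dots> = (2 * B)\<^sup>2 * indicator {-1..2} x" by (simp add: indicator_def)
        finally show ?case .
      qed
      show "integrable lebesgue (\<lambda>x. (2 * B)\<^sup>2 * indicator {-1..2::real} x)"
        by (intro integrable_mult_right integrable_real_indicator) (auto simp: emeasure_lborel_Icc_eq)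
    qed (rule L2_integrable[OF L2_fn])
    also have "\<dots> = 12 * B\<^sup>2" by (simp add: measure_completion power_mult_distrib)
    finally show "(norm (A n f))\<^sup>2 \<le> 12 * B\<^sup>2" .
  qed
  moreover have "conjug f = f" unfolding f_def by (simp add: conjug_mk[OF L])
  moreover have "f \<noteq> 0"
  proof
    assume "f = 0"
    then have "AE x in lebesgue. c x = 0" using ff fn_0 by (auto elim: eventually_elim2)
    then have "AE x in lebesgue. x \<notin> {0<..<1::real}"
    proof eventually_elim
      case (elim x)
      have "c x > 0" if "0 < x" "x < 1" using that by (simp add: c_def bump_def flat_exp_def)
      then show ?case using elim by force
    qed
    then have "{0<..<1::real} \<in> null_sets lebesgue" by (subst AE_iff_null_sets) auto
    then show False by (simp add: null_sets_def)
  qed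
  ultimately show thesis by (rule that)
qed

text \<open>
  The coupling matrix \<open>M\<close> has square \<open>\<nu>\<^sup>2 = \<gamma>\<^sup>2 - \<kappa>\<^sup>2\<close>, and \<open>c + s M\<close> with \<open>c = cosh (\<nu> t)\<close>,
  \<open>s = sinh (\<nu> t) / \<nu>\<close> (or \<open>c = 1\<close>, \<open>s = t\<close> if \<open>\<nu> = 0\<close>) is its exponential. The functions \<open>a\<close>,
  \<open>b\<close> are the components of the solution with initial value \<open>(1, 1)\<close>; by this symmetric choice
  \<open>\<rho> = |a|\<^sup>2 + |b|\<^sup>2\<close> is even in time.
\<close>

locale linear_factors =
  fixes \<gamma> \<kappa> \<nu> :: real and c s :: "real \<Rightarrow> real"
  assumes pos: "\<gamma> > 0" "\<kappa> > 0" and \<nu>: "\<nu>\<^sup>2 = \<gamma>\<^sup>2 - \<kappa>\<^sup>2"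
    and c: "\<And>t. (c has_real_derivative \<nu>\<^sup>2 * s t) (at t)" and s: "\<And>t. (s has_real_derivative c t) (at t)"
    and c_ge: "\<And>t. c t \<ge> 1" and s0: "s 0 = 0" and even: "\<And>t. c (- t) = c t" "\<And>t. s (- t) = - s t"
begin

definition a :: "real \<Rightarrow> complex" where "a t = of_real (c t) + of_real (s t) * (of_real \<gamma> - \<i> * of_real \<kappa>)"
definition b :: "real \<Rightarrow> complex" where "b t = of_real (c t) + of_real (s t) * (- of_real \<gamma> - \<i> * of_real \<kappa>)"
definition a' :: "real \<Rightarrow> complex" where "a' t = of_real (\<nu>\<^sup>2 * s t) + of_real (c t) * (of_real \<gamma> - \<i> * of_real \<kappa>)"
definition b' :: "real \<Rightarrow> complex" where "b' t = of_real (\<nu>\<^sup>2 * s t) + of_real (c t) * (- of_real \<gamma> - \<i> * of_real \<kappa>)"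
definition \<rho> :: "real \<Rightarrow> real" where "\<rho> t = 2 * (c t)\<^sup>2 + 2 * (\<gamma>\<^sup>2 + \<kappa>\<^sup>2) * (s t)\<^sup>2"
definition \<rho>' :: "real \<Rightarrow> real" where "\<rho>' t = 4 * (\<nu>\<^sup>2 + \<gamma>\<^sup>2 + \<kappa>\<^sup>2) * (c t * s t)"

lemma of_real_deriv: "(f has_real_derivative f') (at t) \<Longrightarrow> ((\<lambda>t. complex_of_real (f t)) has_vector_derivative of_real f') (at t)"
  using bounded_linear.has_vector_derivative[OF bounded_linear_of_real, of f f' "at t"]
  by (simp add: has_real_derivative_iff_has_vector_derivative)

lemma a_deriv: "(a has_vector_derivative a' t) (at t)"
  unfolding a_def a'_def
  by (intro has_vector_derivative_add has_vector_derivative_mult_left of_real_deriv c s)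
lemma b_deriv: "(b has_vector_derivative b' t) (at t)"
  unfolding b_def b'_def
  by (intro has_vector_derivative_add has_vector_derivative_mult_left of_real_deriv c s)

lemma a_eq: "\<i> * a' t = of_real \<kappa> * b t + \<i> * of_real \<gamma> * a t"
  unfolding a'_def a_def b_def \<nu> by (simp add: complex_eq_iff power2_eq_square algebra_simps)
lemma b_eq: "\<i> * b' t = of_real \<kappa> * a t - \<i> * of_real \<gamma> * b t"
  unfolding b'_def a_def b_def \<nu> by (simp add: complex_eq_iff power2_eq_square algebra_simps)
lemma norm_ab: "(cmod (a t))\<^sup>2 + (cmod (b t))\<^sup>2 = \<rho> t"
  unfolding \<rho>_def cmod_power2 by (simp add: a_def b_def power2_eq_square algebra_simps)

lemma s_ge: assumes "t \<ge> 0" shows "s t \<ge> t"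
proof -
  have "s 0 - 0 \<le> s t - t"
    by (rule DERIV_nonneg_imp_nondecreasing[OF assms]) (auto intro!: exI derivative_eq_intros s c_ge)
  then show ?thesis by (simp add: s0)
qed

lemma \<rho>_ge: "\<rho> t \<ge> 1"
proof -
  have "1 \<le> (c t)\<^sup>2" using c_ge[of t] by (simp add: one_le_power)
  then show ?thesis by (simp add: \<rho>_def add_increasing2)
qed

lemma \<rho>_deriv: "(\<rho> has_real_derivative \<rho>' t) (at t)"
  unfolding \<rho>_def \<rho>'_def
  by (rule derivative_eq_intros c s refl)+ (simp add: algebra_simps)

lemma \<rho>'_ge: "t \<ge> 0 \<Longrightarrow> \<rho>' t \<ge> 0"
  using s_ge[of t] c_ge[of t] \<nu> unfolding \<rho>'_def by (intro mult_nonneg_nonneg) auto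

lemma \<rho>'_cont: "continuous_on S \<rho>'"
  unfolding \<rho>'_def
  by (intro continuous_intros continuous_at_imp_continuous_on ballI DERIV_isCont[OF c] DERIV_isCont[OF s])

lemma \<rho>_even: "\<rho> \<bar>t\<bar> = \<rho> t"
  by (cases "t \<ge> 0") (auto simp: \<rho>_def even)

lemma \<rho>_at_top: "filterlim \<rho> at_top at_top"
proof (rule filterlim_at_top_mono)
  define m where "m = 2 * (\<gamma>\<^sup>2 + \<kappa>\<^sup>2)"
  have m: "m > 0" using pos by (simp add: m_def add_pos_pos)
  show "filterlim (\<lambda>t::real. m * t) at_top at_top"
    by (rule filterlim_tendsto_pos_mult_at_top[OF tendsto_const m filterlim_ident])
  show "\<forall>\<^sub>F t in at_top. m * t \<le> \<rho> t"
    using eventually_ge_at_top[of "1::real"]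
  proof eventually_elim
    case (elim t)
    have "t \<le> (s t)\<^sup>2" using s_ge[of t] elim mult_mono[of 1 "s t" t "s t"] by (simp add: power2_eq_square)
    then have "m * t \<le> m * (s t)\<^sup>2" using m by (intro mult_left_mono) auto
    also have "\<dots> \<le> \<rho> t" by (simp add: \<rho>_def m_def)
    finally show ?case .
  qed
qed

end

lemma linear_factors_exist:
  assumes "\<gamma> > 0" "\<kappa> > 0" "\<kappa> \<le> \<gamma>"
  obtains \<nu> c s where "linear_factors \<gamma> \<kappa> \<nu> c s"
proof -
  define \<nu> where "\<nu> = sqrt (\<gamma>\<^sup>2 - \<kappa>\<^sup>2)"
  have nn: "\<gamma>\<^sup>2 - \<kappa>\<^sup>2 \<ge> 0" using assms power_mono[of \<kappa> \<gamma> 2] by simp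
  have \<nu>: "\<nu>\<^sup>2 = \<gamma>\<^sup>2 - \<kappa>\<^sup>2" using nn by (simp add: \<nu>_def)
  show thesis
  proof (cases "\<nu> = 0")
    case True
    have "linear_factors \<gamma> \<kappa> \<nu> (\<lambda>t. 1) (\<lambda>t. t)"
      by unfold_locales (use assms \<nu> True in \<open>auto intro!: derivative_eq_intros\<close>)
    then show thesis by (rule that)
  next
    case False
    have "linear_factors \<gamma> \<kappa> \<nu> (\<lambda>t. cosh (\<nu> * t)) (\<lambda>t. sinh (\<nu> * t) / \<nu>)"
    proof unfold_locales
      show "((\<lambda>t. cosh (\<nu> * t)) has_real_derivative \<nu>\<^sup>2 * (sinh (\<nu> * t) / \<nu>)) (at t)" for t
        using False by (auto intro!: derivative_eq_intros simp: power2_eq_square)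
      show "((\<lambda>t. sinh (\<nu> * t) / \<nu>) has_real_derivative cosh (\<nu> * t)) (at t)" for t
        using False by (auto intro!: derivative_eq_intros)
    qed (use assms \<nu> in \<open>auto simp: cosh_real_ge_1\<close>)
    then show thesis by (rule that)
  qed
qed

context nls begin

lemma \<Theta>_bound: "h1 \<eta> \<Longrightarrow> cmod (\<Theta> t \<eta>) \<le> (norm (dx (\<psi> t)) + norm (nl t)) * h1_norm \<eta>"
proof -
  have "cmod (\<Theta> t \<eta>) \<le> cmod (pair (dx (\<psi> t)) (dx \<eta>)) + cmod (pair (nl t) \<eta>)"
    unfolding \<Theta>_def norm_mult norm_minus_cancel norm_ii mult_1 by (rule norm_triangle_ineq4)
  also have "\<dots> \<le> norm (dx (\<psi> t)) * h1_norm \<eta> + norm (nl t) * h1_norm \<eta>"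
    by (intro add_mono order_trans[OF cmod_pair_le] mult_left_mono norm_le_h1_norm norm_ge_zero)
  finally show ?thesis by (simp add: distrib_right)
qed

lemma product_H1:
  fixes w :: "real \<Rightarrow> real \<Rightarrow> complex"
  assumes "w = (\<lambda>s. fn (cscale (a s) (\<psi> s)))"
  shows "H1 (w t)" "mk (w t) = cscale (a t) (\<psi> t)"
  using assms by (simp_all add: H1_iff h1_cscale h1_\<psi>)

lemma product_continuous:
  assumes w: "w = (\<lambda>s. fn (cscale (a s) (\<psi> s)))" and a: "\<And>t. isCont a t"
  shows "continuous_H1 w"
  unfolding continuous_H1_def
proof (intro conjI allI)
  fix t
  show "H1 (w t)" by (rule product_H1[OF w])
  have eq: "H1_norm (\<lambda>x. w s x - w t x) \<le> cmod (a s) * h1_norm (\<psi> s - \<psi> t) + cmod (a s - a t) * h1_norm (\<psi> t)" for s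
  proof -
    have "H1_norm (\<lambda>x. w s x - w t x) = h1_norm (cscale (a s) (\<psi> s) - cscale (a t) (\<psi> t))"
      using H1_norm_h1_norm[OF H1_diff[OF product_H1(1)[OF w] product_H1(1)[OF w]]] product_H1[OF w]
      by (simp add: mk_diff H1_iff)
    also have "cscale (a s) (\<psi> s) - cscale (a t) (\<psi> t) = cscale (a s) (\<psi> s - \<psi> t) + cscale (a s - a t) (\<psi> t)"
      using cscale_add_left[of "a s" "- a t" "\<psi> t"] by (simp add: cscale_diff cscale_minus_left)
    also have "h1_norm \<dots> \<le> h1_norm (cscale (a s) (\<psi> s - \<psi> t)) + h1_norm (cscale (a s - a t) (\<psi> t))"
      by (intro h1_norm_add h1_cscale h1_diff h1_\<psi>)
    finally show ?thesis by (simp add: h1_norm_cscale h1_diff h1_\<psi>)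
  qed
  show "((\<lambda>s. H1_norm (\<lambda>x. w s x - w t x)) \<longlongrightarrow> 0) (at t)"
  proof (rule Lim_null_comparison)
    show "\<forall>\<^sub>F s in at t. norm (H1_norm (\<lambda>x. w s x - w t x)) \<le> cmod (a s) * h1_norm (\<psi> s - \<psi> t) + cmod (a s - a t) * h1_norm (\<psi> t)"
      using eq by (intro always_eventually) (simp add: H1_norm_nonneg)
    have "((\<lambda>s. cmod (a s) * h1_norm (\<psi> s - \<psi> t) + cmod (a s - a t) * h1_norm (\<psi> t)) \<longlongrightarrow> cmod (a t) * 0 + cmod (a t - a t) * h1_norm (\<psi> t)) (at t)"
      by (intro tendsto_add tendsto_mult tendsto_norm tendsto_diff tendsto_const \<psi>_continuous a[unfolded isCont_def])
    then show "((\<lambda>s. cmod (a s) * h1_norm (\<psi> s - \<psi> t) + cmod (a s - a t) * h1_norm (\<psi> t)) \<longlongrightarrow> 0) (at t)" by simp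
  qed
qed

text \<open>
  Product rule for a scalar curve and a curve that is differentiable in the dual of \<open>H\<^sup>1\<close>.
\<close>

lemma product_derivative:
  assumes w: "w = (\<lambda>s. fn (cscale (a s) (\<psi> s)))" and a: "(a has_vector_derivative a') (at t)"
  shows "has_Hm1_derivative w (\<lambda>\<eta>. a' * pair (\<psi> t) (mk \<eta>) + a t * \<Theta> t (mk \<eta>)) t"
proof -
  define W where "W \<eta> = a' * pair (\<psi> t) \<eta> + a t * \<Theta> t \<eta>" for \<eta>
  define M where "M = norm (dx (\<psi> t)) + norm (nl t)"
  have M: "M \<ge> 0" by (simp add: M_def)
  have pb: "cmod (pair (\<psi> t) \<eta>) \<le> norm (\<psi> t) * h1_norm \<eta>" for \<eta>
    by (rule order_trans[OF cmod_pair_le]) (intro mult_left_mono norm_le_h1_norm norm_ge_zero)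
  have hm: "Hm1 (\<lambda>\<eta>. W (mk \<eta>))"
    unfolding Hm1_def
  proof (intro conjI allI impI)
    fix \<phi> \<eta> :: "real \<Rightarrow> complex" assume H: "H1 \<phi>" "H1 \<eta>"
    show "W (mk (\<lambda>x. \<phi> x + \<eta> x)) = W (mk \<phi>) + W (mk \<eta>)"
      using H by (simp add: H1_iff mk_add W_def \<Theta>_def h1_add pair_add_right algebra_simps)
  next
    fix k and \<phi> :: "real \<Rightarrow> complex" assume H: "H1 \<phi>"
    show "W (mk (\<lambda>x. k * \<phi> x)) = k * W (mk \<phi>)"
      using H by (simp add: H1_iff cscale_mk[symmetric] W_def \<Theta>_def h1_cscale pair_cscale_right algebra_simps)
  next
    show "\<exists>C. \<forall>\<phi>. H1 \<phi> \<longrightarrow> cmod (W (mk \<phi>)) \<le> C * H1_norm \<phi>"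
    proof (intro exI allI impI)
      fix \<phi> assume H: "H1 \<phi>"
      have "cmod (W (mk \<phi>)) \<le> cmod a' * cmod (pair (\<psi> t) (mk \<phi>)) + cmod (a t) * cmod (\<Theta> t (mk \<phi>))"
        unfolding W_def norm_mult[symmetric] by (rule norm_triangle_ineq)
      also have "\<dots> \<le> cmod a' * (norm (\<psi> t) * h1_norm (mk \<phi>)) + cmod (a t) * (M * h1_norm (mk \<phi>))"
        unfolding M_def using H by (intro add_mono mult_left_mono pb \<Theta>_bound) (auto simp: H1_iff)
      finally show "cmod (W (mk \<phi>)) \<le> (cmod a' * norm (\<psi> t) + cmod (a t) * M) * H1_norm \<phi>"
        by (simp add: H1_norm_h1_norm[OF H] algebra_simps)
    qed
  qed
  have "\<forall>\<^sub>F s in at t. \<forall>\<phi>. H1 \<phi> \<longrightarrow>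
        cmod ((pairing (w s) \<phi> - pairing (w t) \<phi>) / of_real (s - t) - W (mk \<phi>)) \<le> e * H1_norm \<phi>" if e: "e > 0" for e
  proof -
    define K where "K = norm (\<psi> t) + (cmod (a t) + 1) + M + 1"
    have K: "K > 0" unfolding K_def using M by (intro add_nonneg_pos add_nonneg_nonneg) auto
    define d where "d = min 1 (e / K)"
    have d: "d > 0" "d \<le> 1" "d * K \<le> e" using e K by (auto simp: d_def min_def divide_simps split: if_splits)
    have ac: "(a \<longlongrightarrow> a t) (at t)" using has_vector_derivative_continuous[OF a] by (simp add: isCont_def)
    have "((\<lambda>y. (1 / norm (y - t)) *\<^sub>R (a y - (a t + (y - t) *\<^sub>R a'))) \<longlongrightarrow> 0) (at t)"
      using a unfolding has_vector_derivative_def has_derivative_within by blast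
    from tendstoD[OF this d(1)]
    have e1: "\<forall>\<^sub>F s in at t. cmod (a s - a t - of_real (s - t) * a') \<le> d * \<bar>s - t\<bar>"
      unfolding eventually_at_filter
    proof (rule eventually_mono, intro impI)
      fix s assume A: "s \<noteq> t \<longrightarrow> s \<in> UNIV \<longrightarrow> dist ((1 / norm (s - t)) *\<^sub>R (a s - (a t + (s - t) *\<^sub>R a'))) 0 < d" and st: "s \<noteq> t" "s \<in> UNIV"
      then have "cmod (a s - (a t + (s - t) *\<^sub>R a')) / \<bar>s - t\<bar> < d" by simp
      then have "cmod (a s - (a t + (s - t) *\<^sub>R a')) < d * \<bar>s - t\<bar>" using st by (simp add: divide_simps)
      then show "cmod (a s - a t - of_real (s - t) * a') \<le> d * \<bar>s - t\<bar>"
        by (simp add: scaleR_conv_of_real diff_diff_add)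
    qed
    have e2: "\<forall>\<^sub>F s in at t. dist (a s) (a t) < d" by (rule tendstoD[OF ac d(1)])
    have e4: "\<forall>\<^sub>F s in at t. s \<noteq> t" by (simp add: eventually_at_filter)
    from e1 e2 \<psi>_increment[OF d(1), of t] e4 show ?thesis
    proof eventually_elim
      case (elim s)
      show ?case
      proof (intro allI impI)
        fix \<phi> assume H: "H1 \<phi>"
        define \<eta> where "\<eta> = mk \<phi>"
        have h: "h1 \<eta>" "L2 \<phi>" using H by (auto simp: \<eta>_def H1_iff)
        have P: "pairing (w s) \<phi> = a s * pair (\<psi> s) \<eta>" for s
          using pairing_mk[of "w s" \<phi>] h product_H1[OF w] by (simp add: \<eta>_def H1_iff pair_cscale_left)
        let ?X = "pair (\<psi> s - \<psi> t) \<eta> - of_real (s - t) * \<Theta> t \<eta>"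
        have as: "cmod (a s - a t) \<le> d" "cmod (a s) \<le> cmod (a t) + 1"
          using elim(2) d(2) norm_triangle_sub[of "a s" "a t"] by (auto simp: dist_norm)
        have split: "pairing (w s) \<phi> - pairing (w t) \<phi> - of_real (s - t) * W \<eta> =
          (a s - a t - of_real (s - t) * a') * pair (\<psi> t) \<eta> + a s * ?X + of_real (s - t) * ((a s - a t) * \<Theta> t \<eta>)"
          unfolding P W_def pair_diff_left by (simp add: algebra_simps)
        have "cmod (pairing (w s) \<phi> - pairing (w t) \<phi> - of_real (s - t) * W \<eta>) \<le>
          cmod (a s - a t - of_real (s - t) * a') * cmod (pair (\<psi> t) \<eta>) + cmod (a s) * cmod ?X + \<bar>s - t\<bar> * (cmod (a s - a t) * cmod (\<Theta> t \<eta>))"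
          unfolding split by (intro norm_triangle_mono) (simp_all add: norm_mult del: of_real_diff)
        also have "\<dots> \<le> (d * \<bar>s - t\<bar>) * (norm (\<psi> t) * h1_norm \<eta>) + (cmod (a t) + 1) * (\<bar>s - t\<bar> * (d * h1_norm \<eta>)) + \<bar>s - t\<bar> * (d * (M * h1_norm \<eta>))"
          using elim(1,3) as pb[of \<eta>] \<Theta>_bound[OF h(1), of t] h(1) d(1)
          unfolding M_def[symmetric] by (intro add_mono mult_mono mult_left_mono) auto
        also have "\<dots> = \<bar>s - t\<bar> * (d * (norm (\<psi> t) + (cmod (a t) + 1) + M) * h1_norm \<eta>)" by (simp add: algebra_simps)
        also have "\<dots> \<le> \<bar>s - t\<bar> * (e * h1_norm \<eta>)"
        proof (intro mult_left_mono mult_right_mono)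
          have "d * (norm (\<psi> t) + (cmod (a t) + 1) + M) \<le> d * K" using d(1) by (intro mult_left_mono) (auto simp: K_def)
          then show "d * (norm (\<psi> t) + (cmod (a t) + 1) + M) \<le> e" using d(3) by linarith
        qed auto
        finally have le: "cmod (pairing (w s) \<phi> - pairing (w t) \<phi> - of_real (s - t) * W \<eta>) \<le> \<bar>s - t\<bar> * (e * h1_norm \<eta>)" .
        have st: "complex_of_real (s - t) \<noteq> 0" using elim(4) by (simp del: of_real_diff)
        have "(pairing (w s) \<phi> - pairing (w t) \<phi>) / of_real (s - t) - W \<eta> = (pairing (w s) \<phi> - pairing (w t) \<phi> - of_real (s - t) * W \<eta>) / of_real (s - t)"
          using st by (simp add: diff_divide_distrib del: of_real_diff)
        then have "cmod ((pairing (w s) \<phi> - pairing (w t) \<phi>) / of_real (s - t) - W \<eta>) = cmod (pairing (w s) \<phi> - pairing (w t) \<phi> - of_real (s - t) * W \<eta>) / \<bar>s - t\<bar>"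
          by (simp add: norm_divide del: of_real_diff)
        also have "\<dots> \<le> e * h1_norm \<eta>" using le elim(4) by (simp add: divide_simps mult.commute)
        finally show "cmod ((pairing (w s) \<phi> - pairing (w t) \<phi>) / of_real (s - t) - W (mk \<phi>)) \<le> e * H1_norm \<phi>"
          by (simp add: \<eta>_def H1_norm_h1_norm[OF H])
      qed
    qed
  qed
  then show ?thesis using hm unfolding has_Hm1_derivative_def W_def by blast
qed

end

text \<open>
  On \<open>u = a \<psi>\<close>, \<open>v = b \<psi>\<close> the common factor is \<open>g (|a|\<^sup>2 + |b|\<^sup>2) |\<psi>|\<^sup>2 = g \<rho> |\<psi>|\<^sup>2\<close>, so \<open>\<psi>\<close>
  absorbs the kinetic and the nonlinear terms and \<open>(a, b)\<close> the linear coupling.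
\<close>

lemma growing_solution:
  fixes \<gamma> \<kappa> g :: real
  assumes pos: "\<gamma> > 0" "\<kappa> > 0" "\<kappa> \<le> \<gamma>"
  shows "\<exists>u v. global_solution \<gamma> \<kappa> g g g u v \<and>
     filterlim (\<lambda>t. (L2_norm (u t))\<^sup>2 + (L2_norm (v t))\<^sup>2) at_top at_top"
proof -
  obtain f C where f: "\<And>n. norm (A n f) \<le> C" "conjug f = f" "f \<noteq> 0" using initial_datum by metis
  obtain \<nu> c s where "linear_factors \<gamma> \<kappa> \<nu> c s" using linear_factors_exist[OF pos] by metis
  then interpret lf: linear_factors \<gamma> \<kappa> \<nu> c s .
  define R where "R = 1 + (16 * (norm f)\<^sup>2 * (norm (dx f))\<^sup>2 + 80 * \<bar>g\<bar> * ((norm f)\<^sup>2)\<^sup>2)"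
  interpret nls g R lf.\<rho> lf.\<rho>' f C
    by unfold_locales (use f lf.\<rho>_ge lf.\<rho>'_ge lf.\<rho>'_cont in \<open>auto simp: R_def intro: has_field_derivative_at_within lf.\<rho>_deriv\<close>)
  define u where "u = (\<lambda>s. fn (cscale (lf.a s) (\<psi> s)))"
  define v where "v = (\<lambda>s. fn (cscale (lf.b s) (\<psi> s)))"
  note u = product_H1[OF u_def] and v = product_H1[OF v_def]
  have ia: "isCont lf.a t" and ib: "isCont lf.b t" for t
    using has_vector_derivative_continuous[OF lf.a_deriv] has_vector_derivative_continuous[OF lf.b_deriv] by auto
  have G: "pairing (\<lambda>x. of_real (g * (cmod (u t x))\<^sup>2 + g * (cmod (v t x))\<^sup>2) * fn (cscale k (\<psi> t)) x) \<eta> = k * pair (nl t) (mk \<eta>)"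
    if H: "H1 \<eta>" for k t \<eta>
  proof -
    let ?n = "\<lambda>x. of_real (g * (cmod (u t x))\<^sup>2 + g * (cmod (v t x))\<^sup>2) * fn (cscale k (\<psi> t)) x"
    have ae: "AE x in lebesgue. fn (cscale k (nl t)) x = ?n x"
      using fn_cscale[of "lf.a t" "\<psi> t"] fn_cscale[of "lf.b t" "\<psi> t"] fn_cscale[of k "\<psi> t"] fn_cscale[of k "nl t"] nl_cubic[of t]
    proof eventually_elim
      case (elim x)
      let ?z = "fn (\<psi> t) x"
      have "g * (cmod (u t x))\<^sup>2 + g * (cmod (v t x))\<^sup>2 = g * ((cmod (lf.a t))\<^sup>2 + (cmod (lf.b t))\<^sup>2) * (cmod ?z)\<^sup>2"
        by (simp add: u_def v_def elim(1,2) norm_mult power_mult_distrib algebra_simps)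
      also have "\<dots> = g * lf.\<rho> \<bar>t\<bar> * (cmod ?z)\<^sup>2" by (simp add: lf.norm_ab lf.\<rho>_even)
      finally have e: "g * (cmod (u t x))\<^sup>2 + g * (cmod (v t x))\<^sup>2 = g * lf.\<rho> \<bar>t\<bar> * (cmod ?z)\<^sup>2" .
      show ?case unfolding e elim(3,4,5) by (simp add: mult_ac)
    qed
    have m: "?n \<in> borel_measurable lebesgue" unfolding u_def v_def by measurable
    have "pairing ?n \<eta> = pairing (fn (cscale k (nl t))) \<eta>"
      by (rule pairing_cong_AE) (use L2_cong_AE[OF L2_fn m ae] ae H in \<open>auto simp: H1_iff elim: eventually_mono\<close>)
    also have "\<dots> = k * pair (nl t) (mk \<eta>)" using H by (simp add: pairing_mk H1_iff pair_cscale_left)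
    finally show ?thesis .
  qed
  have dxx: "minus_dxx w \<eta> = k * pair (dx (\<psi> t)) (dx (mk \<eta>))" if "H1 w" "mk w = cscale k (\<psi> t)" "H1 \<eta>" for w k t \<eta>
    using that weak_deriv_dx[OF that(1)] weak_deriv_dx[OF that(3)]
    by (simp add: minus_dxx_def pairing_mk h1_cscale h1_\<psi> pair_cscale_left)
  have pr: "pairing w \<eta> = k * pair (\<psi> t) (mk \<eta>)" if "H1 w" "mk w = cscale k (\<psi> t)" "H1 \<eta>" for w k t \<eta>
    using that by (simp add: pairing_mk H1_iff pair_cscale_left)
  have "global_solution \<gamma> \<kappa> g g g u v"
    unfolding global_solution_def
  proof (intro conjI allI)
    show "continuous_H1 u" "continuous_H1 v"
      using product_continuous[OF u_def ia] product_continuous[OF v_def ib] by auto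
    fix t
    define u' where "u' = (\<lambda>\<eta>. lf.a' t * pair (\<psi> t) (mk \<eta>) + lf.a t * \<Theta> t (mk \<eta>))"
    define v' where "v' = (\<lambda>\<eta>. lf.b' t * pair (\<psi> t) (mk \<eta>) + lf.b t * \<Theta> t (mk \<eta>))"
    have eqs: "\<i> * (k' * p + k * (- \<i> * (x - n))) = k * x + of_real \<kappa> * (l * p) + j * (k * p) - k * n"
      if "\<i> * k' = of_real \<kappa> * l + j * k" for k k' l j p x n :: complex
    proof -
      have "\<i> * (k' * p + k * (- \<i> * (x - n))) = (\<i> * k') * p + k * (x - n)" by (simp add: algebra_simps)
      then show ?thesis unfolding that by (simp add: algebra_simps)
    qed
    have "\<i> * u' \<phi> = minus_dxx (u t) \<phi> + of_real \<kappa> * pairing (v t) \<phi> + \<i> * of_real \<gamma> * pairing (u t) \<phi>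
             - pairing (\<lambda>x. of_real (g * (cmod (u t x))\<^sup>2 + g * (cmod (v t x))\<^sup>2) * u t x) \<phi>" if H: "H1 \<phi>" for \<phi>
    proof -
      have "pairing (\<lambda>x. of_real (g * (cmod (u t x))\<^sup>2 + g * (cmod (v t x))\<^sup>2) * u t x) \<phi> = lf.a t * pair (nl t) (mk \<phi>)"
        using G[OF H, of t "lf.a t"] by (simp add: u_def)
      then show ?thesis
        using eqs[OF lf.a_eq[of t], of "pair (\<psi> t) (mk \<phi>)" "pair (dx (\<psi> t)) (dx (mk \<phi>))" "pair (nl t) (mk \<phi>)"]
        by (simp only: u'_def \<Theta>_def dxx[OF u H] pr[OF u H] pr[OF v H])
    qed
    moreover have "\<i> * v' \<phi> = minus_dxx (v t) \<phi> + of_real \<kappa> * pairing (u t) \<phi> - \<i> * of_real \<gamma> * pairing (v t) \<phi>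
             - pairing (\<lambda>x. of_real (g * (cmod (u t x))\<^sup>2 + g * (cmod (v t x))\<^sup>2) * v t x) \<phi>" if H: "H1 \<phi>" for \<phi>
    proof -
      have "pairing (\<lambda>x. of_real (g * (cmod (u t x))\<^sup>2 + g * (cmod (v t x))\<^sup>2) * v t x) \<phi> = lf.b t * pair (nl t) (mk \<phi>)"
        using G[OF H, of t "lf.b t"] by (simp add: v_def)
      moreover have "\<i> * lf.b' t = of_real \<kappa> * lf.a t + (- (\<i> * of_real \<gamma>)) * lf.b t" using lf.b_eq[of t] by simp
      from eqs[OF this, of "pair (\<psi> t) (mk \<phi>)" "pair (dx (\<psi> t)) (dx (mk \<phi>))" "pair (nl t) (mk \<phi>)"]
      have "\<i> * v' \<phi> = lf.b t * pair (dx (\<psi> t)) (dx (mk \<phi>)) + of_real \<kappa> * (lf.a t * pair (\<psi> t) (mk \<phi>))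
         - \<i> * of_real \<gamma> * (lf.b t * pair (\<psi> t) (mk \<phi>)) - lf.b t * pair (nl t) (mk \<phi>)"
        by (simp add: v'_def \<Theta>_def)
      ultimately show ?thesis
        by (simp only: dxx[OF v H] pr[OF u H] pr[OF v H])
    qed
    ultimately show "\<exists>u' v'. has_Hm1_derivative u u' t \<and> has_Hm1_derivative v v' t \<and>
       (\<forall>\<phi>. H1 \<phi> \<longrightarrow>
          \<i> * u' \<phi> = minus_dxx (u t) \<phi> + of_real \<kappa> * pairing (v t) \<phi> + \<i> * of_real \<gamma> * pairing (u t) \<phi>
             - pairing (\<lambda>x. of_real (g * (cmod (u t x))\<^sup>2 + g * (cmod (v t x))\<^sup>2) * u t x) \<phi> \<and>
          \<i> * v' \<phi> = minus_dxx (v t) \<phi> + of_real \<kappa> * pairing (u t) \<phi> - \<i> * of_real \<gamma> * pairing (v t) \<phi>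
             - pairing (\<lambda>x. of_real (g * (cmod (u t x))\<^sup>2 + g * (cmod (v t x))\<^sup>2) * v t x) \<phi>)"
      using product_derivative[OF u_def lf.a_deriv, of t] product_derivative[OF v_def lf.b_deriv, of t]
      unfolding u'_def v'_def by blast
  qed
  moreover have "filterlim (\<lambda>t. (L2_norm (u t))\<^sup>2 + (L2_norm (v t))\<^sup>2) at_top at_top"
  proof -
    have "(L2_norm (u t))\<^sup>2 + (L2_norm (v t))\<^sup>2 = (norm f)\<^sup>2 * lf.\<rho> t" for t
      using u[of t] v[of t] by (simp add: L2_norm_mk H1_iff norm_\<psi> power_mult_distrib lf.norm_ab[symmetric] algebra_simps)
    moreover have "filterlim (\<lambda>t. (norm f)\<^sup>2 * lf.\<rho> t) at_top at_top"
      by (rule filterlim_tendsto_pos_mult_at_top[OF tendsto_const _ lf.\<rho>_at_top]) (use f(3) in simp)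
    ultimately show ?thesis by simp
  qed
  ultimately show ?thesis by blast
qed

theorem theorem2p2:
  fixes \<gamma> \<kappa> g11 g22 g12 :: real
  assumes "\<gamma> > 0" and "\<kappa> > 0" and "g11 = g22" and "g22 = g12"
  shows "(\<gamma> < \<kappa> \<longrightarrow>
      (\<forall>u v. global_solution \<gamma> \<kappa> g11 g22 g12 u v \<longrightarrow>
        (\<exists>Qmax>0. (SUP t. ereal ((L2_norm (u t))\<^sup>2 + (L2_norm (v t))\<^sup>2)) \<le> ereal Qmax))) \<and>
    (\<gamma> \<ge> \<kappa> \<longrightarrow>
      (\<exists>u v. global_solution \<gamma> \<kappa> g11 g22 g12 u v \<and>
        filterlim (\<lambda>t. (L2_norm (u t))\<^sup>2 + (L2_norm (v t))\<^sup>2) at_top at_top))"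
proof (intro conjI impI allI)
  fix u v assume "\<gamma> < \<kappa>" and "global_solution \<gamma> \<kappa> g11 g22 g12 u v"
  then obtain Q where "Q > 0" "\<forall>t. (L2_norm (u t))\<^sup>2 + (L2_norm (v t))\<^sup>2 \<le> Q"
    using mass_bounded[of \<gamma> \<kappa> g12 u v] assms by auto
  then show "\<exists>Qmax>0. (SUP t. ereal ((L2_norm (u t))\<^sup>2 + (L2_norm (v t))\<^sup>2)) \<le> ereal Qmax"
    by (intro exI[of _ Q]) (auto intro!: SUP_least)
next
  assume "\<kappa> \<le> \<gamma>"
  then show "\<exists>u v. global_solution \<gamma> \<kappa> g11 g22 g12 u v \<and>
        filterlim (\<lambda>t. (L2_norm (u t))\<^sup>2 + (L2_norm (v t))\<^sup>2) at_top at_top"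
    using growing_solution[of \<gamma> \<kappa> g12] assms by simp
qed

end
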